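(* For every integer $s\ge 2$, the spin network $(\mathrm{Drum}_s,\gamma)$ with uniform decoration $\gamma\equiv 2$ has spectral radius $\rho_{\mathrm{Drum}_s,\gamma\equiv 2}=3^{3s}$.
   Context: $\mathrm{Drum}_s$ is the cubic ribbon graph with vertices $u_1,\dots,u_s,w_1,\dots,w_s$ and edges $u_iu_{i+1}$, $w_iw_{i+1}$ ($i=1,\dots,s$, indices mod $s$; for $s=2$ these give double edges) and $u_iw_i$ ($i=1,\dots,s$), with the cyclic orderings at vertices induced by its standard planar drawing (cycle $w$ drawn inside cycle $u$, spokes $u_iw_i$). For a cubic ribbon graph $\Gamma$ embedded in a closed orientable surface and an admissible decoration $\gamma:E\to\{0,1,2,\dots\}$ (at each vertex with incident decorations $a,b,c$, $a+b+c$ even and $|a-b|\le c\le a+b$), the Penrose evaluation is defined by: replace each edge $e$ by $\gamma(e)$ parallel strands on the thickened embedded graph; at each vertex with decorations $a,b,c$ join strands without crossings, $\frac{a+b-c}{2}$ between the $a$- and $b$-edges, $\frac{a+c-b}{2}$ between $a$ and $c$, $\frac{b+c-a}{2}$ between $b$ and $c$; insert a permutation $\sigma_e\in\mathfrak S_{\gamma(e)}$ on each edge; $\langle\Gamma,\gamma\rangle^P=\sum_{\vec\sigma}(\prod_e\mathrm{sign}\,\sigma_e)(-2)^{N(\vec\sigma)}$ with $N(\vec\sigma)$ the number of resulting closed curves. Standard evaluation: $\langle\Gamma,\gamma\rangle^S=\langle\Gamma,\gamma\rangle^P\prod_v\big[(\tfrac{a_v+b_v-c_v}{2})!(\tfrac{a_v+c_v-b_v}{2})!(\tfrac{b_v+c_v-a_v}{2})!\big]^{-1}$.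 The spectral radius $\rho_{\Gamma,\gamma}$ is the inverse of the radius of convergence of $\sum_{n\ge0}\langle\Gamma,n\gamma\rangle^S z^n$, where $n\gamma$ is $e\mapsto n\gamma(e)$. *)

theory Defs
  imports "HOL-Analysis.Analysis" "HOL-Combinatorics.Permutations"
begin

text \<open>A cubic ribbon graph is given combinatorially by a finite set of darts (half-edges) D,
  an edge involution alpha (fixed-point free on D; its orbits are the edges) and a rotation
  rot (a permutation of D whose orbits, all of size 3, are the vertices, giving the cyclic
  orderings).  A decoration is a function on darts, constant on edges.\<close>

definition cubic_ribbon_graph :: "'d set \<Rightarrow> ('d \<Rightarrow> 'd) \<Rightarrow> ('d \<Rightarrow> 'd) \<Rightarrow> bool" where
  "cubic_ribbon_graph D alpha rot \<longleftrightarrow> finite D \<and>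
     (\<forall>d\<in>D. alpha d \<in> D \<and> alpha d \<noteq> d \<and> alpha (alpha d) = d) \<and>
     rot permutes D \<and> (\<forall>d\<in>D. rot d \<noteq> d \<and> rot (rot (rot d)) = d)"

definition admissible :: "'d set \<Rightarrow> ('d \<Rightarrow> 'd) \<Rightarrow> ('d \<Rightarrow> 'd) \<Rightarrow> ('d \<Rightarrow> nat) \<Rightarrow> bool" where
  "admissible D alpha rot g \<longleftrightarrow> (\<forall>d\<in>D. g (alpha d) = g d \<and>
     even (g d + g (rot d) + g (rot (rot d))) \<and>
     g (rot (rot d)) \<le> g d + g (rot d) \<and> g d \<le> g (rot d) + g (rot (rot d)) \<and>
     g (rot d) \<le> g d + g (rot (rot d)))"

text \<open>Number of strands joining dart d to the next dart rot d at their common vertex.\<close>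
definition corner :: "('d \<Rightarrow> 'd) \<Rightarrow> ('d \<Rightarrow> nat) \<Rightarrow> 'd \<Rightarrow> nat" where
  "corner rot g d = (g d + g (rot d) - g (rot (rot d))) div 2"

text \<open>Strand end points: (d, i) with i < g d, positions numbered counterclockwise around
  the vertex of d.\<close>
definition strand_pts :: "'d set \<Rightarrow> ('d \<Rightarrow> nat) \<Rightarrow> ('d \<times> nat) set" where
  "strand_pts D g = {(d, i). d \<in> D \<and> i < g d}"

text \<open>Crossingless junction at vertices: nested arcs at each corner.\<close>
definition vmatch :: "('d \<Rightarrow> 'd) \<Rightarrow> ('d \<Rightarrow> nat) \<Rightarrow> 'd \<times> nat \<Rightarrow> 'd \<times> nat" where
  "vmatch rot g x = (case x of (d, i) \<Rightarrow>
     if g d - corner rot g d \<le> i then (rot d, g d - 1 - i)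
     else (rot (rot d), g (rot (rot d)) - 1 - i))"

text \<open>Strands along an edge {d, alpha d}, with a permutation P d inserted (on the
  representative dart d \<le> alpha d); P d = id gives parallel strands.\<close>
definition ematch :: "('d::linorder \<Rightarrow> 'd) \<Rightarrow> ('d \<Rightarrow> nat) \<Rightarrow> ('d \<Rightarrow> nat \<Rightarrow> nat)
    \<Rightarrow> 'd \<times> nat \<Rightarrow> 'd \<times> nat" where
  "ematch alpha g P x = (case x of (d, i) \<Rightarrow>
     if d \<le> alpha d then (alpha d, g d - 1 - P d i)
     else (alpha d, inv (P (alpha d)) (g (alpha d) - 1 - i)))"

definition num_curves :: "'d set \<Rightarrow> ('d::linorder \<Rightarrow> 'd) \<Rightarrow> ('d \<Rightarrow> 'd) \<Rightarrow> ('d \<Rightarrow> nat)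
    \<Rightarrow> ('d \<Rightarrow> nat \<Rightarrow> nat) \<Rightarrow> nat" where
  "num_curves D alpha rot g P =
     (let S = strand_pts D g;
          R = ({(x, vmatch rot g x) | x. x \<in> S} \<union> {(x, ematch alpha g P x) | x. x \<in> S})\<^sup>*
      in card ((\<lambda>x. R `` {x}) ` S))"

definition edge_reps :: "'d set \<Rightarrow> ('d::linorder \<Rightarrow> 'd) \<Rightarrow> 'd set" where
  "edge_reps D alpha = {d \<in> D. d \<le> alpha d}"

definition perm_assignments :: "'d set \<Rightarrow> ('d::linorder \<Rightarrow> 'd) \<Rightarrow> ('d \<Rightarrow> nat)
    \<Rightarrow> ('d \<Rightarrow> nat \<Rightarrow> nat) set" where
  "perm_assignments D alpha g = {P. (\<forall>d\<in>edge_reps D alpha. P d permutes {..<g d}) \<and>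
                                     (\<forall>d. d \<notin> edge_reps D alpha \<longrightarrow> P d = id)}"

definition penrose_eval :: "'d set \<Rightarrow> ('d::linorder \<Rightarrow> 'd) \<Rightarrow> ('d \<Rightarrow> 'd) \<Rightarrow> ('d \<Rightarrow> nat) \<Rightarrow> int" where
  "penrose_eval D alpha rot g =
     (\<Sum>P\<in>perm_assignments D alpha g.
        (\<Prod>d\<in>edge_reps D alpha. sign (P d)) * (-2) ^ num_curves D alpha rot g P)"

text \<open>Standard evaluation: the product over vertices of the three factorials equals
  the product over all darts of the factorial of the corner count.\<close>
definition standard_eval :: "'d set \<Rightarrow> ('d::linorder \<Rightarrow> 'd) \<Rightarrow> ('d \<Rightarrow> 'd) \<Rightarrow> ('d \<Rightarrow> nat) \<Rightarrow> real" where
  "standard_eval D alpha rot g =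
     real_of_int (penrose_eval D alpha rot g) / (\<Prod>d\<in>D. fact (corner rot g d))"

definition spectral_radius_sn :: "'d set \<Rightarrow> ('d::linorder \<Rightarrow> 'd) \<Rightarrow> ('d \<Rightarrow> 'd) \<Rightarrow> ('d \<Rightarrow> nat) \<Rightarrow> ereal" where
  "spectral_radius_sn D alpha rot g =
     inverse (conv_radius (\<lambda>n. standard_eval D alpha rot (\<lambda>d. n * g d)))"

text \<open>Drum_s. Dart 6 * i + k, i < s: k=0: u_i to u_(i+1); k=1: u_i to u_(i-1); k=2: u_i to w_i;
  k=3: w_i to w_(i+1); k=4: w_i to w_(i-1); k=5: w_i to u_i (indices mod s).  Rotation =
  counterclockwise order in the standard planar drawing (w-cycle inside u-cycle):
  at u_i: u_(i+1), w_i, u_(i-1); at w_i: u_i, w_(i+1), w_(i-1).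
  For s = 2 the edges u_0u_1 and u_1u_0 form the double edge.\<close>
definition drum_darts :: "nat \<Rightarrow> nat set" where
  "drum_darts s = {..<6 * s}"

definition drum_alpha :: "nat \<Rightarrow> nat \<Rightarrow> nat" where
  "drum_alpha s d = (let i = d div 6; k = d mod 6 in
     if k = 0 then 6 * ((i + 1) mod s) + 1
     else if k = 1 then 6 * ((i + s - 1) mod s) + 0
     else if k = 2 then 6 * i + 5
     else if k = 3 then 6 * ((i + 1) mod s) + 4
     else if k = 4 then 6 * ((i + s - 1) mod s) + 3
     else 6 * i + 2)"

definition drum_rot :: "nat \<Rightarrow> nat" where
  "drum_rot d = (let i = d div 6; k = d mod 6 in
     if k = 0 then 6 * i + 2 else if k = 2 then 6 * i + 1 else if k = 1 then 6 * i + 0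
     else if k = 5 then 6 * i + 3 else if k = 3 then 6 * i + 4 else 6 * i + 5)"

end

theory Submission
  imports Defs "HOL-Combinatorics.Orbits" "HOL-Real_Asymp.Real_Asymp"
begin

text \<open>
  A closed curve contributes \<open>-2\<close>; expanding it as a signed sum over its two alternating 0/1-labellings
  of strand points turns the Penrose evaluation into a contraction of \<open>SL\<^sub>2\<close>-invariant tensors
  (3j-symbols of spin \<open>n\<close>). Cutting the \<open>s\<close> rungs of the drum splits it into two mirror images of a
  wheel, so up to an overall sign the evaluation is a sum of squares of wheel amplitudes
  \<open>tr (T c\<^sub>1 \<dots> T c\<^sub>s)\<close>. By Cauchy--Schwarz this is at most \<open>theta ^ s\<close>, where \<open>theta\<close> is the theta
  network, and \<open>theta / (n!)\<^sup>6 = (3n+1)! / (n!)\<^sup>3\<close> grows like \<open>27 ^ n\<close>. Conversely, fusing two adjacent rungs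
  multiplies a wheel by the 6j-symbol of the regular tetrahedron (Schur's lemma), so the sum of squares is at
  least \<open>theta ^ s\<close> times a power of that 6j-symbol, up to a polynomial factor. The 6j-symbol satisfies a second
  order recurrence whose characteristic roots are complex conjugate of modulus 1, hence it is not exponentially
  small along infinitely many \<open>n\<close>.
\<close>

section \<open>The Racah sum and its recurrence\<close>

text \<open>The obstacle is the lower bound. \<open>racah n\<close> is an alternating sum whose
  value keeps changing sign, so neither positivity nor a termwise estimate is available. What helps
  is that a radius of convergence sees only absolute values and only the upper growth rate: global
  signs may be dropped, and a lower bound is needed merely for infinitely many \<open>n\<close> and
  up to a factor \<open>\<rho>^n\<close> with \<open>\<rho> < 1\<close> as close to 1 as desired.
  This slack replaces any asymptotic formula for the 6j-symbol: a second-order recurrence controls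
  two consecutive values jointly, and in each pair at least one is then not too small. Two rungs are
  bounded below without a 6j-symbol, at the price of a factor \<open>2*n+1\<close>; every further
  rung costs one factor \<open>(racah n)^2\<close>, whence the exponent \<open>s-2\<close> later on.

  Scaling the decoration 2 by \<open>n\<close> puts \<open>2*n\<close> strands on every edge and
  \<open>n\<close> arcs in every corner. All tensors are kept unnormalised, with the number of ones
  on an edge as label: the sum over the permutations of an edge then turns into the factorial weight
  \<open>c! * (2*n-c)!\<close>, and invariance becomes a pair of linear recurrences in the
  labels.\<close>

definition rec_coeff0 :: "real \<Rightarrow> real" where "rec_coeff0 n = 9*(3*n+2)^2*(3*n+4)^2*(n+1)*(115*n^2+460*n+451)"
definition rec_coeff1 :: "real \<Rightarrow> real" where "rec_coeff1 n = (2*n+3)*(319212 + 1427658*n + 2578232*n^2 + 2423109*n^3 + 1255139*n^4 + 340515*n^5 + 37835*n^6)"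
definition rec_coeff2 :: "real \<Rightarrow> real" where "rec_coeff2 n = 9*(n+2)*(3*n+5)^2*(3*n+7)^2*(115*n^2+230*n+106)"
text \<open>These polynomials assemble the numerator of a rational certificate of the kind produced
  by Zeilberger's algorithm, of degree 6 in the summation index \<open>l\<close>; they are its
  coefficients by powers of \<open>l\<close>.\<close>

definition cert0 :: "real \<Rightarrow> real" where "cert0 n = 4*(2*n+3)*((-6010960) + (-45250032)*n + (-150768460)*n^2 + (-293094336)*n^3 + (-368474966)*n^4 + (-313272864)*n^5 + (-182532596)*n^6 + (-72015000)*n^7 + (-18421250)*n^8 + (-2760000)*n^9 + (-184000)*n^10)"
definition cert1 :: "real \<Rightarrow> real" where "cert1 n = 4*(2*n+3)*((-741704) + (-4297944)*n + (-10705294)*n^2 + (-15010170)*n^3 + (-12988540)*n^4 + (-7115922)*n^5 + (-2413538)*n^6 + (-463680)*n^7 + (-38640)*n^8)"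
definition cert2 :: "real \<Rightarrow> real" where "cert2 n = 4*(2*n+3)*(2999968 + 17429988*n + 43457392*n^2 + 60976350*n^3 + 52804050*n^4 + 28949922*n^5 + 9824098*n^6 + 1887840*n^7 + 157320*n^8)"
definition cert3 :: "real \<Rightarrow> real" where "cert3 n = 4*(2*n+3)*((-159524) + (-694440)*n + (-1209645)*n^2 + (-1099230)*n^3 + (-555805)*n^4 + (-149040)*n^5 + (-16560)*n^6)"
definition cert4 :: "real \<Rightarrow> real" where "cert4 n = 4*(2*n+3)*((-176816) + (-823524)*n + (-1533104)*n^2 + (-1472484)*n^3 + (-773264)*n^4 + (-211140)*n^5 + (-23460)*n^6)"
definition cert5 :: "real \<Rightarrow> real" where "cert5 n = 4*(2*n+3)*(30100 + 98016*n + 110297*n^2 + 51750*n^3 + 8625*n^4)"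
definition cert6 :: "real \<Rightarrow> real" where "cert6 n = 4*(2*n+3)*((-21304) + (-66960)*n + (-74070)*n^2 + (-34500)*n^3 + (-5750)*n^4)"
definition cert :: "real \<Rightarrow> real \<Rightarrow> real" where
  "cert n l = cert0 n + cert1 n*l + cert2 n*l^2 + cert3 n*l^3 + cert4 n*l^4 + cert5 n*l^5 + cert6 n*l^6"

text \<open>Creative telescoping with all denominators cleared. The products on the left are the
  ratios of the Racah terms for \<open>n\<close>, \<open>n+1\<close>, \<open>n+2\<close> to the
  common factor \<open>racah_base n l\<close>; the right side is the difference of consecutive
  values of a multiple of that factor, divided by the same factor.\<close>

lemma zeilberger_certificate: "rec_coeff0 n*(((n+2-l)*(n+1-l))^2*(2*n+l+2)*(2*n+l+3)*(2*n+l+4)*(2*n+l+5))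
 - rec_coeff1 n*((n+l+1)^2*(2*n+1-l)*(2*n+2-l)*(n+2-l)^2*(2*n+l+4)*(2*n+l+5))
 + rec_coeff2 n*(((n+l+1)*(n+l+2))^2*(2*n+1-l)*(2*n+2-l)*(2*n+3-l)*(2*n+4-l))
 = - ((n+l+1)^2*(n+2-l)^2*cert n (l+1)) 
   - l^2*(2*n+1-l)*(2*n+l+5)*cert n l" (is "?L = ?R")
proof -
  \<comment> \<open>\<open>E0\<close>, ..., \<open>E8\<close> are the coefficients of
    \<open>?L - ?R\<close> as a polynomial in \<open>l\<close>. The powers \<open>l^9\<close> and
    \<open>l^10\<close> cancel even when the \<open>rec_coeff\<close> and \<open>cert\<close>
    coefficients are treated as unknowns, so the bivariate identity splits into nine identities in
    \<open>n\<close> alone and one in which the long coefficients stay folded.\<close>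
  define E0 where "E0 = rec_coeff0 n*(480 + 2672*n + 6392*n^2 + 8580*n^3 + 7068*n^4 + 3660*n^5 + 1164*n^6 + 208*n^7 + 16*n^8) - rec_coeff1 n*(160 + 1104*n + 3176*n^2 + 5004*n^3 + 4740*n^4 + 2772*n^5 + 980*n^6 + 192*n^7 + 16*n^8) + rec_coeff2 n*(96 + 688*n + 2072*n^2 + 3444*n^3 + 3468*n^4 + 2172*n^5 + 828*n^6 + 176*n^7 + 16*n^8) - (cert0 n * ((-4) + (-12)*n + (-13)*n^2 + (-6)*n^3 + (-1)*n^4) + cert1 n*((-4) + (-12)*n + (-13)*n^2 + (-6)*n^3 + (-1)*n^4) + cert2 n*((-4) + (-12)*n + (-13)*n^2 + (-6)*n^3 + (-1)*n^4) + cert3 n*((-4) + (-12)*n + (-13)*n^2 + (-6)*n^3 + (-1)*n^4) + cert4 n*((-4) + (-12)*n + (-13)*n^2 + (-6)*n^3 + (-1)*n^4) + cert5 n*((-4) + (-12)*n + (-13)*n^2 + (-6)*n^3 + (-1)*n^4) + cert6 n*((-4) + (-12)*n + (-13)*n^2 + (-6)*n^3 + (-1)*n^4))"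
  define E1 where "E1 = rec_coeff0 n*((-824) + (-3832)*n + (-7494)*n^2 + (-7992)*n^3 + (-5022)*n^4 + (-1860)*n^5 + (-376)*n^6 + (-32)*n^7) - rec_coeff1 n*((-8) + 72*n + 294*n^2 + 396*n^3 + 246*n^4 + 72*n^5 + 8*n^6 + 0*n^7) + rec_coeff2 n*(88 + 664*n + 1902*n^2 + 2808*n^3 + 2358*n^4 + 1140*n^5 + 296*n^6 + 32*n^7) - (cert0 n * ((-4) + (-6)*n + (-2)*n^2) + cert1 n*((-8) + (-18)*n + (-15)*n^2 + (-6)*n^3 + (-1)*n^4) + cert2 n*((-12) + (-30)*n + (-28)*n^2 + (-12)*n^3 + (-2)*n^4) + cert3 n*((-16) + (-42)*n + (-41)*n^2 + (-18)*n^3 + (-3)*n^4) + cert4 n*((-20) + (-54)*n + (-54)*n^2 + (-24)*n^3 + (-4)*n^4) + cert5 n*((-24) + (-66)*n + (-67)*n^2 + (-30)*n^3 + (-5)*n^4) + cert6 n*((-28) + (-78)*n + (-80)*n^2 + (-36)*n^3 + (-6)*n^4))"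
  define E2 where "E2 = rec_coeff0 n*((-4) + (-60)*n + (-189)*n^2 + (-258)*n^3 + (-177)*n^4 + (-60)*n^5 + (-8)*n^6) - rec_coeff1 n*((-308) + (-1404)*n + (-2601)*n^2 + (-2502)*n^3 + (-1317)*n^4 + (-360)*n^5 + (-40)*n^6) + rec_coeff2 n*((-148) + (-588)*n + (-945)*n^2 + (-786)*n^3 + (-357)*n^4 + (-84)*n^5 + (-8)*n^6) - (cert0 n * ((-2) + (-6)*n + (-2)*n^2) + cert1 n*((-1)) + cert2 n*((-9) + (-18)*n + (-15)*n^2 + (-6)*n^3 + (-1)*n^4) + cert3 n*((-21) + (-48)*n + (-43)*n^2 + (-18)*n^3 + (-3)*n^4) + cert4 n*((-37) + (-90)*n + (-84)*n^2 + (-36)*n^3 + (-6)*n^4) + cert5 n*((-57) + (-144)*n + (-138)*n^2 + (-60)*n^3 + (-10)*n^4) + cert6 n*((-81) + (-210)*n + (-205)*n^2 + (-90)*n^3 + (-15)*n^4))"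
  define E3 where "E3 = rec_coeff0 n*(486 + 1482*n + 1812*n^2 + 1104*n^3 + 334*n^4 + 40*n^5) - rec_coeff1 n*(50 + 102*n + 88*n^2 + 36*n^3 + 6*n^4 + 0*n^5) + rec_coeff2 n*((-126) + (-546)*n + (-888)*n^2 + (-696)*n^3 + (-266)*n^4 + (-40)*n^5) - (cert0 n * (6) + cert1 n*((-6)*n + (-2)*n^2) + cert2 n*(4 + 6*n + 2*n^2) + cert3 n*((-5) + (-12)*n + (-13)*n^2 + (-6)*n^3 + (-1)*n^4) + cert4 n*((-26) + (-60)*n + (-56)*n^2 + (-24)*n^3 + (-4)*n^4) + cert5 n*((-63) + (-150)*n + (-140)*n^2 + (-60)*n^3 + (-10)*n^4) + cert6 n*((-120) + (-294)*n + (-278)*n^2 + (-120)*n^3 + (-20)*n^4))"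
  define E4 where "E4 = rec_coeff0 n*((-45) + (-90)*n + (-57)*n^2 + (-10)*n^3 + 1*n^4) - rec_coeff1 n*(167 + 450*n + 447*n^2 + 198*n^3 + 33*n^4) + rec_coeff2 n*(63 + 126*n + 87*n^2 + 22*n^3 + 1*n^4) - (cert1 n*(5) + cert2 n*(1 + (-6)*n + (-2)*n^2) + cert3 n*(10 + 12*n + 4*n^2) + cert4 n*(5 + (-9)*n^2 + (-6)*n^3 + (-1)*n^4) + cert5 n*((-21) + (-60)*n + (-65)*n^2 + (-30)*n^3 + (-5)*n^4) + cert6 n*((-84) + (-210)*n + (-205)*n^2 + (-90)*n^3 + (-15)*n^4))"
  define E5 where "E5 = rec_coeff0 n*((-102) + (-174)*n + (-102)*n^2 + (-20)*n^3) - rec_coeff1 n*((-46) + (-54)*n + (-18)*n^2 + 0*n^3) + rec_coeff2 n*(42 + 102*n + 78*n^2 + 20*n^3) - (cert2 n*(4) + cert3 n*(1 + (-6)*n + (-2)*n^2) + cert4 n*(16 + 18*n + 6*n^2) + cert5 n*(21 + 18*n + (-3)*n^2 + (-6)*n^3 + (-1)*n^4) + cert6 n*((-42)*n + (-68)*n^2 + (-36)*n^3 + (-6)*n^4))"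
  define E6 where "E6 = rec_coeff0 n*(0 + (-2)*n + (-2)*n^2) - rec_coeff1 n*((-20) + (-30)*n + (-10)*n^2) + rec_coeff2 n*((-12) + (-10)*n + (-2)*n^2) - (cert3 n*(3) + cert4 n*((-6)*n + (-2)*n^2) + cert5 n*(21 + 24*n + 8*n^2) + cert6 n*(42 + 42*n + 5*n^2 + (-6)*n^3 + (-1)*n^4))"
  define E7 where "E7 = rec_coeff0 n*(8 + 4*n) - rec_coeff1 n*(4 + 0*n) + rec_coeff2 n*((-4) + (-4)*n) - (cert4 n*(2) + cert5 n*((-2) + (-6)*n + (-2)*n^2) + cert6 n*(24 + 30*n + 10*n^2))"
  define E8 where "E8 = rec_coeff0 n*(1) - rec_coeff1 n*(1) + rec_coeff2 n*(1) - (cert5 n*(1) + cert6 n*((-5) + (-6)*n + (-2)*n^2))"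
  have E: "E0 = 0" "E1 = 0" "E2 = 0" "E3 = 0" "E4 = 0" "E5 = 0" "E6 = 0" "E7 = 0" "E8 = 0"
    unfolding E0_def E1_def E2_def E3_def E4_def E5_def E6_def E7_def E8_def rec_coeff0_def rec_coeff1_def rec_coeff2_def
      cert0_def cert1_def cert2_def cert3_def cert4_def cert5_def cert6_def by algebra+
  have "?L - ?R = E0*l^0 + E1*l^1 + E2*l^2 + E3*l^3 + E4*l^4 + E5*l^5 + E6*l^6 + E7*l^7 + E8*l^8"
    unfolding E0_def E1_def E2_def E3_def E4_def E5_def E6_def E7_def E8_def cert_def by algebra
  then show ?thesis unfolding E by simp
qed

text \<open>The sum over \<open>l\<close> is the 6j-symbol with all six spins equal to
  \<open>n\<close>, in the single-sum form that \<open>triangle_coefficient\<close> produces. Its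
  values for \<open>n = 0, 1, 2\<close> are 1, 1/6 and -3/70.\<close>

definition racah_term :: "nat \<Rightarrow> nat \<Rightarrow> real" where
  "racah_term n l = (-1)^l * (fact (n+l))^2 * fact (2*n-l) / ((fact l)^2 * (fact (n-l))^2 * fact (2*n+l+1))"

definition racah :: "nat \<Rightarrow> real" where
  "racah n = (\<Sum>l\<le>n. racah_term n l)"

text \<open>A common factor of the terms for \<open>n\<close>, \<open>n+1\<close> and
  \<open>n+2\<close>: numerators are taken from \<open>n\<close>, denominators from
  \<open>n+2\<close>, so that each of the three terms is a polynomial multiple of it. For
  \<open>n \<ge> 2\<close> the subtraction \<open>2*n-l\<close> is not truncated in the range
  \<open>l \<le> n+2\<close>.\<close>

definition racah_base :: "nat \<Rightarrow> nat \<Rightarrow> real" where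
  "racah_base n l = (-1)^l * (fact (n+l))^2 * fact (2*n-l) / ((fact l)^2 * (fact (n+2-l))^2 * fact (2*n+l+5))"

lemma racah_term_base0:
  assumes "l \<le> n"
  shows "racah_term n l = racah_base n l * (((real n+2-real l)*(real n+1-real l))^2*(2*real n+real l+2)*(2*real n+real l+3)*(2*real n+real l+4)*(2*real n+real l+5))"
proof -
  obtain m where m: "n = l + m" using assms le_Suc_ex by blast
  have 1: "fact (n+2-l) = (real n+2-real l)*(real n+1-real l) * fact (n-l)"
    unfolding m by (simp add: algebra_simps)
  have 2: "(fact (2*n+l+5)::real) = fact (2*n+l+1) * ((2*real n+real l+2)*(2*real n+real l+3)*(2*real n+real l+4)*(2*real n+real l+5))"
    by (simp add: numeral_eq_Suc algebra_simps)
  have 3: "real n+2-real l \<noteq> 0" "real n+1-real l \<noteq> 0" using assms by auto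
  have 4: "2*real n+real l+2 \<noteq> 0" "2*real n+real l+3 \<noteq> 0" "2*real n+real l+4 \<noteq> 0" "2*real n+real l+5 \<noteq> 0"
    by linarith+
  show ?thesis unfolding racah_term_def racah_base_def 1 2 using 3 4
    by (simp add: divide_simps power_mult_distrib)
qed

lemma racah_term_base1:
  assumes "l \<le> n + 1" "n \<ge> 2"
  shows "racah_term (n+1) l = racah_base n l * ((real n+real l+1)^2*(2*real n+1-real l)*(2*real n+2-real l)*(real n+2-real l)^2*(2*real n+real l+4)*(2*real n+real l+5))"
proof -
  obtain m where m: "n + 1 = l + m" using assms le_Suc_ex by blast
  have 1: "fact (n+2-l) = (real n+2-real l) * fact (n+1-l)"
  proof -
    have "n + 2 - l = Suc (n + 1 - l)" using assms by simp
    then show ?thesis using assms by (simp add: of_nat_diff algebra_simps)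
  qed
  have 2: "(fact (2*n+l+5)::real) = fact (2*(n+1)+l+1) * ((2*real n+real l+4)*(2*real n+real l+5))"
    by (simp add: numeral_eq_Suc algebra_simps)
  have 5: "fact (2*(n+1)-l) = (2*real n+1-real l)*(2*real n+2-real l) * fact (2*n-l)"
  proof -
    have "2*(n+1)-l = Suc (Suc (2*n-l))" using assms by simp
    moreover have "real (2*n-l) = 2 * real n - real l" using assms by (simp add: of_nat_diff)
    ultimately show ?thesis by (simp add: algebra_simps)
  qed
  have 6: "fact (n+1+l) = (real n+real l+1) * fact (n+l)" by (simp add: algebra_simps)
  have 3: "real n+2-real l \<noteq> 0" using assms by auto
  have 4: "2*real n+real l+4 \<noteq> 0" "2*real n+real l+5 \<noteq> 0"
    by linarith+
  show ?thesis unfolding racah_term_def racah_base_def 1 2 5 6 using 3 4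
    by (simp add: divide_simps power_mult_distrib)
qed

lemma racah_term_base2:
  assumes "l \<le> n + 2" "n \<ge> 2"
  shows "racah_term (n+2) l = racah_base n l * (((real n+real l+1)*(real n+real l+2))^2*(2*real n+1-real l)*(2*real n+2-real l)*(2*real n+3-real l)*(2*real n+4-real l))"
proof -
  have 5: "fact (2*(n+2)-l) = (2*real n+1-real l)*(2*real n+2-real l)*(2*real n+3-real l)*(2*real n+4-real l) * fact (2*n-l)"
  proof -
    have "2*(n+2)-l = Suc (Suc (Suc (Suc (2*n-l))))" using assms by simp
    moreover have "real (2*n-l) = 2 * real n - real l" using assms by (simp add: of_nat_diff)
    ultimately show ?thesis by (simp add: algebra_simps)
  qed
  have 6: "fact (n+2+l) = (real n+real l+1) * (real n+real l+2) * fact (n+l)" by (simp add: algebra_simps)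
  have 7: "2*(n+2)+l+1 = 2*n+l+5" by simp
  show ?thesis unfolding racah_term_def racah_base_def 5 6 7
    by (simp add: divide_simps power_mult_distrib)
qed

lemma racah_base_Suc:
  assumes "l \<le> n + 1" "n \<ge> 2"
  shows "racah_base n (Suc l) * ((real l+1)^2*(2*real n-real l)*(2*real n+real l+6))
    = - racah_base n l * ((real n+real l+1)^2*(real n+2-real l)^2)"
proof -
  have 1: "fact (n+2-l) = (real n+2-real l) * fact (n+2-Suc l)"
  proof -
    have "n + 2 - l = Suc (n + 2 - Suc l)" using assms by simp
    then show ?thesis using assms by (simp add: of_nat_diff algebra_simps)
  qed
  have 2: "(fact (2*n+Suc l+5)::real) = (2*real n+real l+6) * fact (2*n+l+5)"
  proof -
    have "2*n+Suc l+5 = Suc (2*n+l+5)" by simp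
    then show ?thesis by (simp only: fact_Suc) simp
  qed
  have 3: "fact (2*n-l) = (2*real n-real l) * fact (2*n-Suc l)"
  proof (cases "l < 2*n")
    case True
    then have "2*n-l = Suc (2*n-Suc l)" by simp
    then show ?thesis using True by (simp add: of_nat_diff algebra_simps)
  next
    case False then show ?thesis using assms by simp
  qed
  have 4: "fact (n+Suc l) = (real n+real l+1) * fact (n+l)" by (simp add: algebra_simps)
  have 5: "fact (Suc l) = (real l + 1) * fact l" by (simp add: algebra_simps)
  have n0: "real n+2-real l \<noteq> 0" "2*real n+real l+6 \<noteq> 0" "real l + 1 \<noteq> 0"
    using assms by linarith+
  show ?thesis unfolding racah_base_def 1 2 3 4 5 using n0
    by (simp add: divide_simps power_mult_distrib)
qed


lemma racah_recurrence:
  assumes n: "n \<ge> 2"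
  shows "rec_coeff0 n * racah n - rec_coeff1 n * racah (n+1) + rec_coeff2 n * racah (n+2) = 0"
proof -
  define P0 where "P0 l = ((real n+2-real l)*(real n+1-real l))^2*(2*real n+real l+2)*(2*real n+real l+3)*(2*real n+real l+4)*(2*real n+real l+5)" for l
  define P1 where "P1 l = (real n+real l+1)^2*(2*real n+1-real l)*(2*real n+2-real l)*(real n+2-real l)^2*(2*real n+real l+4)*(2*real n+real l+5)" for l
  define P2 where "P2 l = ((real n+real l+1)*(real n+real l+2))^2*(2*real n+1-real l)*(2*real n+2-real l)*(2*real n+3-real l)*(2*real n+4-real l)" for l
  define G where "G l = racah_base n l * ((real l)^2*(2*real n+1-real l)*(2*real n+real l+5) * cert n l)" for l
  have s0: "racah n = (\<Sum>l\<le>n+2. racah_base n l * P0 l)"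
  proof -
    have "racah n = (\<Sum>l\<le>n. racah_base n l * P0 l)"
      unfolding racah_def by (intro sum.cong) (auto simp: racah_term_base0 P0_def)
    \<comment> \<open>The factor \<open>P0\<close> vanishes at \<open>l = n+1\<close> and
      \<open>l = n+2\<close>, and \<open>P1\<close> below vanishes at \<open>l = n+2\<close>, so all
      three sums may run over the same range.\<close>
    also have "\<dots> = (\<Sum>l\<le>n+2. racah_base n l * P0 l)"
      by (simp add: P0_def)
    finally show ?thesis .
  qed
  have s1: "racah (n+1) = (\<Sum>l\<le>n+2. racah_base n l * P1 l)"
  proof -
    have "racah (n+1) = (\<Sum>l\<le>n+1. racah_base n l * P1 l)"
      unfolding racah_def P1_def by (intro sum.cong refl racah_term_base1 n) auto
    also have "\<dots> = (\<Sum>l\<le>n+2. racah_base n l * P1 l)"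
      by (simp add: P1_def)
    finally show ?thesis .
  qed
  have s2: "racah (n+2) = (\<Sum>l\<le>n+2. racah_base n l * P2 l)"
    unfolding racah_def P2_def by (intro sum.cong refl racah_term_base2 n) auto
  have tele: "racah_base n l * (rec_coeff0 n * P0 l - rec_coeff1 n * P1 l + rec_coeff2 n * P2 l) = G (Suc l) - G l"
    if "l \<le> n + 1" for l
  proof -
    have "rec_coeff0 n * P0 l - rec_coeff1 n * P1 l + rec_coeff2 n * P2 l
       = - ((n+real l+1)^2*(real n+2-l)^2*cert n (real l+1)) - (real l)^2*(2*real n+1-l)*(2*real n+l+5)*cert n l"
      unfolding P0_def P1_def P2_def using zeilberger_certificate[of "real n" "real l"] by simp
    moreover have "G (Suc l) = racah_base n (Suc l) * ((real l+1)^2*(2*real n-real l)*(2*real n+real l+6)) * cert n (real l+1)"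
      unfolding G_def by (simp add: algebra_simps)
    then have "G (Suc l) = - racah_base n l * ((real n+real l+1)^2*(real n+2-real l)^2) * cert n (real l+1)"
      unfolding racah_base_Suc[OF that n] .
    ultimately show ?thesis unfolding G_def by (simp only:) (simp only: right_diff_distrib mult_ac mult_minus_left mult_minus_right)
  qed
  \<comment> \<open>At the right end the forward part of the certificate carries the factor
    \<open>(n+2-l)^2 = 0\<close>, so only \<open>- G (n+2)\<close> is left. It cancels the upper
    value of the telescoping sum, and \<open>G 0 = 0\<close> because of the factor
    \<open>l^2\<close>.\<close>
  have last: "racah_base n (n+2) * (rec_coeff0 n * P0 (n+2) - rec_coeff1 n * P1 (n+2) + rec_coeff2 n * P2 (n+2)) = - G (n+2)"
  proof -
    have "rec_coeff0 n * P0 (n+2) - rec_coeff1 n * P1 (n+2) + rec_coeff2 n * P2 (n+2)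
       = - ((n+real (n+2)+1)^2*(real n+2-real (n+2))^2*cert n (real (n+2)+1)) - (real (n+2))^2*(2*real n+1-real (n+2))*(2*real n+real (n+2)+5)*cert n (real (n+2))"
      unfolding P0_def P1_def P2_def using zeilberger_certificate[of "real n" "real (n+2)"] by simp
    then show ?thesis unfolding G_def by simp
  qed
  have "rec_coeff0 n * racah n - rec_coeff1 n * racah (n+1) + rec_coeff2 n * racah (n+2)
     = (\<Sum>l\<le>n+2. racah_base n l * (rec_coeff0 n * P0 l - rec_coeff1 n * P1 l + rec_coeff2 n * P2 l))"
    unfolding s0 s1 s2 sum_distrib_left sum_subtractf[symmetric] sum.distrib[symmetric]
    by (intro sum.cong) (auto simp: algebra_simps)
  also have "\<dots> = (\<Sum>l<n+2. G (Suc l) - G l) - G (n+2)"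
    using last by (simp add: tele lessThan_Suc_atMost[symmetric] del: sum.lessThan_Suc)
      (simp add: tele)
  also have "\<dots> = 0"
    unfolding sum_lessThan_telescope by (simp add: G_def)
  finally show ?thesis .
qed

section \<open>Lower bound for the Racah sum along infinitely many indices\<close>

lemma rec_coeff_pos: "rec_coeff0 (real n) > 0" "rec_coeff2 (real n) > 0"
  unfolding rec_coeff0_def rec_coeff2_def by (intro mult_pos_pos zero_less_power add_nonneg_pos; simp)+

lemma racah_2: "racah 2 \<noteq> 0"
  unfolding racah_def racah_term_def
  by (simp add: numeral_eq_Suc fact_reduce)

text \<open>The lowest coefficient of the recurrence is positive, so two consecutive zeros would
  force the preceding value to vanish as well, and so on down to \<open>racah 2\<close>.\<close>

lemma racah_not_both_zero:
  assumes "n \<ge> 2"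
  shows "racah n \<noteq> 0 \<or> racah (Suc n) \<noteq> 0"
  using assms
proof (induction n rule: dec_induct)
  case base
  then show ?case using racah_2 by blast
next
  case (step n)
  then show ?case using racah_recurrence[of n] rec_coeff_pos(1)[of n] by auto
qed

text \<open>For constant coefficients the quadratic form below is conserved, and it is definite because
  the characteristic roots are not real.\<close>

lemma perturbed_rotation_lower_bound:
  fixes u p r :: "nat \<Rightarrow> real"
  assumes rec: "\<And>n. n \<ge> N \<Longrightarrow> u (n+2) = p n * u (n+1) - r n * u n"
    and p: "p \<longlonglongrightarrow> P" and r: "r \<longlonglongrightarrow> 1" and P: "\<bar>P\<bar> < 2"
    and nz: "\<And>n. n \<ge> N \<Longrightarrow> u n \<noteq> 0 \<or> u (Suc n) \<noteq> 0"
    and \<rho>: "0 < \<rho>" "\<rho> < 1"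
  shows "\<exists>c>0. \<exists>M. \<forall>n\<ge>M. c * \<rho> ^ n \<le> (u n)^2 + (u (Suc n))^2"
proof -
  define E where "E n = (u (Suc n))^2 - P * u (Suc n) * u n + (u n)^2" for n
  define S where "S n = (u n)^2 + (u (Suc n))^2" for n
  define k where "k = 1 - \<bar>P\<bar>/2"
  have k: "k > 0" using P by (simp add: k_def)
  have P_ab: "\<bar>P * a * b\<bar> \<le> \<bar>P\<bar>/2 * (a^2 + b^2)" for a b :: real
  proof -
    have "2 * \<bar>a * b\<bar> \<le> a^2 + b^2"
      using sum_squares_bound[of "\<bar>a\<bar>" "\<bar>b\<bar>"] by (simp add: abs_mult)
    then have "\<bar>P\<bar> * (2 * \<bar>a * b\<bar>) \<le> \<bar>P\<bar> * (a^2+b^2)" by (intro mult_left_mono) auto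
    then show ?thesis by (simp add: abs_mult field_simps)
  qed
  have E_ge: "E n \<ge> k * S n" for n
    using P_ab[of "u (Suc n)" "u n"] unfolding E_def S_def k_def by (simp add: algebra_simps abs_le_iff)
  have E_le: "E n \<le> 2 * S n" for n
  proof -
    have "\<bar>P\<bar>/2 * ((u (Suc n))^2 + (u n)^2) \<le> 1 * ((u (Suc n))^2 + (u n)^2)"
      using P by (intro mult_right_mono) auto
    then show ?thesis using P_ab[of "u (Suc n)" "u n"] unfolding E_def S_def by (simp add: abs_le_iff)
  qed
  \<comment> \<open>Small enough that the error of one step, at most
    \<open>8 * \<epsilon> * S n\<close>, stays below \<open>(1 - \<rho>) * E n\<close>; the
    definiteness \<open>E n \<ge> k * S n\<close> converts one into the other.\<close>
  define \<epsilon> where "\<epsilon> = k * (1 - \<rho>) / 16"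
  have \<epsilon>: "\<epsilon> > 0" "16 * \<epsilon> = k * (1 - \<rho>)" using k \<rho> by (auto simp: \<epsilon>_def)
  have "\<forall>\<^sub>F n in sequentially. \<bar>p n - P\<bar> < \<epsilon> \<and> \<bar>r n - 1\<bar> < \<epsilon>"
    using tendstoD[OF p \<epsilon>(1)] tendstoD[OF r \<epsilon>(1)] by eventually_elim (auto simp: dist_real_def)
  then obtain M0 where M0: "\<And>n. n \<ge> M0 \<Longrightarrow> \<bar>p n - P\<bar> < \<epsilon> \<and> \<bar>r n - 1\<bar> < \<epsilon>"
    unfolding eventually_sequentially by blast
  define M where "M = max M0 N"
  have E_step: "E (Suc n) \<ge> \<rho> * E n" if n: "n \<ge> M" for n
  proof -
    define x y where "x = u n" and "y = u (Suc n)"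
    define \<delta> where "\<delta> = (p n - P) * y - (r n - 1) * x"
    have u2: "u (Suc (Suc n)) = P * y - x + \<delta>"
      using rec[of n] n unfolding \<delta>_def x_def y_def M_def by (simp add: algebra_simps)
    have "\<bar>\<delta>\<bar> \<le> \<bar>(p n - P) * y\<bar> + \<bar>(r n - 1) * x\<bar>" unfolding \<delta>_def by linarith
    also have "\<dots> \<le> \<epsilon> * \<bar>y\<bar> + \<epsilon> * \<bar>x\<bar>"
      using M0[of n] n unfolding abs_mult M_def by (intro add_mono mult_right_mono) auto
    finally have d: "\<bar>\<delta>\<bar> \<le> \<epsilon> * (\<bar>x\<bar> + \<bar>y\<bar>)" by (simp add: algebra_simps)
    \<comment> \<open>The unperturbed step preserves the quadratic form exactly, so every correction
      contains \<open>\<delta>\<close>.\<close>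
    have Eeq: "E (Suc n) = E n + \<delta>^2 + \<delta> * (P * y - 2 * x)"
      unfolding E_def u2 x_def[symmetric] y_def[symmetric] by (simp add: power2_eq_square algebra_simps)
    have "\<bar>P * y\<bar> \<le> 2 * \<bar>y\<bar>" using P unfolding abs_mult by (intro mult_right_mono) auto
    then have "\<bar>P * y - 2 * x\<bar> \<le> 2 * (\<bar>x\<bar> + \<bar>y\<bar>)"
      using abs_triangle_ineq4[of "P * y" "2 * x"] by (simp add: abs_mult)
    then have "\<bar>\<delta> * (P * y - 2 * x)\<bar> \<le> (\<epsilon> * (\<bar>x\<bar> + \<bar>y\<bar>)) * (2 * (\<bar>x\<bar> + \<bar>y\<bar>))"
      unfolding abs_mult using d by (intro mult_mono) auto
    also have "\<dots> = 2 * \<epsilon> * (\<bar>x\<bar> + \<bar>y\<bar>)^2" by (simp add: power2_eq_square)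
    also have "\<dots> \<le> 2 * \<epsilon> * (2 * S n)"
    proof -
      have "(\<bar>x\<bar> + \<bar>y\<bar>)^2 \<le> 2 * S n"
        using sum_squares_bound[of "\<bar>x\<bar>" "\<bar>y\<bar>"] unfolding S_def x_def y_def by (simp add: power2_sum)
      then show ?thesis using \<epsilon> by (intro mult_left_mono) auto
    qed
    also have "\<dots> \<le> 8 * \<epsilon> * S n" using \<epsilon> by (simp add: S_def)
    finally have "E (Suc n) \<ge> E n - 8 * \<epsilon> * S n" unfolding Eeq using zero_le_power2[of \<delta>] by linarith
    moreover have "8 * \<epsilon> * S n \<le> (1 - \<rho>) * E n"
    proof -
      have "8 * \<epsilon> * S n \<le> 16 * \<epsilon> * S n" using \<epsilon>(1) by (intro mult_right_mono) (auto simp: S_def)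
      also have "\<dots> = (1 - \<rho>) * (k * S n)" unfolding \<epsilon> by simp
      also have "\<dots> \<le> (1 - \<rho>) * E n" using E_ge \<rho> by (intro mult_left_mono) auto
      finally show ?thesis .
    qed
    ultimately show ?thesis by (simp add: algebra_simps)
  qed
  have EM: "E M > 0"
  proof -
    have "S M > 0" using nz[of M] unfolding S_def M_def by (auto simp: sum_power2_gt_zero_iff)
    then have "k * S M > 0" using k by simp
    then show ?thesis using E_ge[of M] by linarith
  qed
  have grow: "E n \<ge> \<rho> ^ n * E M" if "n \<ge> M" for n
    using that
  proof (induction n rule: dec_induct)
    case base
    have "\<rho> ^ M \<le> 1" using \<rho> by (simp add: power_le_one)
    then show ?case using EM by simp
  next
    case (step n)
    have "\<rho> ^ Suc n * E M \<le> \<rho> * E n" using step.IH \<rho> by (simp add: mult_left_mono mult.assoc)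
    then show ?case using \<open>n \<ge> M\<close> E_step[of n] by linarith
  qed
  show ?thesis
  proof (intro exI conjI allI impI)
    show "E M / 2 > 0" using EM by simp
    fix n assume "n \<ge> M"
    then show "E M / 2 * \<rho> ^ n \<le> (u n)^2 + (u (Suc n))^2"
      using grow[of n] E_le[of n] unfolding S_def by (simp add: algebra_simps)
  qed
qed

text \<open>The sum of two consecutive squares is bounded below, so the larger of the two is. This
  yields infinitely many indices but says nothing about every single one, since the values
  oscillate.\<close>

lemma racah_frequently_large:
  assumes "0 < \<rho>" "\<rho> < 1"
  shows "\<exists>c>0. \<exists>\<^sub>F n in sequentially. c * \<rho> ^ n \<le> (racah n)^2"
proof -
  \<comment> \<open>The limit equals 658/729, which is \<open>2 * cos (6 * arccos (1/3))\<close>: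
    the phase advances by the six dihedral angles of the regular tetrahedron, in accordance with the
    Ponzano-Regge asymptotics. Being smaller than 2, it makes the characteristic roots
    non-real.\<close>
  have lim1: "(\<lambda>n. rec_coeff1 (real n) / rec_coeff2 (real n)) \<longlonglongrightarrow> 75670/83835"
    unfolding rec_coeff1_def rec_coeff2_def by real_asymp
  have lim2: "(\<lambda>n. rec_coeff0 (real n) / rec_coeff2 (real n)) \<longlonglongrightarrow> 1"
    unfolding rec_coeff0_def rec_coeff2_def by real_asymp
  have "racah (n+2) = rec_coeff1 n / rec_coeff2 n * racah (n+1) - rec_coeff0 n / rec_coeff2 n * racah n"
    if "n \<ge> 2" for n
    using racah_recurrence[OF that] rec_coeff_pos(2)[of n] by (simp add: field_simps)
  from perturbed_rotation_lower_bound[of 2 racah, OF this lim1 lim2 _ racah_not_both_zero assms]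
  obtain c M where c: "c > 0" "\<And>n. n \<ge> M \<Longrightarrow> c * \<rho> ^ n \<le> (racah n)^2 + (racah (Suc n))^2"
    by auto
  have "\<exists>n\<ge>m. c/2 * \<rho> ^ n \<le> (racah n)^2" for m
  proof (rule ccontr)
    assume "\<not> ?thesis"
    then have *: "(racah n)^2 < c/2 * \<rho> ^ n" if "n \<ge> m" for n using that by auto
    define n where "n = max m M"
    have "\<rho> ^ Suc n \<le> \<rho> ^ n" using assms by (simp add: mult_left_le_one_le)
    then have "c/2 * \<rho> ^ Suc n \<le> c/2 * \<rho> ^ n" using c(1) by (intro mult_left_mono) auto
    moreover have "n \<ge> m" "n \<ge> M" unfolding n_def by auto
    ultimately show False using *[of n] *[of "Suc n"] c(2)[of n] by simp
  qed
  then have "\<exists>\<^sub>F n in sequentially. c/2 * \<rho> ^ n \<le> (racah n)^2"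
    unfolding frequently_sequentially by blast
  then show ?thesis using c(1) by (intro exI[of _ "c/2"]) auto
qed

section \<open>Unnormalised 3j-symbols\<close>

definition sbinom :: "nat \<Rightarrow> nat \<Rightarrow> real" where
  "sbinom n k = (-1)^k * real (n choose k)"

text \<open>Attach variables x_1, y_1 to the first leg, and so on, and put [pq] = y_p x_q - x_p y_q.
  The value is the coefficient of x_1^a x_2^b x_3^c in the invariant polynomial [12]^n [23]^n
  [31]^n, of degree \<open>2*n\<close> on each leg. The indices \<open>i\<close>, \<open>j\<close>,
  \<open>k\<close> count, corner by corner, the arcs whose x sits at the first end. Labels are
  integers, so that the shifts and the reflection \<open>2*n - a\<close> used below need no case
  distinction.\<close>

definition threej :: "nat \<Rightarrow> int \<Rightarrow> int \<Rightarrow> int \<Rightarrow> real" where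
  "threej n a b c = (\<Sum>i\<le>n. \<Sum>j\<le>n. \<Sum>k\<le>n.
     if int n + int i = a + int k \<and> int n + int j = b + int i \<and> int n + int k = c + int j
     then sbinom n i * sbinom n j * sbinom n k else 0)"

lemma threej_cyclic: "threej n a b c = threej n b c a"
proof -
  define g where "g i j k = (if int n + int i = a + int k \<and> int n + int j = b + int i \<and> int n + int k = c + int j
     then sbinom n i * sbinom n j * sbinom n k else 0)" for i j k
  have "threej n b c a = (\<Sum>i\<le>n. \<Sum>j\<le>n. \<Sum>k\<le>n. g k i j)"
    unfolding threej_def g_def by (intro sum.cong refl) (simp add: mult_ac conj_ac)
  also have "\<dots> = (\<Sum>i\<le>n. \<Sum>k\<le>n. \<Sum>j\<le>n. g k i j)"
    by (rule sum.cong[OF refl], rule sum.swap)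
  also have "\<dots> = (\<Sum>k\<le>n. \<Sum>i\<le>n. \<Sum>j\<le>n. g k i j)"
    by (rule sum.swap)
  finally show ?thesis unfolding threej_def g_def by simp
qed

lemma threej_eq_0:
  assumes "a < 0 \<or> 2 * int n < a \<or> b < 0 \<or> 2 * int n < b \<or> c < 0 \<or> 2 * int n < c \<or> a + b + c \<noteq> 3 * int n"
  shows "threej n a b c = 0"
  unfolding threej_def using assms by (intro sum.neutral ballI) auto

lemma sbinom_complement: "k \<le> n \<Longrightarrow> sbinom n (n - k) = (-1)^n * sbinom n k"
  unfolding sbinom_def using binomial_symmetric[of k n]
  by (simp add: power_diff) (simp add: divide_simps)

lemma sum_complement: "(\<Sum>k\<le>n. f (n - k)) = (\<Sum>k\<le>(n::nat). f k)"
  by (rule sum.reindex_bij_witness[of _ "\<lambda>k. n - k" "\<lambda>k. n - k"]) auto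

lemma threej_complement:
  "threej n (2 * int n - a) (2 * int n - b) (2 * int n - c) = (-1)^n * threej n a b c"
proof -
  have "threej n (2 * int n - a) (2 * int n - b) (2 * int n - c)
    = (\<Sum>i\<le>n. \<Sum>j\<le>n. \<Sum>k\<le>n. if int n + int (n-i) = 2 * int n - a + int (n-k) \<and> int n + int (n-j) = 2 * int n - b + int (n-i) \<and> int n + int (n-k) = 2 * int n - c + int (n-j)
     then sbinom n (n-i) * sbinom n (n-j) * sbinom n (n-k) else 0)"
    unfolding threej_def
    by (subst sum_complement[symmetric], rule sum.cong[OF refl],
        subst sum_complement[symmetric], rule sum.cong[OF refl],
        subst sum_complement[symmetric]) (rule refl)
  also have "\<dots> = (-1)^n * threej n a b c"
    unfolding threej_def sum_distrib_left
    by (intro sum.cong refl) (auto simp: sbinom_complement of_nat_diff power_mult_distrib[symmetric])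
  finally show ?thesis .
qed

lemma threej_reverse: "threej n c b a = (-1)^n * threej n a b c"
proof -
  have "threej n c b a
    = (\<Sum>i\<le>n. \<Sum>j\<le>n. \<Sum>k\<le>n. if int n + int (n-j) = c + int (n-k) \<and> int n + int (n-i) = b + int (n-j) \<and> int n + int (n-k) = a + int (n-i)
     then sbinom n (n-j) * sbinom n (n-i) * sbinom n (n-k) else 0)"
    unfolding threej_def
    by (subst sum.swap, subst sum_complement[symmetric], rule sum.cong[OF refl],
        subst sum_complement[symmetric], rule sum.cong[OF refl],
        subst sum_complement[symmetric]) (rule refl)
  also have "\<dots> = (-1)^n * threej n a b c"
    unfolding threej_def sum_distrib_left
    by (intro sum.cong refl) (auto simp: sbinom_complement of_nat_diff power_mult_distrib[symmetric])
  finally show ?thesis .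
qed

text \<open>Absorption for binomial coefficients followed by an index shift; the minus sign comes
  from the alternating sign in \<open>sbinom\<close>. There is no boundary condition on
  \<open>f\<close>, because \<open>real k\<close> vanishes at the lower end and \<open>n - k\<close>
  at the upper one.\<close>

lemma sum_sbinom_shift:
  "(\<Sum>k\<le>n. real k * sbinom n k * f k) = - (\<Sum>k\<le>n. real (n - k) * sbinom n k * f (Suc k))"
proof -
  have "(\<Sum>k\<le>n. real k * sbinom n k * f k) = (\<Sum>k\<le>Suc n. real k * sbinom n k * f k)"
    by (simp add: sbinom_def)
  also have "\<dots> = (\<Sum>k\<le>n. real (Suc k) * sbinom n (Suc k) * f (Suc k))"
    by (subst sum.atMost_Suc_shift) simp
  also have "\<dots> = (\<Sum>k\<le>n. - (real (n - k) * sbinom n k * f (Suc k)))"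
  proof (intro sum.cong refl)
    fix k
    have "real (Suc k) * real (n choose Suc k) = real (n - k) * real (n choose k)"
      unfolding of_nat_mult[symmetric] by (metis binomial_absorb_comp binomial_absorption mult.commute)
    then have "real (Suc k) * sbinom n (Suc k) = - (real (n - k) * sbinom n k)"
      unfolding sbinom_def power_Suc
      by (metis (no_types, opaque_lifting) mult.left_commute mult_minus1 mult_minus_left mult_minus_right)
    then show "real (Suc k) * sbinom n (Suc k) * f (Suc k) = - (real (n - k) * sbinom n k * f (Suc k))"
      by (simp only: mult_minus_left)
  qed
  finally show ?thesis by (simp add: sum_negf)
qed

text \<open>Coefficient form of the invariance under the operator y d/dx summed over the three legs,
  which annihilates every bracket [pq]. The factor \<open>a+1\<close> splits as
  \<open>i + (n-k)\<close>, one part for each of the two corners at the leg; the six parts cancel in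
  pairs, one pair per corner.\<close>

lemma threej_lower:
  "(of_int a + 1) * threej n (a+1) b c + (of_int b + 1) * threej n a (b+1) c + (of_int c + 1) * threej n a b (c+1) = 0"
proof -
  define \<delta> where "\<delta> a b c i j k = (if int n + int i = a + int k \<and> int n + int j = b + int i \<and> int n + int k = c + int j then 1 else 0::real)" for a b c i j k
  define S where "S g a b c = (\<Sum>i\<le>n. \<Sum>j\<le>n. \<Sum>k\<le>n. g i j k * (sbinom n i * sbinom n j * sbinom n k * \<delta> a b c i j k))"
    for g :: "nat \<Rightarrow> nat \<Rightarrow> nat \<Rightarrow> real" and a b c
  have weight: "of_int a + 1 = real i + real (n-k)" if "int n + int i = a + 1 + int k" "k \<le> n" for a i k
    using arg_cong[OF that(1), of real_of_int] that(2) by (simp add: of_nat_diff)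
  have 1: "(of_int a + 1) * threej n (a+1) b c = S (\<lambda>i j k. real i) (a+1) b c + S (\<lambda>i j k. real (n-k)) (a+1) b c"
    unfolding threej_def S_def sum_distrib_left sum.distrib[symmetric] \<delta>_def
  proof (intro sum.cong refl, goal_cases)
    case (1 i j k)
    show ?case
    proof (cases "int n + int i = a + 1 + int k \<and> int n + int j = b + int i \<and> int n + int k = c + int j")
      case True
      with 1 have w: "of_int a + 1 = real i + real (n-k)" by (intro weight) auto
      show ?thesis unfolding w using True by (simp add: distrib_right)
    qed (auto simp: add.assoc)
  qed
  have 2: "(of_int b + 1) * threej n a (b+1) c = S (\<lambda>i j k. real j) a (b+1) c + S (\<lambda>i j k. real (n-i)) a (b+1) c"
    unfolding threej_def S_def sum_distrib_left sum.distrib[symmetric] \<delta>_def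
  proof (intro sum.cong refl, goal_cases)
    case (1 i j k)
    show ?case
    proof (cases "int n + int i = a + int k \<and> int n + int j = b + 1 + int i \<and> int n + int k = c + int j")
      case True
      with 1 have w: "of_int b + 1 = real j + real (n-i)" by (intro weight) auto
      show ?thesis unfolding w using True by (simp add: distrib_right)
    qed (auto simp: add.assoc)
  qed
  have 3: "(of_int c + 1) * threej n a b (c+1) = S (\<lambda>i j k. real k) a b (c+1) + S (\<lambda>i j k. real (n-j)) a b (c+1)"
    unfolding threej_def S_def sum_distrib_left sum.distrib[symmetric] \<delta>_def
  proof (intro sum.cong refl, goal_cases)
    case (1 i j k)
    show ?case
    proof (cases "int n + int i = a + int k \<and> int n + int j = b + int i \<and> int n + int k = c + 1 + int j")
      case True
      with 1 have w: "of_int c + 1 = real k + real (n-j)" by (intro weight) auto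
      show ?thesis unfolding w using True by (simp add: distrib_right)
    qed (auto simp: add.assoc)
  qed
  have 4: "S (\<lambda>i j k. real i) (a+1) b c = - S (\<lambda>i j k. real (n-i)) a (b+1) c"
  proof -
    have "S (\<lambda>i j k. real i) (a+1) b c = (\<Sum>i\<le>n. real i * sbinom n i * (\<Sum>j\<le>n. \<Sum>k\<le>n. sbinom n j * sbinom n k * \<delta> (a+1) b c i j k))"
      unfolding S_def sum_distrib_left by (simp add: mult_ac)
    also have "\<dots> = - (\<Sum>i\<le>n. real (n-i) * sbinom n i * (\<Sum>j\<le>n. \<Sum>k\<le>n. sbinom n j * sbinom n k * \<delta> (a+1) b c (Suc i) j k))"
      by (rule sum_sbinom_shift)
    also have "(\<lambda>i j k. \<delta> (a+1) b c (Suc i) j k) = (\<lambda>i j k. \<delta> a (b+1) c i j k)"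
      unfolding \<delta>_def by (intro ext if_cong) auto
    then have "- (\<Sum>i\<le>n. real (n-i) * sbinom n i * (\<Sum>j\<le>n. \<Sum>k\<le>n. sbinom n j * sbinom n k * \<delta> (a+1) b c (Suc i) j k)) = - S (\<lambda>i j k. real (n-i)) a (b+1) c"
      unfolding S_def sum_distrib_left by (simp add: mult_ac fun_eq_iff)
    finally show ?thesis .
  qed
  have 5: "S (\<lambda>i j k. real j) a (b+1) c = - S (\<lambda>i j k. real (n-j)) a b (c+1)"
  proof -
    have "S (\<lambda>i j k. real j) a (b+1) c = (\<Sum>i\<le>n. \<Sum>j\<le>n. real j * sbinom n j * (\<Sum>k\<le>n. sbinom n i * sbinom n k * \<delta> a (b+1) c i j k))"
      unfolding S_def sum_distrib_left by (simp add: mult_ac)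
    also have "\<dots> = (\<Sum>i\<le>n. - (\<Sum>j\<le>n. real (n-j) * sbinom n j * (\<Sum>k\<le>n. sbinom n i * sbinom n k * \<delta> a (b+1) c i (Suc j) k)))"
      by (intro sum.cong refl sum_sbinom_shift)
    also have "(\<lambda>i j k. \<delta> a (b+1) c i (Suc j) k) = (\<lambda>i j k. \<delta> a b (c+1) i j k)"
      unfolding \<delta>_def by (intro ext if_cong) auto
    then have "(\<Sum>i\<le>n. - (\<Sum>j\<le>n. real (n-j) * sbinom n j * (\<Sum>k\<le>n. sbinom n i * sbinom n k * \<delta> a (b+1) c i (Suc j) k))) = - S (\<lambda>i j k. real (n-j)) a b (c+1)"
      unfolding S_def sum_distrib_left sum_negf by (simp add: mult_ac fun_eq_iff)
    finally show ?thesis .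
  qed
  have 6: "S (\<lambda>i j k. real k) a b (c+1) = - S (\<lambda>i j k. real (n-k)) (a+1) b c"
  proof -
    have "S (\<lambda>i j k. real k) a b (c+1) = (\<Sum>i\<le>n. \<Sum>j\<le>n. \<Sum>k\<le>n. real k * sbinom n k * (sbinom n i * sbinom n j * \<delta> a b (c+1) i j k))"
      unfolding S_def sum_distrib_left by (simp add: mult_ac)
    also have "\<dots> = (\<Sum>i\<le>n. \<Sum>j\<le>n. - (\<Sum>k\<le>n. real (n-k) * sbinom n k * (sbinom n i * sbinom n j * \<delta> a b (c+1) i j (Suc k))))"
      by (intro sum.cong refl sum_sbinom_shift)
    also have "(\<lambda>i j k. \<delta> a b (c+1) i j (Suc k)) = (\<lambda>i j k. \<delta> (a+1) b c i j k)"
      unfolding \<delta>_def by (intro ext if_cong) auto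
    then have "(\<Sum>i\<le>n. \<Sum>j\<le>n. - (\<Sum>k\<le>n. real (n-k) * sbinom n k * (sbinom n i * sbinom n j * \<delta> a b (c+1) i j (Suc k)))) = - S (\<lambda>i j k. real (n-k)) (a+1) b c"
      unfolding S_def sum_distrib_left sum_negf by (simp add: mult_ac fun_eq_iff)
    finally show ?thesis .
  qed
  show ?thesis unfolding 1 2 3 4 5 6 by simp
qed

text \<open>Reflecting all labels exchanges x and y, so the lowering equation at the reflected
  labels is the raising equation.\<close>

lemma threej_raise:
  "(2 * real n - of_int a + 1) * threej n (a-1) b c + (2 * real n - of_int b + 1) * threej n a (b-1) c
    + (2 * real n - of_int c + 1) * threej n a b (c-1) = 0"
proof -
  have *: "2 * int n - x + 1 = 2 * int n - (x - 1)" for x by simp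
  have "(-1)^n * ((2 * real n - of_int a + 1) * threej n (a-1) b c + (2 * real n - of_int b + 1) * threej n a (b-1) c
    + (2 * real n - of_int c + 1) * threej n a b (c-1)) = 0"
    using threej_lower[of "2 * int n - a" n "2 * int n - b" "2 * int n - c"]
    unfolding * threej_complement by (simp add: algebra_simps)
  then show ?thesis by simp
qed

text \<open>A label 0 on the third leg forces \<open>k = 0\<close> and \<open>j = n\<close>, which
  leaves a single term of the triple sum.\<close>

lemma threej_bottom:
  assumes "i \<le> n"
  shows "threej n (int n + int i) (2 * int n - int i) 0 = (-1)^(n+i) * real (n choose i)"
proof -
  have "threej n (int n + int i) (2 * int n - int i) 0 =
    (\<Sum>i'\<le>n. \<Sum>j\<le>n. \<Sum>k\<le>n. if k = 0 then if j = n then if i' = i then sbinom n i * sbinom n n * sbinom n 0 else 0 else 0 else 0)"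
    unfolding threej_def by (intro sum.cong refl) auto
  also have "\<dots> = sbinom n i * sbinom n n * sbinom n 0"
    using assms by (simp add: sum.delta)
  finally show ?thesis by (simp add: sbinom_def power_add)
qed

text \<open>A label \<open>n\<close> on the first leg forces equal counts in its two corners, which
  leaves a single sum. This is the one entry away from the extreme labels that the proof
  evaluates.\<close>

lemma threej_middle:
  assumes "i \<le> n"
  shows "threej n (int n) (2 * int n - int i) (int i)
    = (-1)^(n+i) * (\<Sum>j\<le>i. (-1)^j * (real (n choose j))^2 * real (n choose (i-j)))"
proof -
  define m where "m a = n + a - i" for a
  have "threej n (int n) (2 * int n - int i) (int i) =
    (\<Sum>a\<le>n. \<Sum>b\<le>n. \<Sum>c\<le>n. if c = a then if b = m a then if a \<le> i then sbinom n a * sbinom n (m a) * sbinom n a else 0 else 0 else 0)"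
    unfolding threej_def
  proof (intro sum.cong refl, goal_cases)
    case (1 a b c)
    then have "(int n + int a = int n + int c \<and> int n + int b = 2 * int n - int i + int a \<and> int n + int c = int i + int b)
      \<longleftrightarrow> c = a \<and> b = m a \<and> a \<le> i"
      using assms by (auto simp: of_nat_diff m_def)
    then show ?case by (simp only:) auto
  qed
  also have "\<dots> = (\<Sum>a\<le>n. \<Sum>b\<le>n. if b = m a then if a \<le> i then sbinom n a * sbinom n (m a) * sbinom n a else 0 else 0)"
    by (intro sum.cong refl) (simp add: sum.delta)
  also have "\<dots> = (\<Sum>a\<le>n. if a \<le> i then sbinom n a * sbinom n (m a) * sbinom n a else 0)"
  proof (rule sum.cong[OF refl])
    fix a assume "a \<in> {..n}"
    have "m a \<le> n" if "a \<le> i" using that by (simp add: m_def)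
    then show "(\<Sum>b\<le>n. if b = m a then if a \<le> i then sbinom n a * sbinom n (m a) * sbinom n a else 0 else 0)
      = (if a \<le> i then sbinom n a * sbinom n (m a) * sbinom n a else 0)"
      by (simp add: sum.delta)
  qed
  also have "\<dots> = (\<Sum>a\<le>i. sbinom n a * sbinom n (m a) * sbinom n a)"
    using assms by (intro sum.mono_neutral_cong_right) auto
  also have "\<dots> = (\<Sum>a\<le>i. (-1)^(n+i) * ((-1)^a * (real (n choose a))^2 * real (n choose (i-a))))"
  proof (intro sum.cong refl)
    fix a assume "a \<in> {..i}"
    then have a: "a \<le> i" by simp
    have "m a = n - (i - a)" using a assms by (simp add: m_def)
    then have "sbinom n (m a) = (-1)^n * ((-1)^(i-a) * real (n choose (i-a)))"
      using sbinom_complement[of "i-a" n] assms by (simp add: sbinom_def)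
    moreover have "(-1::real)^(i-a) = (-1)^i * (-1)^a"
      using a by (simp add: power_diff) (simp add: divide_simps)
    moreover have "sbinom n a * sbinom n a = (real (n choose a))^2"
      by (simp add: sbinom_def power2_eq_square)
    ultimately show "sbinom n a * sbinom n (m a) * sbinom n a = (-1)^(n+i) * ((-1)^a * (real (n choose a))^2 * real (n choose (i-a)))"
      by (simp add: power_add mult_ac)
  qed
  finally show ?thesis by (simp add: sum_distrib_left)
qed

section \<open>The theta network\<close>

definition spins :: "nat \<Rightarrow> int set" where
  "spins n = {0..2 * int n}"

text \<open>The number of permutations of \<open>2*n\<close> strands that preserve a given set of
  \<open>c\<close> strands. It is also the squared norm of the monomial x^c y^(2n-c) in the
  invariant inner product on binary forms, for which raising and lowering are adjoint.\<close>

definition weight :: "nat \<Rightarrow> int \<Rightarrow> real" where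
  "weight n c = fact (nat c) * fact (nat (2 * int n - c))"

lemma weight_pos: "weight n c > 0"
  by (simp add: weight_def)

lemma finite_spins [simp]: "finite (spins n)"
  by (simp add: spins_def)

lemma card_spins: "card (spins n) = 2 * n + 1"
  by (simp add: spins_def)

lemma weight_complement: "weight n (2 * int n - c) = weight n c"
  by (simp add: weight_def mult.commute)

lemma sum_spins_complement: "(\<Sum>c\<in>spins n. f (2 * int n - c)) = (\<Sum>c\<in>spins n. f c)"
  by (rule sum.reindex_bij_witness[of _ "\<lambda>k. 2 * int n - k" "\<lambda>k. 2 * int n - k"]) (auto simp: spins_def)

lemma weight_step:
  assumes "0 \<le> c" "c < 2 * int n"
  shows "weight n (c+1) * (2 * real n - of_int c) = weight n c * (of_int c + 1)"
proof -
  have "nat (c+1) = Suc (nat c)" "nat (2 * int n - c) = Suc (nat (2 * int n - (c+1)))"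
    using assms by auto
  moreover have "real (nat c) = of_int c" "real (nat (2 * int n - (c+1))) = 2 * real n - of_int c - 1"
    using assms by (auto simp: of_nat_nat)
  ultimately show ?thesis unfolding weight_def by (simp add: algebra_simps)
qed

text \<open>Summation by parts expressing the adjointness of lowering and raising. The two
  conditions on \<open>h\<close> remove the boundary terms.\<close>

lemma weight_shift:
  assumes "h (2 * int n) = 0" "h (-1) = 0"
  shows "(\<Sum>c\<in>spins n. weight n c * (of_int c + 1) * h c)
       = (\<Sum>c\<in>spins n. weight n c * (2 * real n - of_int c + 1) * h (c-1))"
proof -
  have "(\<Sum>c\<in>spins n. weight n c * (of_int c + 1) * h c) = (\<Sum>c\<in>{0..<2 * int n}. weight n c * (of_int c + 1) * h c)"
    using assms by (intro sum.mono_neutral_right) (auto simp: spins_def not_less)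
  also have "\<dots> = (\<Sum>c\<in>{1..2 * int n}. weight n c * (2 * real n - of_int c + 1) * h (c-1))"
    by (rule sum.reindex_bij_witness[of _ "\<lambda>c. c - 1" "\<lambda>c. c + 1"]) (auto simp: weight_step)
  also have "\<dots> = (\<Sum>c\<in>spins n. weight n c * (2 * real n - of_int c + 1) * h (c-1))"
  proof (intro sum.mono_neutral_left ballI)
    fix c assume "c \<in> spins n - {1..2 * int n}"
    then have "c = 0" by (auto simp: spins_def)
    then show "weight n c * (2 * real n - of_int c + 1) * h (c-1) = 0" using assms by simp
  qed (auto simp: spins_def)
  finally show ?thesis .
qed

definition theta_slice :: "nat \<Rightarrow> int \<Rightarrow> real" where
  "theta_slice n c = (\<Sum>a\<in>spins n. \<Sum>b\<in>spins n. weight n a * weight n b * (threej n a b c)^2)"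

definition theta :: "nat \<Rightarrow> real" where
  "theta n = (\<Sum>a\<in>spins n. \<Sum>b\<in>spins n. \<Sum>c\<in>spins n. weight n a * weight n b * weight n c * (threej n a b c)^2)"

text \<open>In one factor of the square the lowering equation moves the operator from the third leg
  to the other two, adjointness carries it over to the second factor as a raising operator, and the
  raising equation returns it to the third leg.\<close>

lemma theta_slice_step: "(of_int c + 1) * theta_slice n (c+1) = (2 * real n - of_int c) * theta_slice n c"
proof -
  have up: "(of_int c + 1) * threej n a b (c+1) = - ((of_int a + 1) * threej n (a+1) b c) - (of_int b + 1) * threej n a (b+1) c" for a b
    using threej_lower[of a n b c] by linarith
  have down: "(2 * real n - of_int c) * threej n a b c = - ((2 * real n - of_int a + 1) * threej n (a-1) b (c+1)) - (2 * real n - of_int b + 1) * threej n a (b-1) (c+1)" for a b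
    using threej_raise[of n a b "c+1"] by simp
  have "(of_int c + 1) * theta_slice n (c+1)
     = (\<Sum>a\<in>spins n. \<Sum>b\<in>spins n. weight n a * weight n b * threej n a b (c+1) * ((of_int c + 1) * threej n a b (c+1)))"
    unfolding theta_slice_def sum_distrib_left by (simp add: power2_eq_square mult_ac)
  also have "\<dots> = - (\<Sum>b\<in>spins n. weight n b * (\<Sum>a\<in>spins n. weight n a * (of_int a + 1) * (threej n a b (c+1) * threej n (a+1) b c)))
      - (\<Sum>a\<in>spins n. weight n a * (\<Sum>b\<in>spins n. weight n b * (of_int b + 1) * (threej n a b (c+1) * threej n a (b+1) c)))"
    unfolding up sum_distrib_left sum_negf[symmetric]
    by (subst sum.swap) (simp add: right_diff_distrib sum_subtractf mult_ac sum_negf)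
  also have "\<dots> = - (\<Sum>b\<in>spins n. weight n b * (\<Sum>a\<in>spins n. weight n a * (2 * real n - of_int a + 1) * (threej n (a-1) b (c+1) * threej n a b c)))
      - (\<Sum>a\<in>spins n. weight n a * (\<Sum>b\<in>spins n. weight n b * (2 * real n - of_int b + 1) * (threej n a (b-1) (c+1) * threej n a b c)))"
    by (subst (1 2) weight_shift) (auto simp: threej_eq_0)
  also have "\<dots> = (\<Sum>a\<in>spins n. \<Sum>b\<in>spins n. weight n a * weight n b * threej n a b c * ((2 * real n - of_int c) * threej n a b c))"
    unfolding down sum_distrib_left sum_negf[symmetric]
    by (subst sum.swap) (simp add: right_diff_distrib sum_subtractf mult_ac sum_negf)
  also have "\<dots> = (2 * real n - of_int c) * theta_slice n c"
    unfolding theta_slice_def sum_distrib_left by (simp add: power2_eq_square mult_ac)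
  finally show ?thesis .
qed

text \<open>Schur's lemma in coordinates. All \<open>2*n+1\<close> labels of the third leg
  contribute equally to \<open>theta\<close>, so it suffices to evaluate the slice
  \<open>c = 0\<close>, where the 3j-symbol is a signed binomial coefficient.\<close>

lemma theta_slice_const:
  assumes "c \<in> spins n"
  shows "weight n c * theta_slice n c = weight n 0 * theta_slice n 0"
proof -
  have "weight n (int k) * theta_slice n (int k) = weight n 0 * theta_slice n 0" if "k \<le> 2 * n" for k
    using that
  proof (induction k)
    case (Suc k)
    have "(real k + 1) * (weight n (int (Suc k)) * theta_slice n (int (Suc k)))
        = weight n (int k + 1) * (2 * real n - of_int (int k)) * theta_slice n (int k)"
      using arg_cong[OF theta_slice_step[of "int k" n], of "\<lambda>x. weight n (int k + 1) * x"] by (simp add: algebra_simps)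
    also have "\<dots> = (real k + 1) * (weight n (int k) * theta_slice n (int k))"
      using Suc.prems by (subst weight_step) auto
    finally show ?case using Suc by (simp add: add_eq_0_iff)
  qed simp
  from this[of "nat c"] assms show ?thesis by (simp add: spins_def nat_le_iff)
qed

text \<open>Classify the subsets of size \<open>p+q+1\<close> of a set of \<open>m+1\<close> numbers
  by their \<open>(p+1)\<close>-st smallest element: \<open>p\<close> elements lie below it and
  \<open>q\<close> above.\<close>

lemma convolution_binomial:
  "(\<Sum>i\<le>m. (i choose p) * (m - i choose q)) = (Suc m choose Suc (p + q))"
proof (induction m arbitrary: q)
  case 0
  then show ?case by (cases p; cases q) auto
next
  case (Suc m)
  show ?case
  proof (cases q)
    case 0
    then show ?thesis using sum_choose_upper[of p "Suc m"] by simp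
  next
    case (Suc r)
    have "(\<Sum>i\<le>Suc m. (i choose p) * (Suc m - i choose q)) = (\<Sum>i\<le>m. (i choose p) * (Suc (m - i) choose Suc r))"
      using Suc by (simp add: Suc_diff_le)
    also have "\<dots> = (\<Sum>i\<le>m. (i choose p) * (m - i choose r)) + (\<Sum>i\<le>m. (i choose p) * (m - i choose Suc r))"
      by (simp add: sum.distrib[symmetric] algebra_simps)
    also have "\<dots> = (Suc (Suc m) choose Suc (p + q))"
      unfolding Suc.IH using Suc by simp
    finally show ?thesis .
  qed
qed

text \<open>The case \<open>l = 0\<close> evaluates \<open>theta\<close>; the general case performs
  the inner summation that produces the Racah sum.\<close>

lemma convolution_binomial_shifted:
  assumes "l \<le> n"
  shows "(\<Sum>i=l..n. (n + i choose (n + l)) * (2 * n - i choose n)) = (3 * n + 1 choose (n - l))"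
proof -
  have "(\<Sum>i=l..n. (n + i choose (n + l)) * (2 * n - i choose n)) = (\<Sum>i=n+l..2*n. (i choose (n + l)) * (3 * n - i choose n))"
    by (rule sum.reindex_bij_witness[of _ "\<lambda>i. i - n" "\<lambda>i. n + i"]) auto
  also have "\<dots> = (\<Sum>i\<le>3*n. (i choose (n + l)) * (3 * n - i choose n))"
    by (intro sum.mono_neutral_left) (auto simp: not_le)
  also have "\<dots> = (3 * n + 1 choose (2 * n + l + 1))"
    unfolding convolution_binomial by (rule arg_cong2[where f=binomial]) simp_all
  also have "\<dots> = (3 * n + 1 choose (n - l))"
    using assms by (subst binomial_symmetric) auto
  finally show ?thesis .
qed

lemma sum_threej_bottom:
  "(\<Sum>a\<in>spins n. \<Sum>b\<in>spins n. f a b * threej n a b 0) = (\<Sum>i\<le>n. f (int n + int i) (2 * int n - int i) * threej n (int n + int i) (2 * int n - int i) 0)"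
proof -
  have *: "(\<Sum>b\<in>spins n. f a b * threej n a b 0) = f a (3 * int n - a) * threej n a (3 * int n - a) 0" if "a \<in> spins n" for a
  proof -
    have "(\<Sum>b\<in>spins n. f a b * threej n a b 0) = (\<Sum>b\<in>spins n. if b = 3 * int n - a then f a b * threej n a b 0 else 0)"
      by (intro sum.cong refl) (auto simp: threej_eq_0)
    also have "\<dots> = f a (3 * int n - a) * threej n a (3 * int n - a) 0"
      using that by (simp add: sum.delta) (auto simp: spins_def threej_eq_0)
    finally show ?thesis .
  qed
  have "(\<Sum>a\<in>spins n. \<Sum>b\<in>spins n. f a b * threej n a b 0) = (\<Sum>a\<in>spins n. f a (3 * int n - a) * threej n a (3 * int n - a) 0)"
    by (intro sum.cong refl *)
  also have "\<dots> = (\<Sum>a\<in>{int n..2 * int n}. f a (3 * int n - a) * threej n a (3 * int n - a) 0)"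
    by (intro sum.mono_neutral_right) (auto simp: spins_def threej_eq_0)
  also have "\<dots> = (\<Sum>i\<le>n. f (int n + int i) (2 * int n - int i) * threej n (int n + int i) (2 * int n - int i) 0)"
    by (rule sum.reindex_bij_witness[of _ "\<lambda>i. int n + int i" "\<lambda>a. nat (a - int n)"]) auto
  finally show ?thesis .
qed

lemma weight_pair:
  assumes "i \<le> n"
  shows "weight n (int n + int i) * weight n (int i) * (real (n choose i))^2 = (fact n)^2 * fact (n+i) * fact (2*n-i) / (fact i * fact (n-i))"
proof -
  have e: "nat (int n + int i) = n + i" "nat (2 * int n - (int n + int i)) = n - i"
    "nat (2 * int n - int i) = 2 * n - i" using assms by auto
  show ?thesis unfolding weight_def e binomial_fact[OF assms]
    by (simp add: power2_eq_square divide_simps)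
qed

lemma theta_closed: "theta n = (fact n)^3 * fact (3*n+1)"
proof -
  have "theta n = (\<Sum>c\<in>spins n. weight n c * theta_slice n c)"
  proof -
    have "theta n = (\<Sum>a\<in>spins n. \<Sum>c\<in>spins n. \<Sum>b\<in>spins n. weight n a * weight n b * weight n c * (threej n a b c)^2)"
      unfolding theta_def by (rule sum.cong[OF refl], rule sum.swap)
    also have "\<dots> = (\<Sum>c\<in>spins n. \<Sum>a\<in>spins n. \<Sum>b\<in>spins n. weight n a * weight n b * weight n c * (threej n a b c)^2)"
      by (rule sum.swap)
    finally show ?thesis unfolding theta_slice_def sum_distrib_left by (simp add: mult_ac)
  qed
  also have "\<dots> = (2 * real n + 1) * (weight n 0 * theta_slice n 0)"
    by (simp add: theta_slice_const card_spins)
  also have "theta_slice n 0 = (\<Sum>i\<le>n. weight n (int n + int i) * weight n (int i) * (real (n choose i))^2)"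
  proof -
    have "theta_slice n 0 = (\<Sum>a\<in>spins n. \<Sum>b\<in>spins n. (weight n a * weight n b * threej n a b 0) * threej n a b 0)"
      unfolding theta_slice_def power2_eq_square by (simp add: mult_ac)
    also have "\<dots> = (\<Sum>i\<le>n. (weight n (int n + int i) * weight n (2 * int n - int i) * threej n (int n + int i) (2 * int n - int i) 0)
       * threej n (int n + int i) (2 * int n - int i) 0)"
      by (rule sum_threej_bottom)
    also have "\<dots> = (\<Sum>i\<le>n. weight n (int n + int i) * weight n (int i) * (real (n choose i))^2)"
      by (intro sum.cong refl) (simp add: threej_bottom weight_complement power2_eq_square)
    finally show ?thesis .
  qed
  also have "\<dots> = (\<Sum>i\<le>n. (fact n)^4 * (real (n + i choose n) * real (2 * n - i choose n)))"
  proof (intro sum.cong refl)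
    fix i assume "i \<in> {..n}"
    then have i: "i \<le> n" by simp
    have b: "real (n + i choose n) = fact (n+i) / (fact n * fact i)" "real (2 * n - i choose n) = fact (2*n-i) / (fact n * fact (n-i))"
      using i by (auto simp: binomial_fact)
    show "weight n (int n + int i) * weight n (int i) * (real (n choose i))^2 = (fact n)^4 * (real (n + i choose n) * real (2 * n - i choose n))"
      unfolding weight_pair[OF i] b by (simp add: divide_simps power2_eq_square power4_eq_xxxx)
  qed
  also have "\<dots> = (fact n)^4 * real (3 * n + 1 choose n)"
    using convolution_binomial_shifted[of 0 n]
    unfolding sum_distrib_left[symmetric] of_nat_mult[symmetric] of_nat_sum[symmetric] by (simp add: atLeast0AtMost)
  also have "real (3 * n + 1 choose n) = fact (3*n+1) / (fact n * fact (2*n+1))"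
    by (simp add: binomial_fact)
  also have "weight n 0 = fact (2*n)" by (simp add: weight_def nat_mult_distrib)
  also have "(2 * real n + 1) * (fact (2*n) * ((fact n)^4 * (fact (3*n+1) / (fact n * fact (2*n+1))))) = (fact n)^3 * fact (3*n+1)"
    by (simp add: divide_simps power4_eq_xxxx power3_eq_cube)
  finally show ?thesis .
qed

section \<open>Invariant tensors and the triangle reduction\<close>

text \<open>The sign turns the inner product into the invariant bilinear pairing, in which a leg
  with label \<open>c\<close> is glued to a leg with label \<open>2*n - c\<close>.\<close>

definition sweight :: "nat \<Rightarrow> int \<Rightarrow> real" where
  "sweight n c = (-1) ^ nat c * weight n c"

lemma sweight_shift:
  assumes "h (2 * int n) = 0" "h (-1) = 0"
  shows "(\<Sum>c\<in>spins n. sweight n c * (of_int c + 1) * h c)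
       = - (\<Sum>c\<in>spins n. sweight n c * (2 * real n - of_int c + 1) * h (c-1))"
proof -
  have "(\<Sum>c\<in>spins n. sweight n c * (of_int c + 1) * h c)
     = (\<Sum>c\<in>spins n. weight n c * (of_int c + 1) * ((-1) ^ nat c * h c))"
    by (simp add: sweight_def mult_ac)
  also have "\<dots> = (\<Sum>c\<in>spins n. weight n c * (2 * real n - of_int c + 1) * ((-1) ^ nat (c-1) * h (c-1)))"
    using assms by (intro weight_shift[where h = "\<lambda>c. (-1) ^ nat c * h c"]) auto
  also have "\<dots> = (\<Sum>c\<in>spins n. - (sweight n c * (2 * real n - of_int c + 1) * h (c-1)))"
  proof (intro sum.cong refl)
    fix c assume "c \<in> spins n"
    then have "c = 0 \<or> nat c = Suc (nat (c-1))" by (simp add: spins_def) linarith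
    then consider "c = 0" | "nat c = Suc (nat (c-1))" by blast
    then show "weight n c * (2 * real n - of_int c + 1) * ((-1) ^ nat (c-1) * h (c-1)) = - (sweight n c * (2 * real n - of_int c + 1) * h (c-1))"
      using assms by cases (auto simp: sweight_def)
  qed
  finally show ?thesis by (simp add: sum_negf)
qed

text \<open>Invariance of the pairing: a lowering operator may be moved from one of two glued legs
  to the other at the cost of a sign. The two hypotheses say that both tensors vanish outside the
  range of labels, so no boundary terms arise.\<close>

lemma sweight_contract_lower:
  assumes "\<And>c. c < 0 \<or> 2 * int n < c \<Longrightarrow> f c = 0" "\<And>c. c < 0 \<or> 2 * int n < c \<Longrightarrow> g c = 0"
  shows "(\<Sum>c\<in>spins n. sweight n c * ((of_int c + 1) * f (c+1) * g (2 * int n - c)))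
       = - (\<Sum>c\<in>spins n. sweight n c * (f c * ((of_int (2 * int n - c) + 1) * g (2 * int n - c + 1))))"
  using sweight_shift[of "\<lambda>c. f (c+1) * g (2 * int n - c)" n] assms by (simp add: mult_ac algebra_simps)

text \<open>The weight-zero vectors killed by the raising and the lowering operator form a line: the
  raising equation determines the row with \<open>c = 0\<close>, the lowering equation all further rows.\<close>

lemma invariant_tensor_unique:
  fixes X :: "int \<Rightarrow> int \<Rightarrow> int \<Rightarrow> real"
  assumes supp: "\<And>a b c. a < 0 \<or> 2 * int n < a \<or> b < 0 \<or> 2 * int n < b \<or> c < 0 \<or> 2 * int n < c \<or> a + b + c \<noteq> 3 * int n \<Longrightarrow> X a b c = 0"
    and lower: "\<And>a b c. (of_int a + 1) * X (a+1) b c + (of_int b + 1) * X a (b+1) c + (of_int c + 1) * X a b (c+1) = 0"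
    and raise: "\<And>a b c. (2 * real n - of_int a + 1) * X (a-1) b c + (2 * real n - of_int b + 1) * X a (b-1) c
    + (2 * real n - of_int c + 1) * X a b (c-1) = 0"
  shows "X a b c = X (int n) (2 * int n) 0 * (-1)^n * threej n a b c"
proof -
  \<comment> \<open>The entry of \<open>threej\<close> at \<open>(n, 2*n, 0)\<close> is
    \<open>(-1)^n\<close>, so this multiple makes the difference \<open>Y\<close> vanish there,
    which starts the induction along the row.\<close>
  define k where "k = X (int n) (2 * int n) 0 * (-1)^n"
  define Y where "Y a b c = X a b c - k * threej n a b c" for a b c
  have suppY: "Y a b c = 0" if "a < 0 \<or> 2 * int n < a \<or> b < 0 \<or> 2 * int n < b \<or> c < 0 \<or> 2 * int n < c \<or> a + b + c \<noteq> 3 * int n" for a b c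
    unfolding Y_def using supp[OF that] threej_eq_0[OF that] by simp
  have lowerY: "(of_int a + 1) * Y (a+1) b c + (of_int b + 1) * Y a (b+1) c + (of_int c + 1) * Y a b (c+1) = 0" for a b c
    using lower[of a b c] arg_cong[OF threej_lower[of a n b c], of "\<lambda>x. k * x"] unfolding Y_def by (simp add: algebra_simps)
  have raiseY: "(2 * real n - of_int a + 1) * Y (a-1) b c + (2 * real n - of_int b + 1) * Y a (b-1) c
    + (2 * real n - of_int c + 1) * Y a b (c-1) = 0" for a b c
    using raise[of a b c] arg_cong[OF threej_raise[of n a b c], of "\<lambda>x. k * x"] unfolding Y_def by (simp add: algebra_simps)
  have row: "Y (int n + int j) (2 * int n - int j) 0 = 0" for j
  proof (induction j)
    case 0
    have "threej n (int n) (2 * int n) 0 = (-1)^n" using threej_bottom[of 0 n] by simp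
    then show ?case by (simp add: Y_def k_def)
  next
    case (Suc j)
    have "(real j + 1) * Y (int n + int (Suc j)) (2 * int n - int (Suc j)) 0 = 0"
      using raiseY[of "int n + int (Suc j)" "2 * int n - int j" 0] Suc
      by (simp add: suppY algebra_simps)
    then show ?case by (simp add: add_eq_0_iff)
  qed
  have row0: "Y a b 0 = 0" for a b
  proof (cases "a + b = 3 * int n \<and> b \<le> 2 * int n")
    case True
    then have "a = int n + int (nat (a - int n))" "b = 2 * int n - int (nat (a - int n))" by auto
    then show ?thesis using row[of "nat (a - int n)"] by simp
  qed (auto simp: suppY)
  have "Y a b (int m) = 0" for a b m
  proof (induction m arbitrary: a b)
    case 0
    then show ?case using row0 by simp
  next
    case (Suc m)
    have "(real m + 1) * Y a b (int m + 1) = 0" using lowerY[of a b "int m"] Suc by simp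
    then show ?case by (simp add: add_eq_0_iff add.commute)
  qed
  from this[of a b "nat c"] have "Y a b c = 0" using suppY[of a b c] by (cases "c < 0") auto
  then show ?thesis by (simp add: Y_def k_def)
qed


section \<open>Binomial sums for one entry of the triangle\<close>

lemma alternating_sum_Suc:
  fixes f :: "nat \<Rightarrow> real"
  shows "(\<Sum>l\<le>Suc j. (-1)^l * real (Suc j choose l) * f l) = (\<Sum>l\<le>j. (-1)^l * real (j choose l) * (f l - f (Suc l)))"
proof -
  have "(\<Sum>l\<le>Suc j. (-1)^l * real (Suc j choose l) * f l)
      = f 0 + (\<Sum>l\<le>j. (-1)^Suc l * real (j choose Suc l) * f (Suc l)) + (\<Sum>l\<le>j. (-1)^Suc l * real (j choose l) * f (Suc l))"
    unfolding sum.atMost_Suc_shift by (simp add: sum.distrib[symmetric] algebra_simps)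
  also have "f 0 + (\<Sum>l\<le>j. (-1)^Suc l * real (j choose Suc l) * f (Suc l)) = (\<Sum>l\<le>Suc j. (-1)^l * real (j choose l) * f l)"
    unfolding sum.atMost_Suc_shift by simp
  also have "\<dots> = (\<Sum>l\<le>j. (-1)^l * real (j choose l) * f l)" by simp
  finally show ?thesis by (simp add: sum.distrib[symmetric] sum_negf sum_subtractf algebra_simps)
qed

text \<open>The left side is a \<open>j\<close>-fold finite difference. Each single difference,
  supplied by \<open>alternating_sum_Suc\<close>, lowers the lower index by one through Pascal's
  rule.\<close>

lemma alternating_binomial_convolution:
  "(\<Sum>l\<le>j. (-1)^l * real (j choose l) * real (m + l choose (p + j))) = (-1)^j * real (m choose p)"
proof (induction j arbitrary: p)
  case (Suc j)
  have "(\<Sum>l\<le>Suc j. (-1)^l * real (Suc j choose l) * real (m + l choose (p + Suc j)))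
     = (\<Sum>l\<le>j. (-1)^l * real (j choose l) * - real (m + l choose (p + j)))"
    unfolding alternating_sum_Suc by simp
  then show ?case using Suc by (simp add: sum_negf)
qed simp

text \<open>On the right \<open>j\<close> occurs in a single binomial coefficient, so that the later
  convolution with \<open>n choose (i-j)\<close> is Vandermonde's. After extracting
  \<open>n choose j\<close>, the sum over \<open>l\<close> is the \<open>j\<close>-fold difference
  of \<open>n + l choose n\<close>; the odd form \<open>n - j + j\<close> of that lower index serves
  to match the preceding lemma.\<close>

lemma square_binomial_expansion:
  assumes "j \<le> n"
  shows "(-1)^j * (real (n choose j))^2 = (\<Sum>l\<le>j. (-1)^l * real (n choose l) * real (n + l choose l) * real (n - l choose (j - l)))"
proof -
  have "(\<Sum>l\<le>j. (-1)^l * real (n choose l) * real (n + l choose l) * real (n - l choose (j - l)))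
     = (\<Sum>l\<le>j. real (n choose j) * ((-1)^l * real (j choose l) * real (n + l choose (n - j + j))))"
  proof (intro sum.cong refl)
    fix l assume "l \<in> {..j}"
    then have l: "l \<le> j" by simp
    have "real (n choose l) * real (n - l choose (j - l)) = real (n choose j) * real (j choose l)"
      using choose_mult[OF l assms] by (simp only: of_nat_mult[symmetric])
    moreover have "n + l choose l = (n + l choose (n - j + j))"
      using assms by (subst binomial_symmetric) auto
    ultimately show "(-1)^l * real (n choose l) * real (n + l choose l) * real (n - l choose (j - l))
      = real (n choose j) * ((-1)^l * real (j choose l) * real (n + l choose (n - j + j)))"
      by (simp add: mult_ac)
  qed
  also have "\<dots> = real (n choose j) * ((-1)^j * real (n choose (n - j)))"
    unfolding sum_distrib_left[symmetric] alternating_binomial_convolution ..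
  also have "n choose (n - j) = n choose j" using binomial_symmetric[OF assms] by simp
  finally show ?thesis by (simp add: power2_eq_square mult_ac)
qed

lemma middle_sum:
  assumes "i \<le> n"
  shows "(\<Sum>j\<le>i. (-1)^j * (real (n choose j))^2 * real (n choose (i-j)))
    = (\<Sum>l\<le>i. (-1)^l * real (n choose l) * real (n + l choose l) * real (2 * n - l choose (i - l)))"
proof -
  define g where "g l = (-1)^l * real (n choose l) * real (n + l choose l)" for l
  have "(\<Sum>j\<le>i. (-1)^j * (real (n choose j))^2 * real (n choose (i-j)))
     = (\<Sum>j\<le>i. \<Sum>l\<le>j. g l * real (n - l choose (j - l)) * real (n choose (i-j)))"
    using assms by (intro sum.cong refl) (auto simp: square_binomial_expansion sum_distrib_right g_def)
  also have "\<dots> = (\<Sum>j\<le>i. \<Sum>l\<le>i. if l \<le> j then g l * real (n - l choose (j - l)) * real (n choose (i-j)) else 0)"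
    by (intro sum.cong refl sum.mono_neutral_cong_left) auto
  also have "\<dots> = (\<Sum>l\<le>i. \<Sum>j\<le>i. if l \<le> j then g l * real (n - l choose (j - l)) * real (n choose (i-j)) else 0)"
    by (rule sum.swap)
  also have "\<dots> = (\<Sum>l\<le>i. g l * real (2 * n - l choose (i - l)))"
  proof (intro sum.cong refl)
    fix l assume "l \<in> {..i}"
    then have l: "l \<le> i" by simp
    have "(\<Sum>j\<le>i. if l \<le> j then g l * real (n - l choose (j - l)) * real (n choose (i-j)) else 0)
        = (\<Sum>j=l..i. g l * real (n - l choose (j - l)) * real (n choose (i-j)))"
      by (intro sum.mono_neutral_cong_right) auto
    also have "\<dots> = (\<Sum>k\<le>i-l. g l * real (n - l choose k) * real (n choose (i-l-k)))"
      using l by (intro sum.reindex_bij_witness[of _ "\<lambda>k. l + k" "\<lambda>j. j - l"]) auto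
    also have "\<dots> = g l * real (\<Sum>k\<le>i-l. (n - l choose k) * (n choose (i-l-k)))"
      by (simp add: sum_distrib_left mult_ac)
    also have "(\<Sum>k\<le>i-l. (n - l choose k) * (n choose (i-l-k))) = (n - l + n choose (i - l))"
      by (rule vandermonde)
    also have "n - l + n = 2 * n - l" using l assms by simp
    finally show "(\<Sum>j\<le>i. if l \<le> j then g l * real (n - l choose (j - l)) * real (n choose (i-j)) else 0) = g l * real (2 * n - l choose (i - l))" .
  qed
  finally show ?thesis by (simp add: g_def)
qed

text \<open>After \<open>middle_sum\<close> and cancellation of factorials, \<open>i\<close>
  survives only in \<open>(n + i choose (n + l)) * (2 * n - i choose n)\<close>. Summing over
  \<open>i\<close> first gives a closed form, and the remaining sum over \<open>l\<close> is the
  Racah sum.\<close>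

lemma triangle_coefficient:
  "(\<Sum>i\<le>n. weight n (int n + int i) * (weight n (int i))^2 * (real (n choose i))^2 *
      (\<Sum>j\<le>i. (-1)^j * (real (n choose j))^2 * real (n choose (i-j)))) = theta n * racah n"
proof -
  let ?t = "\<lambda>i l. (fact n)^3 * ((-1)^l * real (n choose l) * real (n + l choose l) * fact (2*n-l) * fact (n+l)) * real ((n + i choose (n + l)) * (2 * n - i choose n)) :: real"
  let ?w = "\<lambda>i. weight n (int n + int i) * (weight n (int i))^2 * (real (n choose i))^2 * (\<Sum>j\<le>i. (-1)^j * (real (n choose j))^2 * real (n choose (i-j)))"
  have "(\<Sum>i\<le>n. ?w i)
    = (\<Sum>i\<le>n. \<Sum>l\<le>i. ?t i l)"
  proof (intro sum.cong refl)
    fix i assume "i \<in> {..n}"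
    then have i: "i \<le> n" by simp
    have "?w i
     = (weight n (int n + int i) * weight n (int i) * (real (n choose i))^2) * (weight n (int i) *
      (\<Sum>l\<le>i. (-1)^l * real (n choose l) * real (n + l choose l) * real (2 * n - l choose (i - l))))"
      unfolding middle_sum[OF i] by (simp only: power2_eq_square mult_ac)
    also have "\<dots> = (\<Sum>l\<le>i. ((-1)^l * real (n choose l) * real (n + l choose l)) *
        ((fact n)^2 * fact (n+i) * fact (2*n-i) / (fact i * fact (n-i)) * (weight n (int i) * real (2 * n - l choose (i - l)))))"
      unfolding weight_pair[OF i] sum_distrib_left by (simp only: mult_ac)
    also have "\<dots> = (\<Sum>l\<le>i. ?t i l)"
    proof (intro sum.cong refl)
      fix l assume "l \<in> {..i}"
      then have l: "l \<le> i" by simp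
      have w: "weight n (int i) = fact i * fact (2*n-i)"
      proof -
        have "nat (2 * int n - int i) = 2 * n - i" using i by auto
        then show ?thesis by (simp add: weight_def)
      qed
      have b: "real (2 * n - l choose (i - l)) = fact (2*n-l) / (fact (i-l) * fact (2*n-i))"
        "real (n + i choose (n + l)) = fact (n+i) / (fact (n+l) * fact (i-l))"
        "real (2 * n - i choose n) = fact (2*n-i) / (fact n * fact (n-i))"
        using i l by (auto simp: binomial_fact)
      have "(fact n)^2 * fact (n+i) * fact (2*n-i) / (fact i * fact (n-i)) * (weight n (int i) * real (2 * n - l choose (i - l)))
        = (fact n)^3 * fact (2*n-l) * fact (n+l) * real ((n + i choose (n + l)) * (2 * n - i choose n))"
        unfolding of_nat_mult w b by (simp add: divide_simps power2_eq_square power3_eq_cube)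
      then show "((-1)^l * real (n choose l) * real (n + l choose l)) *
        ((fact n)^2 * fact (n+i) * fact (2*n-i) / (fact i * fact (n-i)) * (weight n (int i) * real (2 * n - l choose (i - l))))
        = ?t i l"
        by (simp only: mult_ac)
    qed
    finally show "?w i = \<dots>" .
  qed
  also have "\<dots> = (\<Sum>i\<le>n. \<Sum>l\<le>n. if l \<le> i then ?t i l else 0)"
    by (intro sum.cong refl sum.mono_neutral_cong_left) auto
  also have "\<dots> = (\<Sum>l\<le>n. \<Sum>i\<le>n. if l \<le> i then ?t i l else 0)"
    by (rule sum.swap)
  also have "\<dots> = (\<Sum>l\<le>n. theta n * racah_term n l)"
  proof (intro sum.cong refl)
    fix l assume "l \<in> {..n}"
    then have l: "l \<le> n" by simp
    have "(\<Sum>i\<le>n. if l \<le> i then ?t i l else 0)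
       = (\<Sum>i=l..n. ?t i l)"
      by (intro sum.mono_neutral_cong_right) auto
    also have "\<dots> = (fact n)^3 * ((-1)^l * real (n choose l) * real (n + l choose l) * fact (2*n-l) * fact (n+l))
         * real (3 * n + 1 choose (n - l))"
      unfolding sum_distrib_left[symmetric] of_nat_sum[symmetric] convolution_binomial_shifted[OF l] ..
    also have "\<dots> = theta n * racah_term n l"
    proof -
      have b: "real (n choose l) = fact n / (fact l * fact (n-l))" "real (n + l choose l) = fact (n+l) / (fact l * fact n)"
        "real (3 * n + 1 choose (n - l)) = fact (3*n+1) / (fact (n-l) * fact (2*n+l+1))"
        using l by (auto simp: binomial_fact)
      show ?thesis unfolding theta_closed racah_term_def b
        by (simp add: divide_simps power2_eq_square)
    qed
    finally show "(\<Sum>i\<le>n. if l \<le> i then ?t i l else 0) = theta n * racah_term n l" .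
  qed
  finally show ?thesis by (simp add: racah_def sum_distrib_left)
qed

text \<open>Three vertices glued along the sides of a triangle, with free legs \<open>a\<close>,
  \<open>b\<close>, \<open>c\<close>. Each side label occurs once as itself and once reflected, as
  the pairing \<open>sweight\<close> requires.\<close>

definition triangle :: "nat \<Rightarrow> int \<Rightarrow> int \<Rightarrow> int \<Rightarrow> real" where
  "triangle n a b c = (\<Sum>u\<in>spins n. \<Sum>v\<in>spins n. \<Sum>p\<in>spins n. sweight n u * sweight n v * sweight n p *
     (threej n (2 * int n - u) (2 * int n - v) b * threej n p u c * threej n a v (2 * int n - p)))"

lemma sweight_complement: "c \<in> spins n \<Longrightarrow> sweight n (2 * int n - c) = sweight n c"
proof -
  assume "c \<in> spins n"
  then have "nat (2 * int n - c) + nat c = 2 * n" by (auto simp: spins_def)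
  then have "even (nat (2 * int n - c)) = even (nat c)" by (metis dvd_triv_left even_add)
  then have "(-1::real) ^ nat (2 * int n - c) = (-1) ^ nat c"
    by (simp add: minus_one_power_iff)
  then show ?thesis by (simp add: sweight_def weight_complement)
qed

lemma triangle_complement:
  "triangle n (2 * int n - a) (2 * int n - b) (2 * int n - c) = (-1)^n * triangle n a b c"
proof -
  let ?N = "2 * int n"
  have "triangle n (?N - a) (?N - b) (?N - c)
   = (\<Sum>u\<in>spins n. \<Sum>v\<in>spins n. \<Sum>p\<in>spins n. sweight n (?N-u) * sweight n (?N-v) * sweight n (?N-p) *
     (threej n (?N - (?N-u)) (?N - (?N-v)) (?N-b) * threej n (?N-p) (?N-u) (?N-c) * threej n (?N-a) (?N-v) (?N - (?N-p))))"
    unfolding triangle_def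
    by (subst sum_spins_complement[symmetric], rule sum.cong[OF refl],
        subst sum_spins_complement[symmetric], rule sum.cong[OF refl],
        subst sum_spins_complement[symmetric]) (rule refl)
  also have "\<dots> = (-1)^n * triangle n a b c"
    unfolding triangle_def sum_distrib_left
  proof (intro sum.cong refl, goal_cases)
    case (1 u v p)
    have m: "(-1::real)^n * ((-1)^n * x) = x" for x by (simp add: power_add[symmetric] mult.assoc[symmetric])
    have e: "threej n (?N - (?N-u)) (?N - (?N-v)) (?N-b) = (-1)^n * threej n (?N-u) (?N-v) b"
      by (rule threej_complement)
    note w = sweight_complement[OF 1(1)] sweight_complement[OF 1(2)] sweight_complement[OF 1(3)]
    show ?case unfolding e threej_complement w by (simp add: mult_ac m)
  qed
  finally show ?thesis .
qed

text \<open>Lowering a free leg is minus lowering the two inner legs of the same vertex. Of the six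
  resulting terms, the two that act on the ends of the same side cancel by invariance of the
  pairing.\<close>

lemma triangle_lower:
  "(of_int a + 1) * triangle n (a+1) b c + (of_int b + 1) * triangle n a (b+1) c + (of_int c + 1) * triangle n a b (c+1) = 0"
proof -
  let ?N = "2 * int n"
  let ?Uu = "\<lambda>u v. (of_int (?N - u) + 1) * threej n (?N - u + 1) (?N - v) b"
  let ?Uv = "\<lambda>u v. (of_int (?N - v) + 1) * threej n (?N - u) (?N - v + 1) b"
  let ?Vv = "\<lambda>v p. (of_int v + 1) * threej n a (v+1) (?N - p)"
  let ?Vp = "\<lambda>v p. (of_int (?N - p) + 1) * threej n a v (?N - p + 1)"
  let ?Cp = "\<lambda>p u. (of_int p + 1) * threej n (p+1) u c"
  let ?Cu = "\<lambda>p u. (of_int u + 1) * threej n p (u+1) c"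
  define S where "S g = (\<Sum>u\<in>spins n. \<Sum>v\<in>spins n. \<Sum>p\<in>spins n. sweight n u * sweight n v * sweight n p * g u v p)" for g :: "int \<Rightarrow> int \<Rightarrow> int \<Rightarrow> real"
  define U where "U u v b = threej n (?N - u) (?N - v) b" for u v b
  define C where "C p u c = threej n p u c" for p u c
  define V where "V a v p = threej n a v (?N - p)" for a v p
  have S_add: "S (\<lambda>u v p. g u v p + h u v p) = S g + S h" for g h
    unfolding S_def by (simp add: distrib_left sum.distrib)
  have S_neg: "S (\<lambda>u v p. - g u v p) = - S g" for g
    unfolding S_def by (simp add: sum_negf)
  have t: "triangle n a b c = S (\<lambda>u v p. U u v b * C p u c * V a v p)" for a b c
    unfolding triangle_def S_def U_def C_def V_def ..
  have 1: "(of_int a + 1) * triangle n (a+1) b c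
    = - S (\<lambda>u v p. U u v b * C p u c * ?Vv v p)
      - S (\<lambda>u v p. U u v b * C p u c * ?Vp v p)"
  proof -
    have "(of_int a + 1) * V (a+1) v p = - ?Vv v p + - ?Vp v p" for v p
      using threej_lower[of a n v "?N - p"] unfolding V_def by linarith
    then have "U u v b * C p u c * ((of_int a + 1) * V (a+1) v p) = - (U u v b * C p u c * ?Vv v p)
       + - (U u v b * C p u c * ?Vp v p)" for u v p
      by (simp only: distrib_left mult_minus_right)
    moreover have "(of_int a + 1) * triangle n (a+1) b c = S (\<lambda>u v p. U u v b * C p u c * ((of_int a + 1) * V (a+1) v p))"
      unfolding t S_def sum_distrib_left by (simp only: mult_ac)
    ultimately show ?thesis by (simp only: S_add S_neg)
  qed
  have 2: "(of_int b + 1) * triangle n a (b+1) c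
    = - S (\<lambda>u v p. ?Uu u v * C p u c * V a v p)
      - S (\<lambda>u v p. ?Uv u v * C p u c * V a v p)"
  proof -
    have "(of_int b + 1) * U u v (b+1) = - ?Uu u v + - ?Uv u v" for u v
      using threej_lower[of "?N - u" n "?N - v" b] unfolding U_def by linarith
    then have "((of_int b + 1) * U u v (b+1)) * C p u c * V a v p = - (?Uu u v * C p u c * V a v p)
       + - (?Uv u v * C p u c * V a v p)" for u v p
      by (simp only: distrib_right mult_minus_left)
    moreover have "(of_int b + 1) * triangle n a (b+1) c = S (\<lambda>u v p. ((of_int b + 1) * U u v (b+1)) * C p u c * V a v p)"
      unfolding t S_def sum_distrib_left by (simp only: mult_ac)
    ultimately show ?thesis by (simp only: S_add S_neg)
  qed
  have 3: "(of_int c + 1) * triangle n a b (c+1)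
    = - S (\<lambda>u v p. U u v b * ?Cp p u * V a v p)
      - S (\<lambda>u v p. U u v b * ?Cu p u * V a v p)"
  proof -
    have "(of_int c + 1) * C p u (c+1) = - ?Cp p u + - ?Cu p u" for u p
      using threej_lower[of p n u c] unfolding C_def by linarith
    then have "U u v b * ((of_int c + 1) * C p u (c+1)) * V a v p = - (U u v b * ?Cp p u * V a v p)
       + - (U u v b * ?Cu p u * V a v p)" for u v p
      by (simp only: distrib_left distrib_right mult_minus_left mult_minus_right)
    moreover have "(of_int c + 1) * triangle n a b (c+1) = S (\<lambda>u v p. U u v b * ((of_int c + 1) * C p u (c+1)) * V a v p)"
      unfolding t S_def sum_distrib_left by (simp only: mult_ac)
    ultimately show ?thesis by (simp only: S_add S_neg)
  qed
  have cu: "S (\<lambda>u v p. U u v b * ?Cu p u * V a v p)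
     = - S (\<lambda>u v p. ?Uu u v * C p u c * V a v p)"
  proof -
    have swap: "S g = (\<Sum>v\<in>spins n. \<Sum>p\<in>spins n. \<Sum>u\<in>spins n. sweight n u * sweight n v * sweight n p * g u v p)" for g
      unfolding S_def by (subst sum.swap, rule sum.cong[OF refl], rule sum.swap)
    have "sweight n v * sweight n p * V a v p * (\<Sum>u\<in>spins n. sweight n u * ((of_int u + 1) * threej n p (u+1) c * threej n (?N - u) (?N - v) b))
      = sweight n v * sweight n p * V a v p * - (\<Sum>u\<in>spins n. sweight n u * (threej n p u c * ?Uu u v))" for v p
      by (subst sweight_contract_lower[of n "\<lambda>u. threej n p u c" "\<lambda>u. threej n u (?N - v) b"]) (auto simp: threej_eq_0)
    note contract = this
    show ?thesis unfolding swap sum_negf[symmetric] U_def C_def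
    proof (rule sum.cong[OF refl], rule sum.cong[OF refl], goal_cases)
      case (1 v p)
      show ?case using contract[of v p] unfolding U_def C_def
        by (simp only: sum_distrib_left sum_negf[symmetric] mult_ac mult_minus_right)
    qed
  qed
  have cv: "S (\<lambda>u v p. U u v b * C p u c * ?Vv v p)
     = - S (\<lambda>u v p. ?Uv u v * C p u c * V a v p)"
  proof -
    have swap: "S g = (\<Sum>u\<in>spins n. \<Sum>p\<in>spins n. \<Sum>v\<in>spins n. sweight n u * sweight n v * sweight n p * g u v p)" for g
      unfolding S_def by (rule sum.cong[OF refl], rule sum.swap)
    have "sweight n u * sweight n p * C p u c * (\<Sum>v\<in>spins n. sweight n v * ((of_int v + 1) * threej n a (v+1) (?N - p) * threej n (?N - u) (?N - v) b))
      = sweight n u * sweight n p * C p u c * - (\<Sum>v\<in>spins n. sweight n v * (threej n a v (?N - p) * ?Uv u v))" for u p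
      by (subst sweight_contract_lower[of n "\<lambda>v. threej n a v (?N - p)" "\<lambda>v. threej n (?N - u) v b"]) (auto simp: threej_eq_0)
    note contract = this
    show ?thesis unfolding swap sum_negf[symmetric] U_def V_def
    proof (rule sum.cong[OF refl], rule sum.cong[OF refl], goal_cases)
      case (1 u p)
      show ?case using contract[of u p] unfolding U_def V_def
        by (simp only: sum_distrib_left sum_negf[symmetric] mult_ac mult_minus_right)
    qed
  qed
  have cp: "S (\<lambda>u v p. U u v b * ?Cp p u * V a v p)
     = - S (\<lambda>u v p. U u v b * C p u c * ?Vp v p)"
  proof -
    have "sweight n u * sweight n v * U u v b * (\<Sum>p\<in>spins n. sweight n p * ((of_int p + 1) * threej n (p+1) u c * threej n a v (?N - p)))
      = sweight n u * sweight n v * U u v b * - (\<Sum>p\<in>spins n. sweight n p * (threej n p u c * ?Vp v p))" for u v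
      by (subst sweight_contract_lower[of n "\<lambda>p. threej n p u c" "\<lambda>p. threej n a v p"]) (auto simp: threej_eq_0)
    note contract = this
    show ?thesis unfolding S_def sum_negf[symmetric] V_def C_def
    proof (rule sum.cong[OF refl], rule sum.cong[OF refl], goal_cases)
      case (1 u v)
      show ?case using contract[of u v] unfolding V_def C_def
        by (simp only: sum_distrib_left sum_negf[symmetric] mult_ac mult_minus_right)
    qed
  qed
  show ?thesis unfolding 1 2 3 cu cv cp by simp
qed

lemma triangle_raise:
  "(2 * real n - of_int a + 1) * triangle n (a-1) b c + (2 * real n - of_int b + 1) * triangle n a (b-1) c
    + (2 * real n - of_int c + 1) * triangle n a b (c-1) = 0"
proof -
  have *: "2 * int n - x + 1 = 2 * int n - (x - 1)" for x by simp
  have "(-1)^n * ((2 * real n - of_int a + 1) * triangle n (a-1) b c + (2 * real n - of_int b + 1) * triangle n a (b-1) c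
    + (2 * real n - of_int c + 1) * triangle n a b (c-1)) = 0"
    using triangle_lower[of "2 * int n - a" n "2 * int n - b" "2 * int n - c"]
    unfolding * triangle_complement by (simp add: algebra_simps)
  then show ?thesis by simp
qed

lemma triangle_eq_0:
  assumes "a < 0 \<or> 2 * int n < a \<or> b < 0 \<or> 2 * int n < b \<or> c < 0 \<or> 2 * int n < c \<or> a + b + c \<noteq> 3 * int n"
  shows "triangle n a b c = 0"
  unfolding triangle_def
proof (intro sum.neutral ballI)
  fix u v p
  have "threej n (2 * int n - u) (2 * int n - v) b = 0 \<or> threej n p u c = 0 \<or> threej n a v (2 * int n - p) = 0"
  proof (rule ccontr)
    assume "\<not> ?thesis"
    then have nz: "threej n (2 * int n - u) (2 * int n - v) b \<noteq> 0" "threej n p u c \<noteq> 0" "threej n a v (2 * int n - p) \<noteq> 0" by auto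
    have "\<not> (b < 0 \<or> 2 * int n < b \<or> (2 * int n - u) + (2 * int n - v) + b \<noteq> 3 * int n)"
      using nz(1) threej_eq_0 by blast
    moreover have "\<not> (c < 0 \<or> 2 * int n < c \<or> p + u + c \<noteq> 3 * int n)"
      using nz(2) threej_eq_0 by blast
    moreover have "\<not> (a < 0 \<or> 2 * int n < a \<or> a + v + (2 * int n - p) \<noteq> 3 * int n)"
      using nz(3) threej_eq_0 by blast
    ultimately show False using assms by linarith
  qed
  then show "sweight n u * sweight n v * sweight n p *
     (threej n (2 * int n - u) (2 * int n - v) b * threej n p u c * threej n a v (2 * int n - p)) = 0" by auto
qed

lemma sweight_nonneg_int:
  "sweight n (int i) = (-1)^i * weight n (int i)"
  "sweight n (int n + int i) = (-1)^(n+i) * weight n (int n + int i)"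
proof -
  have "nat (int n + int i) = n + i" by simp
  then show "sweight n (int n + int i) = (-1)^(n+i) * weight n (int n + int i)"
    by (simp add: sweight_def)
qed (simp add: sweight_def)

text \<open>The extreme labels \<open>2*n\<close> and 0 on two free legs reduce the corresponding
  vertices to signed binomial coefficients and leave one free side label \<open>i\<close>. Only the
  third vertex still contains a sum, and its label \<open>n\<close> makes it accessible to
  \<open>threej_middle\<close>.\<close>

lemma triangle_corner: "triangle n (int n) (2 * int n) 0 = theta n * racah n"
proof -
  let ?N = "2 * int n"
  define f where "f p u = (\<Sum>v\<in>spins n. sweight n u * sweight n v * sweight n p * (threej n (?N - u) (?N - v) ?N * threej n (int n) v (?N - p)))" for p u
  have "triangle n (int n) ?N 0 = (\<Sum>u\<in>spins n. \<Sum>v\<in>spins n. \<Sum>p\<in>spins n. sweight n u * sweight n v * sweight n p *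
     (threej n (?N - u) (?N - v) ?N * threej n p u 0 * threej n (int n) v (?N - p)))"
    unfolding triangle_def ..
  also have "\<dots> = (\<Sum>u\<in>spins n. \<Sum>p\<in>spins n. \<Sum>v\<in>spins n. sweight n u * sweight n v * sweight n p *
     (threej n (?N - u) (?N - v) ?N * threej n p u 0 * threej n (int n) v (?N - p)))"
    by (rule sum.cong[OF refl], rule sum.swap)
  also have "\<dots> = (\<Sum>p\<in>spins n. \<Sum>u\<in>spins n. f p u * threej n p u 0)"
    unfolding f_def sum_distrib_right by (subst sum.swap) (simp add: mult_ac)
  also have "\<dots> = (\<Sum>i\<le>n. f (int n + int i) (?N - int i) * threej n (int n + int i) (?N - int i) 0)"
    by (rule sum_threej_bottom)
  \<comment> \<open>The reflected index \<open>n-i\<close> is the parameter for which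
    \<open>threej_middle\<close> describes the third vertex; \<open>sum_complement\<close> reverses
    the summation at the end.\<close>
  also have "\<dots> = (\<Sum>i\<le>n. weight n (int n + int (n-i)) * (weight n (int (n-i)))^2 * (real (n choose (n-i)))^2 *
      (\<Sum>j\<le>n-i. (-1)^j * (real (n choose j))^2 * real (n choose (n-i-j))))"
  proof (rule sum.cong[OF refl])
    fix i assume "i \<in> {..n}"
    then have i: "i \<le> n" by simp
    have top: "threej n (int i) (int n - int i) ?N = (-1)^(n+i) * real (n choose i)"
    proof -
      have "threej n (int i) (int n - int i) ?N = (-1)^n * threej n (?N - int i) (int n + int i) 0"
        using threej_complement[of n "?N - int i" "int n + int i" 0] by simp
      also have "threej n (?N - int i) (int n + int i) 0 = (-1)^(n+(n-i)) * real (n choose (n-i))"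
        using threej_bottom[of "n-i" n] i by (simp add: of_nat_diff algebra_simps)
      also have "n choose (n - i) = n choose i" using binomial_symmetric[OF i] by simp
      also have "(-1::real)^n * ((-1)^(n+(n-i)) * real (n choose i)) = (-1)^(n+i) * real (n choose i)"
        using i by (auto simp: minus_one_power_iff)
      finally show ?thesis .
    qed
    have "f (int n + int i) (?N - int i) = (\<Sum>v\<in>spins n. if v = int n + int i then
        sweight n (?N - int i) * sweight n v * sweight n (int n + int i) * (threej n (int i) (?N - v) ?N * threej n (int n) v (int n - int i)) else 0)"
      unfolding f_def by (intro sum.cong refl) (auto simp: threej_eq_0)
    also have "\<dots> = sweight n (?N - int i) * sweight n (int n + int i) * sweight n (int n + int i) * (threej n (int i) (int n - int i) ?N * threej n (int n) (int n + int i) (int n - int i))"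
      using i by (simp add: sum.delta spins_def)
    also have "threej n (int n) (int n + int i) (int n - int i) = (-1)^(n+(n-i)) * (\<Sum>j\<le>n-i. (-1)^j * (real (n choose j))^2 * real (n choose (n-i-j)))"
      using threej_middle[of "n-i" n] i by (simp add: of_nat_diff algebra_simps)
    also have "sweight n (?N - int i) = (-1)^i * weight n (int i)"
      using i by (subst sweight_complement) (auto simp: spins_def sweight_nonneg_int)
    finally have f: "f (int n + int i) (?N - int i) = (-1)^i * weight n (int i) * sweight n (int n + int i) * sweight n (int n + int i) *
      (threej n (int i) (int n - int i) ?N * ((-1)^(n+(n-i)) * (\<Sum>j\<le>n-i. (-1)^j * (real (n choose j))^2 * real (n choose (n-i-j)))))" .
    have w: "weight n (int n + int (n-i)) = weight n (int i)" "weight n (int (n-i)) = weight n (int n + int i)"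
      using weight_complement[of n "int i"] weight_complement[of n "int n + int i"] i by (simp_all add: of_nat_diff algebra_simps)
    have sgn: "(-1::real)^n * (-1)^n = 1" "(-1::real)^i * (-1)^i = 1" "(-1::real)^(n-i) = (-1)^n * (-1)^i"
      using i by (auto simp: minus_one_power_iff)
    have b: "n choose (n - i) = n choose i" using binomial_symmetric[OF i] by simp
    let ?M = "\<Sum>j\<le>n-i. (-1)^j * (real (n choose j))^2 * real (n choose (n-i-j))"
    have "f (int n + int i) (?N - int i) * threej n (int n + int i) (?N - int i) 0
      = (((-1)^n * (-1)^n) ^ 3 * (((-1)^i * (-1)^i) ^ 3 :: real)) *
        (weight n (int i) * (weight n (int n + int i))^2 * (real (n choose i))^2 * ?M)"
      unfolding f top threej_bottom[OF i] sweight_nonneg_int power_add sgn(3)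
      by (simp only: power2_eq_square power3_eq_cube mult_ac)
    then show "f (int n + int i) (?N - int i) * threej n (int n + int i) (?N - int i) 0
       = weight n (int n + int (n-i)) * (weight n (int (n-i)))^2 * (real (n choose (n-i)))^2 * ?M"
      unfolding w b sgn by simp
  qed
  also have "\<dots> = theta n * racah n"
    unfolding triangle_coefficient[symmetric] by (rule sum_complement)
  finally show ?thesis .
qed

text \<open>A contraction of invariant tensors is invariant, hence a multiple of the 3j-symbol, and
  a single entry determines the multiple.\<close>

theorem triangle_reduction: "triangle n a b c = (-1)^n * theta n * racah n * threej n a b c"
  using invariant_tensor_unique[of n "triangle n", OF triangle_eq_0 triangle_lower triangle_raise]
  unfolding triangle_corner by (simp add: mult_ac)

section \<open>Wheel amplitudes\<close>

definition lists_of :: "nat \<Rightarrow> nat \<Rightarrow> int list set" where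
  "lists_of n s = {cs. set cs \<subseteq> spins n \<and> length cs = s}"

lemma sum_lists_of_0: "(\<Sum>cs\<in>lists_of n 0. f cs) = f []"
proof -
  have "lists_of n 0 = {[]}" by (auto simp: lists_of_def)
  then show ?thesis by simp
qed

lemma sum_lists_of_Suc: "(\<Sum>cs\<in>lists_of n (Suc s). f cs) = (\<Sum>c\<in>spins n. \<Sum>cs\<in>lists_of n s. f (c # cs))"
proof -
  have "(\<Sum>cs\<in>lists_of n (Suc s). f cs) = (\<Sum>(c, cs)\<in>spins n \<times> lists_of n s. f (c # cs))"
    by (rule sum.reindex_bij_witness[of _ "\<lambda>(c, cs). c # cs" "\<lambda>cs. (hd cs, tl cs)"])
       (auto simp: lists_of_def length_Suc_conv)
  then show ?thesis by (simp add: sum.cartesian_product)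
qed

section \<open>Matrices indexed by labels and their Hilbert-Schmidt norm\<close>

definition mmul :: "nat \<Rightarrow> (int \<Rightarrow> int \<Rightarrow> real) \<Rightarrow> (int \<Rightarrow> int \<Rightarrow> real) \<Rightarrow> int \<Rightarrow> int \<Rightarrow> real" where
  "mmul n M N p q = (\<Sum>r\<in>spins n. M p r * N r q)"

definition mtrace :: "nat \<Rightarrow> (int \<Rightarrow> int \<Rightarrow> real) \<Rightarrow> real" where
  "mtrace n M = (\<Sum>p\<in>spins n. M p p)"

definition frob :: "nat \<Rightarrow> (int \<Rightarrow> int \<Rightarrow> real) \<Rightarrow> real" where
  "frob n M = (\<Sum>p\<in>spins n. \<Sum>q\<in>spins n. (M p q)^2)"

definition mone :: "int \<Rightarrow> int \<Rightarrow> real" where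
  "mone p q = (if p = q then 1 else 0)"

lemma frob_nonneg: "frob n M \<ge> 0"
  by (simp add: frob_def sum_nonneg)

lemma frob_mmul: "frob n (mmul n M N) \<le> frob n M * frob n N"
proof -
  have "(mmul n M N p q)^2 \<le> (\<Sum>r\<in>spins n. (M p r)^2) * (\<Sum>r\<in>spins n. (N r q)^2)" for p q
    unfolding mmul_def by (rule Cauchy_Schwarz_ineq_sum)
  then have "frob n (mmul n M N) \<le> (\<Sum>p\<in>spins n. \<Sum>q\<in>spins n. (\<Sum>r\<in>spins n. (M p r)^2) * (\<Sum>r\<in>spins n. (N r q)^2))"
    unfolding frob_def by (intro sum_mono)
  also have "\<dots> = frob n M * (\<Sum>q\<in>spins n. \<Sum>r\<in>spins n. (N r q)^2)"
    unfolding frob_def sum_product ..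
  also have "(\<Sum>q\<in>spins n. \<Sum>r\<in>spins n. (N r q)^2) = frob n N"
    unfolding frob_def by (rule sum.swap)
  finally show ?thesis .
qed

lemma mtrace_mmul: "(mtrace n (mmul n M N))^2 \<le> frob n M * frob n N"
proof -
  have "mtrace n (mmul n M N) = (\<Sum>z\<in>spins n \<times> spins n. M (fst z) (snd z) * N (snd z) (fst z))"
    unfolding mtrace_def mmul_def sum.cartesian_product by (simp add: case_prod_unfold)
  then have "(mtrace n (mmul n M N))^2 \<le> (\<Sum>z\<in>spins n \<times> spins n. (M (fst z) (snd z))^2) * (\<Sum>z\<in>spins n \<times> spins n. (N (snd z) (fst z))^2)"
    by (simp only: Cauchy_Schwarz_ineq_sum)
  also have "(\<Sum>z\<in>spins n \<times> spins n. (M (fst z) (snd z))^2) = frob n M"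
    unfolding frob_def sum.cartesian_product by (simp add: case_prod_unfold)
  also have "(\<Sum>z\<in>spins n \<times> spins n. (N (snd z) (fst z))^2) = (\<Sum>q\<in>spins n. \<Sum>p\<in>spins n. (N p q)^2)"
    unfolding sum.cartesian_product by (simp add: case_prod_unfold)
  also have "\<dots> = frob n N" unfolding frob_def by (rule sum.swap)
  finally show ?thesis .
qed

text \<open>Splitting weights into square roots makes the squared entries of all spokes add up to
  \<open>theta n\<close>, while a product around a cycle collects the full weight of each cycle
  label. The sign sits on the first index only, so that each cycle label contributes it
  once.\<close>

definition spoke :: "nat \<Rightarrow> int \<Rightarrow> int \<Rightarrow> int \<Rightarrow> real" where
  "spoke n c p q = sqrt (weight n c) * sqrt (weight n p) * sqrt (weight n q) * (-1) ^ nat p * threej n p c (2 * int n - q)"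

primrec spoke_prod :: "nat \<Rightarrow> int list \<Rightarrow> int \<Rightarrow> int \<Rightarrow> real" where
  "spoke_prod n [] = mone"
| "spoke_prod n (c # cs) = mmul n (spoke n c) (spoke_prod n cs)"

definition wheel :: "nat \<Rightarrow> nat \<Rightarrow> real" where
  "wheel n s = (\<Sum>cs\<in>lists_of n s. (mtrace n (spoke_prod n cs))^2)"

lemma spoke_square: "(spoke n c p q)^2 = weight n c * weight n p * weight n q * (threej n p c (2 * int n - q))^2"
  using weight_pos[of n c] weight_pos[of n p] weight_pos[of n q]
  by (simp add: spoke_def power_mult_distrib less_imp_le power_mult[symmetric])

lemma sum_frob_spoke: "(\<Sum>c\<in>spins n. frob n (spoke n c)) = theta n"
proof -
  have "(\<Sum>c\<in>spins n. frob n (spoke n c)) = (\<Sum>c\<in>spins n. \<Sum>p\<in>spins n. \<Sum>q\<in>spins n. weight n c * weight n p * weight n (2 * int n - q) * (threej n p c (2 * int n - q))^2)"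
    unfolding frob_def spoke_square weight_complement ..
  also have "\<dots> = (\<Sum>c\<in>spins n. \<Sum>p\<in>spins n. \<Sum>q\<in>spins n. weight n c * weight n p * weight n q * (threej n p c q)^2)"
    by (intro sum.cong[OF refl] sum_spins_complement)
  also have "\<dots> = (\<Sum>p\<in>spins n. \<Sum>c\<in>spins n. \<Sum>q\<in>spins n. weight n p * weight n c * weight n q * (threej n p c q)^2)"
    by (subst sum.swap) (simp add: mult_ac)
  finally show ?thesis by (simp add: theta_def)
qed

lemma frob_spoke_prod: "cs \<noteq> [] \<Longrightarrow> set cs \<subseteq> spins n \<Longrightarrow> frob n (spoke_prod n cs) \<le> (\<Prod>c\<leftarrow>cs. frob n (spoke n c))"
proof (induction cs)
  case (Cons c cs)
  show ?case
  proof (cases "cs = []")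
    case True
    have "mmul n (spoke n c) mone p q = spoke n c p q" if "q \<in> spins n" for p q
      using that by (simp add: mmul_def mone_def if_distrib cong: if_cong)
    then have "frob n (mmul n (spoke n c) mone) = frob n (spoke n c)"
      unfolding frob_def by (intro sum.cong refl) simp
    then show ?thesis using True by simp
  next
    case False
    have "frob n (spoke_prod n (c # cs)) \<le> frob n (spoke n c) * frob n (spoke_prod n cs)"
      using frob_mmul by simp
    also have "\<dots> \<le> frob n (spoke n c) * (\<Prod>c\<leftarrow>cs. frob n (spoke n c))"
      using Cons False by (intro mult_left_mono frob_nonneg) auto
    finally show ?thesis by simp
  qed
qed simp

lemma sum_lists_of_prod: "(\<Sum>cs\<in>lists_of n s. (\<Prod>c\<leftarrow>cs. g c)) = (\<Sum>c\<in>spins n. g c :: real) ^ s"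
  by (induction s) (simp_all add: sum_lists_of_0 sum_lists_of_Suc sum_distrib_left[symmetric] sum_distrib_right)

text \<open>With at least two spokes the trace is that of a product of two matrices, the first spoke
  and the rest, and is bounded by their Hilbert-Schmidt norms. The bound is a product over the list
  of rung labels, so the sum over lists is a power.\<close>

lemma wheel_upper:
  assumes "s \<ge> 2"
  shows "wheel n s \<le> theta n ^ s"
proof -
  have "(mtrace n (spoke_prod n cs))^2 \<le> (\<Prod>c\<leftarrow>cs. frob n (spoke n c))" if cs: "cs \<in> lists_of n s" for cs
  proof -
    obtain c ds where cd: "cs = c # ds" using cs assms by (cases cs) (auto simp: lists_of_def)
    then have ds: "cs = c # ds" "ds \<noteq> []" "set ds \<subseteq> spins n"
      using cs assms by (auto simp: lists_of_def)
    have "(mtrace n (spoke_prod n cs))^2 \<le> frob n (spoke n c) * frob n (spoke_prod n ds)"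
      unfolding ds using mtrace_mmul by simp
    also have "\<dots> \<le> frob n (spoke n c) * (\<Prod>c\<leftarrow>ds. frob n (spoke n c))"
      using ds by (intro mult_left_mono frob_nonneg frob_spoke_prod) auto
    finally show ?thesis by (simp add: ds)
  qed
  then have "wheel n s \<le> (\<Sum>cs\<in>lists_of n s. (\<Prod>c\<leftarrow>cs. frob n (spoke n c)))"
    unfolding wheel_def by (intro sum_mono)
  then show ?thesis by (simp add: sum_lists_of_prod sum_frob_spoke)
qed

section \<open>Lower bounds: two rungs, then fusion of adjacent rungs\<close>

lemma mtrace_mmul_mone: "mtrace n (mmul n M (mmul n N mone)) = mtrace n (mmul n M N)"
proof -
  have "mmul n N mone r p = N r p" if "p \<in> spins n" for p r
    using that by (simp add: mmul_def mone_def if_distrib cong: if_cong)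
  then show ?thesis unfolding mtrace_def mmul_def[of n M] by (intro sum.cong refl) simp
qed

text \<open>Only the pairs of opposite rung labels are kept. For them the second spoke is, up to
  signs, the transpose of the first, so the trace is a squared Hilbert-Schmidt norm up to sign;
  Cauchy-Schwarz over the \<open>2*n+1\<close> labels then compares with
  \<open>theta n ^ 2\<close>.\<close>

lemma wheel_2: "wheel n 2 \<ge> theta n ^ 2 / (2 * real n + 1)"
proof -
  have sgn: "(-1::real)^k * ((-1)^k * x) = x" for k x
    by (simp add: mult.assoc[symmetric] power_add[symmetric])
  have tr: "(mtrace n (mmul n (spoke n c) (spoke n (2 * int n - c))))^2 = (frob n (spoke n c))^2" if c: "c \<in> spins n" for c
  proof -
    \<comment> \<open>The sign is the same for all \<open>p\<close> and \<open>r\<close>: wherever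
      the entry is nonzero, conservation of labels gives \<open>p + c = n + r\<close>. Hence nothing
      cancels in the trace.\<close>
    have "spoke n c p r * spoke n (2 * int n - c) r p = (-1)^(n + nat c) * (spoke n c p r)^2"
      if p: "p \<in> spins n" and r: "r \<in> spins n" for p r
    proof (cases "threej n p c (2 * int n - r) = 0")
      case True
      then show ?thesis by (simp add: spoke_def)
    next
      case False
      then have "p + c + (2 * int n - r) = 3 * int n" using threej_eq_0 by blast
      then have "nat p + nat c = n + nat r" using p r c by (auto simp: spins_def)
      then have "even (nat p + nat c) = even (n + nat r)" by simp
      then have "(-1::real)^(nat p + nat r) = (-1)^(n + nat c)"
        by (auto simp: minus_one_power_iff)
      have rev: "threej n r (2 * int n - c) (2 * int n - p) = threej n p c (2 * int n - r)"
        using threej_reverse[of n p c "2 * int n - r"] threej_complement[of n "2 * int n - r" c p]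
        by (simp add: power_add[symmetric] mult.assoc[symmetric])
      have "spoke n (2 * int n - c) r p = (-1)^nat r * (-1)^nat p * spoke n c p r"
        unfolding spoke_def rev weight_complement by (simp add: mult_ac sgn)
      then show ?thesis
        using \<open>(-1::real)^(nat p + nat r) = (-1)^(n + nat c)\<close>
        by (simp add: power2_eq_square power_add mult_ac)
    qed
    then have "mtrace n (mmul n (spoke n c) (spoke n (2 * int n - c))) = (-1)^(n + nat c) * frob n (spoke n c)"
      unfolding mtrace_def mmul_def frob_def sum_distrib_left by (intro sum.cong refl)
    then show ?thesis by (simp add: power_mult_distrib power_mult[symmetric])
  qed
  have "theta n ^ 2 = (\<Sum>c\<in>spins n. 1 * frob n (spoke n c))^2" by (simp add: sum_frob_spoke)
  also have "\<dots> \<le> (\<Sum>c\<in>spins n. 1^2) * (\<Sum>c\<in>spins n. (frob n (spoke n c))^2)"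
    by (rule Cauchy_Schwarz_ineq_sum)
  also have "\<dots> = (2 * real n + 1) * (\<Sum>c\<in>spins n. (frob n (spoke n c))^2)"
    by (simp add: card_spins)
  also have "\<dots> \<le> (2 * real n + 1) * (\<Sum>c\<in>spins n. \<Sum>c'\<in>spins n. (mtrace n (mmul n (spoke n c) (spoke n c')))^2)"
  proof (intro mult_left_mono sum_mono)
    fix c assume c: "c \<in> spins n"
    have "(\<Sum>c'\<in>{2 * int n - c}. (mtrace n (mmul n (spoke n c) (spoke n c')))^2) \<le> (\<Sum>c'\<in>spins n. (mtrace n (mmul n (spoke n c) (spoke n c')))^2)"
      using c by (intro sum_mono2) (auto simp: spins_def)
    then show "(frob n (spoke n c))^2 \<le> (\<Sum>c'\<in>spins n. (mtrace n (mmul n (spoke n c) (spoke n c')))^2)"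
      by (simp add: tr[OF c])
  qed simp
  also have "(\<Sum>c\<in>spins n. \<Sum>c'\<in>spins n. (mtrace n (mmul n (spoke n c) (spoke n c')))^2) = wheel n 2"
    by (simp add: wheel_def numeral_2_eq_2 sum_lists_of_Suc sum_lists_of_0 mtrace_mmul_mone)
  finally show ?thesis by (simp add: field_simps)
qed

text \<open>A trivalent vertex that joins the rungs \<open>u\<close> and \<open>v\<close> into a
  rung \<open>d\<close>. Its factors complete the square roots in two adjacent spokes to the
  pairings \<open>sweight\<close> on \<open>u\<close> and \<open>v\<close>.\<close>

definition fusion :: "nat \<Rightarrow> int \<Rightarrow> int \<Rightarrow> int \<Rightarrow> real" where
  "fusion n u v d = sqrt (weight n u) * sqrt (weight n v) * sqrt (weight n d) * (-1) ^ nat u * (-1) ^ nat v *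
     threej n (2 * int n - v) (2 * int n - u) d"

lemma sum_fusion_square: "(\<Sum>d\<in>spins n. \<Sum>u\<in>spins n. \<Sum>v\<in>spins n. (fusion n u v d)^2) = theta n"
proof -
  have sq: "(fusion n u v d)^2 = weight n (2 * int n - v) * weight n (2 * int n - u) * weight n d * (threej n (2 * int n - v) (2 * int n - u) d)^2" for u v d
    using weight_pos[of n u] weight_pos[of n v] weight_pos[of n d]
    by (simp add: fusion_def power_mult_distrib less_imp_le power_mult[symmetric] weight_complement)
  have "(\<Sum>d\<in>spins n. \<Sum>u\<in>spins n. \<Sum>v\<in>spins n. (fusion n u v d)^2) =
     (\<Sum>d\<in>spins n. \<Sum>u\<in>spins n. \<Sum>v\<in>spins n. weight n v * weight n u * weight n d * (threej n v u d)^2)"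
    unfolding sq
    by (subst sum_spins_complement[where f = "\<lambda>v. weight n v * weight n _ * weight n _ * (threej n v _ _)^2"],
        subst sum_spins_complement[where f = "\<lambda>u. \<Sum>v\<in>spins n. weight n v * weight n u * weight n _ * (threej n v u _)^2"]) (rule refl)
  also have "\<dots> = (\<Sum>d\<in>spins n. \<Sum>v\<in>spins n. \<Sum>u\<in>spins n. weight n v * weight n u * weight n d * (threej n v u d)^2)"
    by (rule sum.cong[OF refl], rule sum.swap)
  also have "\<dots> = (\<Sum>v\<in>spins n. \<Sum>d\<in>spins n. \<Sum>u\<in>spins n. weight n v * weight n u * weight n d * (threej n v u d)^2)"
    by (rule sum.swap)
  also have "\<dots> = theta n"
    unfolding theta_def by (rule sum.cong[OF refl], rule sum.swap)
  finally show ?thesis .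
qed

text \<open>Two adjacent spokes and the fusing vertex bound a triangle, which
  \<open>triangle_reduction\<close> contracts to a single vertex.\<close>

lemma fusion_spoke:
  "(\<Sum>u\<in>spins n. \<Sum>v\<in>spins n. fusion n u v d * mmul n (spoke n u) (spoke n v) p q)
    = (-1)^n * theta n * racah n * spoke n d p q"
proof -
  have sq: "sqrt (weight n c) * sqrt (weight n c) = weight n c" for c
    using weight_pos[of n c] by simp
  let ?k = "sqrt (weight n d) * sqrt (weight n p) * sqrt (weight n q) * (-1) ^ nat p"
  have "(\<Sum>u\<in>spins n. \<Sum>v\<in>spins n. fusion n u v d * mmul n (spoke n u) (spoke n v) p q)
     = (\<Sum>u\<in>spins n. \<Sum>v\<in>spins n. \<Sum>r\<in>spins n. ?k * (sweight n v * sweight n u * sweight n r *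
     (threej n (2 * int n - v) (2 * int n - u) d * threej n r v (2 * int n - q) * threej n p u (2 * int n - r))))"
    unfolding mmul_def sum_distrib_left
  proof (intro sum.cong refl, goal_cases)
    case (1 u v r)
    have "fusion n u v d * (spoke n u p r * spoke n v r q) = ?k * (((-1) ^ nat v * (sqrt (weight n v) * sqrt (weight n v))) *
        ((-1) ^ nat u * (sqrt (weight n u) * sqrt (weight n u))) * ((-1) ^ nat r * (sqrt (weight n r) * sqrt (weight n r))) *
     (threej n (2 * int n - v) (2 * int n - u) d * threej n r v (2 * int n - q) * threej n p u (2 * int n - r)))"
      unfolding fusion_def spoke_def by (simp only: mult_ac)
    then show ?case unfolding sq sweight_def .
  qed
  also have "\<dots> = ?k * triangle n p d (2 * int n - q)"
    unfolding triangle_def sum_distrib_left by (rule sum.swap)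
  also have "\<dots> = (-1)^n * theta n * racah n * spoke n d p q"
    unfolding triangle_reduction spoke_def by (simp only: mult_ac)
  finally show ?thesis .
qed

lemma mmul_assoc: "mmul n M (mmul n N R) p q = mmul n (mmul n M N) R p q"
  unfolding mmul_def sum_distrib_left sum_distrib_right by (subst sum.swap) (simp add: mult_ac)

lemma fusion_trace:
  "(\<Sum>u\<in>spins n. \<Sum>v\<in>spins n. fusion n u v d * mtrace n (mmul n (spoke n u) (mmul n (spoke n v) R)))
    = (-1)^n * theta n * racah n * mtrace n (mmul n (spoke n d) R)"
proof -
  let ?F = "\<lambda>u v z. fusion n u v d * mmul n (spoke n u) (spoke n v) (fst z) (snd z) * R (snd z) (fst z)"
  have "(\<Sum>u\<in>spins n. \<Sum>v\<in>spins n. fusion n u v d * mtrace n (mmul n (spoke n u) (mmul n (spoke n v) R)))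
     = (\<Sum>u\<in>spins n. \<Sum>v\<in>spins n. \<Sum>z\<in>spins n \<times> spins n. ?F u v z)"
    unfolding mtrace_def mmul_assoc unfolding mmul_def[of n "mmul n _ _"] sum.cartesian_product sum_distrib_left
    by (simp add: case_prod_unfold mult.assoc)
  also have "\<dots> = (\<Sum>u\<in>spins n. \<Sum>z\<in>spins n \<times> spins n. \<Sum>v\<in>spins n. ?F u v z)"
    by (rule sum.cong[OF refl], rule sum.swap)
  also have "\<dots> = (\<Sum>z\<in>spins n \<times> spins n. \<Sum>u\<in>spins n. \<Sum>v\<in>spins n. ?F u v z)"
    by (rule sum.swap)
  also have "\<dots> = (\<Sum>z\<in>spins n \<times> spins n. ((-1)^n * theta n * racah n * spoke n d (fst z) (snd z)) * R (snd z) (fst z))"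
    unfolding sum_distrib_right[symmetric] fusion_spoke ..
  also have "\<dots> = (-1)^n * theta n * racah n * mtrace n (mmul n (spoke n d) R)"
    unfolding mtrace_def mmul_def sum.cartesian_product sum_distrib_left
    by (simp add: case_prod_unfold mult.assoc)
  finally show ?thesis .
qed

text \<open>Fusion writes a multiple of each trace with \<open>s\<close> spokes as a linear
  combination of traces with \<open>s+1\<close> spokes. Cauchy-Schwarz bounds its square, and the
  squared coefficients add up to \<open>theta n\<close> over all fused labels \<open>d\<close>; this
  cancels one of the two factors \<open>theta n\<close> of the multiple.\<close>

lemma wheel_Suc_lower:
  assumes "s \<ge> 1"
  shows "theta n * (racah n)^2 * wheel n s \<le> wheel n (Suc s)"
proof -
  let ?K = "\<lambda>d R. (-1)^n * theta n * racah n * mtrace n (mmul n (spoke n d) R)"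
  let ?Q = "\<lambda>u v R. (mtrace n (mmul n (spoke n u) (mmul n (spoke n v) R)))^2"
  obtain m where m: "s = Suc m" using assms by (cases s) auto
  have th: "theta n > 0" by (simp add: theta_closed)
  have *: "(\<Sum>d\<in>spins n. (?K d R)^2)
      \<le> theta n * (\<Sum>u\<in>spins n. \<Sum>v\<in>spins n. ?Q u v R)" for R
  proof -
    have "(?K d R)^2
       \<le> (\<Sum>u\<in>spins n. \<Sum>v\<in>spins n. (fusion n u v d)^2) * (\<Sum>u\<in>spins n. \<Sum>v\<in>spins n. ?Q u v R)" for d
      using Cauchy_Schwarz_ineq_sum[of "\<lambda>z. fusion n (fst z) (snd z) d" "\<lambda>z. mtrace n (mmul n (spoke n (fst z)) (mmul n (spoke n (snd z)) R))" "spins n \<times> spins n"]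
      unfolding fusion_trace[symmetric] sum.cartesian_product by (simp add: case_prod_unfold)
    then have "(\<Sum>d\<in>spins n. (?K d R)^2)
      \<le> (\<Sum>d\<in>spins n. (\<Sum>u\<in>spins n. \<Sum>v\<in>spins n. (fusion n u v d)^2) * (\<Sum>u\<in>spins n. \<Sum>v\<in>spins n. ?Q u v R))"
      by (intro sum_mono)
    then show ?thesis unfolding sum_distrib_right[symmetric] sum_fusion_square .
  qed
  have "theta n * (theta n * (racah n)^2 * wheel n s) = (\<Sum>d\<in>spins n. \<Sum>cs\<in>lists_of n m. (?K d (spoke_prod n cs))^2)"
    unfolding wheel_def m sum_lists_of_Suc sum_distrib_left
    by (simp add: power_mult_distrib power_mult[symmetric] power2_eq_square mult_ac)
  also have "\<dots> = (\<Sum>cs\<in>lists_of n m. \<Sum>d\<in>spins n. (?K d (spoke_prod n cs))^2)"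
    by (rule sum.swap)
  also have "\<dots> \<le> (\<Sum>cs\<in>lists_of n m. theta n * (\<Sum>u\<in>spins n. \<Sum>v\<in>spins n. ?Q u v (spoke_prod n cs)))"
    by (intro sum_mono *)
  also have "\<dots> = theta n * (\<Sum>u\<in>spins n. \<Sum>cs\<in>lists_of n m. \<Sum>v\<in>spins n. ?Q u v (spoke_prod n cs))"
    unfolding sum_distrib_left[symmetric] by (subst sum.swap) (rule refl)
  also have "\<dots> = theta n * (\<Sum>u\<in>spins n. \<Sum>v\<in>spins n. \<Sum>cs\<in>lists_of n m. ?Q u v (spoke_prod n cs))"
    by (rule arg_cong[where f = "\<lambda>x. theta n * x"], rule sum.cong[OF refl], rule sum.swap)
  also have "\<dots> = theta n * wheel n (Suc s)"
    unfolding wheel_def m sum_lists_of_Suc by simp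
  finally show ?thesis using th by simp
qed

lemma wheel_lower: "wheel n (s + 2) \<ge> (racah n)^(2 * s) * theta n ^ (s+2) / (2 * real n + 1)"
proof (induction s)
  case 0
  then show ?case using wheel_2[of n] by (simp add: eval_nat_numeral)
next
  case (Suc s)
  have "theta n \<ge> 0" by (simp add: theta_closed)
  then have "theta n * (racah n)^2 * ((racah n)^(2 * s) * theta n ^ (s+2) / (2 * real n + 1)) \<le> theta n * (racah n)^2 * wheel n (s + 2)"
    using Suc by (intro mult_left_mono) auto
  also have "\<dots> \<le> wheel n (Suc s + 2)" using wheel_Suc_lower[of "s+2" n] by simp
  finally show ?case by (simp add: power_add power2_eq_square mult_ac)
qed

section \<open>Growth of the wheel sums\<close>

definition theta_normalized :: "nat \<Rightarrow> real" where
  "theta_normalized n = fact (3*n+1) / (fact n)^3"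

lemma theta_normalized_pos: "theta_normalized n > 0"
  by (simp add: theta_normalized_def)

lemma theta_normalized: "theta n / (fact n)^6 = theta_normalized n"
  by (simp add: theta_closed theta_normalized_def divide_simps eval_nat_numeral)

lemma theta_normalized_ratio: "(\<lambda>n. theta_normalized n / theta_normalized (Suc n)) \<longlonglongrightarrow> 1/27"
proof -
  have "theta_normalized n / theta_normalized (Suc n) = (real n + 1)^3 / ((3*real n+2)*(3*real n+3)*(3*real n+4))" for n
  proof -
    have "3 * Suc n + 1 = Suc (Suc (Suc (3*n+1)))" by simp
    then have "(fact (3 * Suc n + 1) :: real) = (3*real n+4)*((3*real n+3)*((3*real n+2)*fact (3*n+1)))"
      by (simp only: fact_Suc) (simp add: algebra_simps)
    moreover have "3*real n+2 \<noteq> 0" "3*real n+3 \<noteq> 0" "3*real n+4 \<noteq> 0" by linarith+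
    ultimately show ?thesis unfolding theta_normalized_def
      by (simp add: divide_simps power_mult_distrib add.commute)
  qed
  moreover have "(\<lambda>n. (real n + 1)^3 / ((3*real n+2)*(3*real n+3)*(3*real n+4))) \<longlonglongrightarrow> 1/27"
    by real_asymp
  ultimately show ?thesis by simp
qed

text \<open>Provides the loss rate that may be conceded to each factor \<open>(racah n)^2\<close>
  without using up the exponential gain \<open>K\<close>.\<close>

lemma exists_power_mult_gt_1:
  assumes "K > (1::real)"
  obtains \<rho> where "0 < \<rho>" "\<rho> < 1" "\<rho> ^ t * K > 1"
proof
  \<comment> \<open>By Bernoulli's inequality \<open>(1-x)^t \<ge> 1 - t*x\<close>, and this exceeds
    \<open>1/K\<close> for the chosen \<open>x\<close>. Dividing by \<open>t+1\<close> instead of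
    \<open>t\<close> covers \<open>t = 0\<close> and makes the inequality strict.\<close>
  define x where "x = (1 - 1/K) / (real t + 1)"
  have K: "1 - 1/K > 0" "1 - 1/K < 1" using assms by auto
  have x: "x > 0" "x \<le> 1 - 1/K" using K unfolding x_def
    by (auto simp: divide_simps algebra_simps)
  then show "0 < 1 - x" "1 - x < 1" using K by linarith+
  have "x * (real t + 1) = 1 - 1/K" unfolding x_def by simp
  then have "real t * x < 1 - 1/K" using x by (simp add: algebra_simps)
  then have "1 / K < 1 + real t * (-x)" by linarith
  also have "\<dots> \<le> (1 + (-x)) ^ t" using x K by (intro Bernoulli_inequality) linarith
  finally show "(1 - x) ^ t * K > 1" using assms by (simp add: field_simps)
qed

text \<open>The comparison sequence \<open>theta_normalized n ^ s\<close> has the required radius by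
  the ratio test and dominates \<open>a\<close>. For the other inequality a larger radius is refuted
  at a single, suitably large index.\<close>

lemma conv_radius_wheel:
  fixes a :: "nat \<Rightarrow> real"
  assumes s: "s \<ge> 2" and a: "\<And>n. \<bar>a n\<bar> = wheel n s / (fact n)^(6 * s)"
  shows "conv_radius a = ereal (1 / 27^s)"
proof (rule antisym)
  define b where "b n = theta_normalized n ^ s" for n
  have b_pos: "b n > 0" for n by (simp add: b_def theta_normalized_pos)
  have b_eq: "b n = theta n ^ s / (fact n)^(6 * s)" for n
    by (simp add: b_def theta_normalized[symmetric] power_divide power_mult)
  have ratio: "(\<lambda>n. b n / b (Suc n)) \<longlonglongrightarrow> (1/27)^s"
    unfolding b_def power_divide[symmetric] by (intro tendsto_power theta_normalized_ratio)
  have rad_b: "conv_radius b = ereal (1/27^s)"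
  proof (rule conv_radius_ratio_limit[OF refl])
    show "(\<lambda>n. norm (b n) / norm (b (Suc n))) \<longlonglongrightarrow> 1/27^s"
      using ratio b_pos by (simp add: power_one_over less_imp_le)
    show "eventually (\<lambda>n. b n \<noteq> 0) sequentially" using b_pos by (simp add: less_imp_neq[symmetric])
  qed
  have a_le: "\<bar>a n\<bar> \<le> b n" for n
    unfolding a b_eq using wheel_upper[OF s, of n] by (intro divide_right_mono) auto
  show "ereal (1/27^s) \<le> conv_radius a"
  proof (rule conv_radius_geI_ex')
    fix r :: real assume r: "0 < r" "ereal r < ereal (1/27^s)"
    have "summable (\<lambda>n. norm (b n * r ^ n))"
      using r by (intro abs_summable_in_conv_radius) (simp add: rad_b)
    then show "summable (\<lambda>n. a n * of_real r ^ n)"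
    proof (rule summable_comparison_test')
      fix n
      have "\<bar>a n\<bar> * r^n \<le> b n * r^n" using a_le r by (intro mult_right_mono) auto
      then show "norm (a n * of_real r ^ n) \<le> norm (b n * r ^ n)"
        using r b_pos[of n] by (simp add: abs_mult)
    qed
  qed
  show "conv_radius a \<le> ereal (1/27^s)"
  proof (rule ccontr)
    assume "\<not> ?thesis"
    then have "ereal (1/27^s) < conv_radius a" by simp
    then obtain r where r: "ereal (1/27^s) < ereal r" "ereal r < conv_radius a"
      using ereal_dense2 by blast
    have r0: "r > 0" using r(1) by (simp add: less_trans[OF _ r(1)[simplified]])
    have "summable (\<lambda>n. a n * r ^ n)" using r r0 by (intro summable_in_conv_radius) simp
    then have "(\<lambda>n. a n * r ^ n) \<longlonglongrightarrow> 0" by (rule summable_LIMSEQ_zero)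
    then have small: "\<forall>\<^sub>F n in sequentially. \<bar>a n\<bar> * r ^ n < 1"
      using r0 by (auto simp: tendsto_iff abs_mult dest!: spec[of _ 1])
    have K: "r * 27^s > 1" using r(1) by (simp add: field_simps)
    \<comment> \<open>The surplus \<open>r * 27^s > 1\<close> must survive \<open>s-2\<close>
      factors of size \<open>\<rho>^n\<close>, one for each rung beyond the second.\<close>
    obtain \<rho> where \<rho>: "0 < \<rho>" "\<rho> < 1" "\<rho> ^ (s-2) * (r * 27^s) > 1"
      using exists_power_mult_gt_1[OF K] .
    define q where "q = \<rho> ^ (s-2) * r"
    have q: "q > 0" "q * 27^s > 1" using \<rho> r0 by (simp_all add: q_def mult_ac)
    obtain c where c: "c > 0" "\<exists>\<^sub>F n in sequentially. c * \<rho> ^ n \<le> (racah n)^2"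
      using racah_frequently_large[OF \<rho>(1,2)] by auto
    \<comment> \<open>Since \<open>1/q < 27^s\<close>, the sequence \<open>f n * (1/q)^n\<close>
      tends to 0; so the exponential surplus outweighs the factor \<open>2*n+1\<close> and the
      constant \<open>c^(s-2)\<close>.\<close>
    define f where "f n = (2 * real n + 1) / b n" for n
    have "conv_radius f = ereal (27^s)"
    proof (rule conv_radius_ratio_limit[OF refl])
      have "(\<lambda>n. ((2 * real n + 1) / (2 * real (Suc n) + 1)) * inverse (b n / b (Suc n))) \<longlonglongrightarrow> 1 * inverse ((1/27)^s)"
        by (intro tendsto_mult tendsto_inverse ratio) (real_asymp, simp)
      then show "(\<lambda>n. norm (f n) / norm (f (Suc n))) \<longlonglongrightarrow> 27^s"
        unfolding f_def using b_pos by (simp add: power_one_over less_imp_le field_simps)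
      show "eventually (\<lambda>n. f n \<noteq> 0) sequentially"
        using b_pos by (intro always_eventually) (auto simp: f_def add_eq_0_iff less_imp_neq[symmetric])
    qed
    then have "summable (\<lambda>n. f n * (1/q) ^ n)"
      using q by (intro summable_in_conv_radius) (simp add: field_simps)
    then have "(\<lambda>n. f n * (1/q) ^ n) \<longlonglongrightarrow> 0" by (rule summable_LIMSEQ_zero)
    then have "\<forall>\<^sub>F n in sequentially. dist (f n * (1/q) ^ n) 0 < c ^ (s-2)"
      using c(1) by (intro tendstoD) auto
    then have big: "\<forall>\<^sub>F n in sequentially. 1 < c ^ (s-2) * (b n * q ^ n / (2 * real n + 1))"
    proof eventually_elim
      case (elim n)
      have "f n * (1/q)^n > 0" using b_pos[of n] q by (simp add: f_def)
      then have "f n * (1/q)^n < c ^ (s-2)" using elim by simp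
      then show ?case using b_pos[of n] q by (simp add: f_def field_simps)
    qed
    \<comment> \<open>Two of the conditions hold eventually and one only frequently, so they hold
      together for some \<open>n\<close>, which is enough for the contradiction.\<close>
    have "\<exists>\<^sub>F n in sequentially. (c * \<rho> ^ n \<le> (racah n)^2 \<and> \<bar>a n\<bar> * r ^ n < 1 \<and> 1 < c ^ (s-2) * (b n * q ^ n / (2 * real n + 1)))"
      by (rule frequently_rev_mp[OF c(2)], use small big in eventually_elim) simp
    then obtain n where n: "c * \<rho> ^ n \<le> (racah n)^2" "\<bar>a n\<bar> * r ^ n < 1" "1 < c ^ (s-2) * (b n * q ^ n / (2 * real n + 1))"
      by (auto dest: frequently_ex)
    have s2: "s - 2 + 2 = s" using s by simp
    have "c ^ (s-2) * (b n * q ^ n / (2 * real n + 1)) = (c * \<rho> ^ n) ^ (s-2) * (b n * r ^ n / (2 * real n + 1))"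
      unfolding q_def by (simp add: power_mult_distrib power_mult[symmetric] mult_ac)
    also have "\<dots> \<le> ((racah n)^2) ^ (s-2) * (b n * r ^ n / (2 * real n + 1))"
      using n(1) c(1) \<rho> b_pos[of n] r0 by (intro mult_right_mono power_mono) auto
    also have "\<dots> = (racah n)^(2 * (s-2)) * theta n ^ (s-2+2) / (2 * real n + 1) / (fact n)^(6 * s) * r ^ n"
      unfolding s2 b_eq by (simp add: power_mult mult_ac)
    also have "\<dots> \<le> wheel n (s-2+2) / (fact n)^(6 * s) * r ^ n"
      using wheel_lower[of n "s-2"] r0 by (intro mult_right_mono divide_right_mono) auto
    also have "\<dots> = \<bar>a n\<bar> * r ^ n" unfolding s2 a ..
    finally show False using n(2,3) by linarith
  qed
qed

section \<open>Loops of two matchings\<close>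

text \<open>Induction on \<open>U\<close>. Composing with the transposition of \<open>a\<close> and
  \<open>p a\<close> cuts \<open>a\<close> out of its orbit: if \<open>a\<close> was not fixed, the
  sign flips while the number of orbits stays the same; if it was, one orbit disappears together
  with one element.\<close>

lemma sign_eq_card_orbits:
  assumes "finite U" "p permutes U"
  shows "sign p = (-1) ^ (card U + card (orbit p ` U))"
  using assms
proof (induction U arbitrary: p rule: finite_induct)
  case empty
  then show ?case by (simp add: permutes_empty)
next
  case (insert a F)
  define b where "b = p a"
  define q where "q = Transposition.transpose a b \<circ> p"
  have q: "q permutes F"
    unfolding q_def b_def using insert.prems by (rule permutes_insert_lemma)
  have p_q: "p = Transposition.transpose a b \<circ> q"
    by (simp add: q_def o_assoc[symmetric] fun_eq_iff transpose_involutory)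
  have qa: "q a = a" using q insert.hyps by (auto simp: permutes_def)
  have q_in: "q x \<in> F" if "x \<in> F" for x using that q by (simp add: permutes_in_image)
  have orbit_sub: "orbit q x \<subseteq> F" if "x \<in> F" for x
    using q that by (rule permutes_orbit_subset)
  show ?case
  proof (cases "b = a")
    case True
    then have pq: "p = q" using p_q by simp
    have "orbit p a = {a}" using True b_def by (simp add: orbit_eq_singleton_iff)
    moreover have "{a} \<notin> orbit p ` F" using orbit_sub insert.hyps(2) unfolding pq by blast
    ultimately have "card (orbit p ` insert a F) = Suc (card (orbit p ` F))"
      using insert.hyps(1) by simp
    then show ?thesis using insert.IH[OF q] insert.hyps unfolding pq by simp
  next
    case False
    have "b \<in> insert a F" unfolding b_def using permutes_in_image[OF insert.prems, of a] by simp
    then have bF: "b \<in> F" using False by simp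
    have px: "p x = (if q x = b then a else q x)" if "x \<in> F" for x
    proof -
      have "q x \<noteq> a" using q_in[OF that] insert.hyps(2) by auto
      then show ?thesis unfolding p_q by (simp add: Transposition.transpose_def)
    qed
    have pa: "p a = b" by (simp add: b_def)
    \<comment> \<open>Puts \<open>a\<close> back into the orbit from which it was cut, the one
      through \<open>b\<close>.\<close>
    define ext where "ext X = (if b \<in> X then insert a X else X)" for X
    have orb: "orbit p x = ext (orbit q x)" if x: "x \<in> F" for x
    proof
      show "orbit p x \<subseteq> ext (orbit q x)"
      proof
        fix y assume "y \<in> orbit p x"
        then show "y \<in> ext (orbit q x)"
        proof induction
          case base
          have "q x \<in> orbit q x" by (rule orbit.base)
          then show ?case using px[OF x] unfolding ext_def by (auto split: if_splits)
        next
          case (step y)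
          then consider "y = a" "b \<in> orbit q x" | "y \<in> orbit q x" unfolding ext_def by (auto split: if_splits)
          then show ?case
          proof cases
            case 1
            then show ?thesis using pa unfolding ext_def by simp
          next
            case 2
            then have "q y \<in> orbit q x" by (rule orbit.step)
            moreover have "y \<in> F" using orbit_sub[OF x] 2 by blast
            ultimately show ?thesis using px unfolding ext_def by auto
          qed
        qed
      qed
      have sub: "y \<in> orbit p x" if "y \<in> orbit q x" for y
        using that
      proof induction
        case base
        have "p x \<in> orbit p x" by (rule orbit.base)
        moreover then have "p (p x) \<in> orbit p x" by (rule orbit.step)
        ultimately show ?case using px[OF x] pa by (auto split: if_splits)
      next
        case (step y)
        have "p y \<in> orbit p x" using step.IH by (rule orbit.step)
        moreover then have "p (p y) \<in> orbit p x" by (rule orbit.step)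
        moreover have "y \<in> F" using orbit_sub[OF x] step.hyps by blast
        ultimately show ?case using px pa by (auto split: if_splits)
      qed
      moreover have "a \<in> orbit p x" if "b \<in> orbit q x"
        using that
      proof cases
        case base
        have "p x \<in> orbit p x" by (rule orbit.base)
        then show ?thesis using px[OF x] base by simp
      next
        case (step y)
        have "p y \<in> orbit p x" using sub[OF step(2)] by (rule orbit.step)
        moreover have "y \<in> F" using orbit_sub[OF x] step(2) by blast
        ultimately show ?thesis using px step(1) by simp
      qed
      ultimately show "ext (orbit q x) \<subseteq> orbit p x" unfolding ext_def by auto
    qed
    have perm: "permutation p" using insert.prems insert.hyps(1) by (auto simp: permutation_permutes)
    have "orbit p a = orbit p b" using permutation_orbit_step[OF perm, of a] pa by simp
    then have "orbit p ` insert a F = orbit p ` F" using bF by auto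
    also have "\<dots> = ext ` (orbit q ` F)" using orb by (auto simp: image_image)
    finally have im: "orbit p ` insert a F = ext ` (orbit q ` F)" .
    have "inj_on ext (orbit q ` F)"
    proof (rule inj_onI)
      fix X Y assume XY: "X \<in> orbit q ` F" "Y \<in> orbit q ` F" "ext X = ext Y"
      then have "a \<notin> X" "a \<notin> Y" using orbit_sub insert.hyps(2) by blast+
      then show "X = Y" using XY(3) unfolding ext_def by (auto split: if_splits)
    qed
    then have "card (orbit p ` insert a F) = card (orbit q ` F)" unfolding im by (rule card_image)
    moreover have "sign p = - sign q"
    proof -
      have "permutation q" using q insert.hyps(1) by (auto simp: permutation_permutes)
      then show ?thesis unfolding p_q using False by (simp add: sign_compose permutation_swap_id sign_swap_id)
    qed
    ultimately show ?thesis using insert.IH[OF q] insert.hyps by simp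
  qed
qed

lemma card_image_eqI:
  assumes "finite U" "\<And>x y. x \<in> U \<Longrightarrow> y \<in> U \<Longrightarrow> f x = f y \<longleftrightarrow> g x = g y"
  shows "card (f ` U) = card (g ` U)"
proof -
  have le: "card (f ` U) \<le> card (g ` U)" if "\<And>x y. x \<in> U \<Longrightarrow> y \<in> U \<Longrightarrow> g x = g y \<Longrightarrow> f x = f y"
    for f :: "'a \<Rightarrow> 'x" and g :: "'a \<Rightarrow> 'y"
  proof -
    define k where "k z = f (SOME x. x \<in> U \<and> g x = z)" for z
    have "k (g x) = f x" if "x \<in> U" for x
    proof -
      have "(SOME y. y \<in> U \<and> g y = g x) \<in> U \<and> g (SOME y. y \<in> U \<and> g y = g x) = g x"
        by (rule someI[of _ x]) (use that in auto)
      then show ?thesis unfolding k_def using that \<open>\<And>x y. x \<in> U \<Longrightarrow> y \<in> U \<Longrightarrow> g x = g y \<Longrightarrow> f x = f y\<close> by blast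
    qed
    then have "f ` U = k ` (g ` U)" by (auto simp: image_image)
    then show ?thesis using assms(1) by (simp add: card_image_le)
  qed
  show ?thesis using le[of g f] le[of f g] assms(2) by (intro antisym) blast+
qed

section \<open>Matchings, their loops and alternating labellings\<close>

definition matching :: "'a set \<Rightarrow> ('a \<Rightarrow> 'a) \<Rightarrow> bool" where
  "matching S v \<longleftrightarrow> (\<forall>x\<in>S. v x \<in> S \<and> v x \<noteq> x \<and> v (v x) = x)"

lemma matchingD:
  assumes "matching S v" "x \<in> S"
  shows "v x \<in> S" "v x \<noteq> x" "v (v x) = x"
  using assms by (auto simp: matching_def)

text \<open>The set of points labelled 1 in a 0/1-labelling for which every arc of the matching has
  different labels at its ends.\<close>

definition transversal :: "'a set \<Rightarrow> ('a \<Rightarrow> 'a) \<Rightarrow> 'a set \<Rightarrow> bool" where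
  "transversal S v A \<longleftrightarrow> A \<subseteq> S \<and> (\<forall>x\<in>S. v x \<in> A \<longleftrightarrow> x \<notin> A)"

text \<open>The same closure as in \<open>num_curves\<close>, so that the curve count is
  \<open>card (loops S v e)\<close> by unfolding.\<close>

definition loop_rel :: "'a set \<Rightarrow> ('a \<Rightarrow> 'a) \<Rightarrow> ('a \<Rightarrow> 'a) \<Rightarrow> ('a \<times> 'a) set" where
  "loop_rel S v e = ({(x, v x) | x. x \<in> S} \<union> {(x, e x) | x. x \<in> S})\<^sup>*"

definition loops :: "'a set \<Rightarrow> ('a \<Rightarrow> 'a) \<Rightarrow> ('a \<Rightarrow> 'a) \<Rightarrow> 'a set set" where
  "loops S v e = (\<lambda>x. loop_rel S v e `` {x}) ` S"

lemma loop_rel_refl: "(x, x) \<in> loop_rel S v e"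
  by (simp add: loop_rel_def)

lemma loop_rel_sym:
  assumes "matching S v" "matching S e"
  shows "sym (loop_rel S v e)"
  unfolding loop_rel_def
  by (rule sym_rtrancl) (use assms in \<open>auto simp: sym_def matching_def\<close>)

lemma loop_rel_image_eq:
  assumes "matching S v" "matching S e"
  shows "loop_rel S v e `` {x} = loop_rel S v e `` {y} \<longleftrightarrow> (x, y) \<in> loop_rel S v e"
proof
  assume "loop_rel S v e `` {x} = loop_rel S v e `` {y}"
  then show "(x, y) \<in> loop_rel S v e" using loop_rel_refl[of y S v e] by blast
next
  assume xy: "(x, y) \<in> loop_rel S v e"
  then have yx: "(y, x) \<in> loop_rel S v e" using loop_rel_sym[OF assms] by (auto dest: symD)
  have tr: "trans (loop_rel S v e)" unfolding loop_rel_def by (rule trans_rtrancl)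
  show "loop_rel S v e `` {x} = loop_rel S v e `` {y}"
    using xy yx tr by (auto dest: transD)
qed

lemma loop_rel_step: "x \<in> S \<Longrightarrow> (x, v x) \<in> loop_rel S v e" "x \<in> S \<Longrightarrow> (x, e x) \<in> loop_rel S v e"
  unfolding loop_rel_def by auto

lemma loop_rel_invariant:
  assumes "(x, y) \<in> loop_rel S v e" "\<And>z. z \<in> S \<Longrightarrow> f (v z) = f z" "\<And>z. z \<in> S \<Longrightarrow> f (e z) = f z"
  shows "f y = f x"
  using assms(1) unfolding loop_rel_def by (induction rule: rtrancl_induct) (auto simp: assms(2,3))

definition alternating :: "'a set \<Rightarrow> ('a \<Rightarrow> 'a) \<Rightarrow> ('a \<Rightarrow> 'a) \<Rightarrow> 'a set set" where
  "alternating S v e = {U. transversal S v U \<and> transversal S e U}"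

lemma step_permutes:
  assumes "matching S v" "matching S e" "finite S"
  shows "(\<lambda>x. if x \<in> S then e (v x) else x) permutes S"
proof (rule bij_imp_permutes)
  show "bij_betw (\<lambda>x. if x \<in> S then e (v x) else x) S S"
    by (rule bij_betw_byWitness[where f' = "\<lambda>x. v (e x)"]) (auto simp: matchingD[OF assms(1)] matchingD[OF assms(2)])
qed auto

text \<open>Going around a loop two steps at a time, \<open>v\<close> and then \<open>e\<close>,
  stays inside an alternating set and visits all of its points on the loop. The number of loops thus
  becomes a number of orbits, which the sign of a permutation detects modulo 2.\<close>

lemma card_loops_eq_orbits:
  assumes v: "matching S v" and e: "matching S e" and S: "finite S" and U: "U \<in> alternating S v e"
  defines "w \<equiv> \<lambda>x. if x \<in> U then e (v x) else x"
  shows "w permutes U" "card (orbit w ` U) = card (loops S v e)"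
proof -
  have US: "U \<subseteq> S" using U by (simp add: alternating_def transversal_def)
  have vU: "v x \<in> U \<longleftrightarrow> x \<notin> U" if "x \<in> S" for x using U that by (simp add: alternating_def transversal_def)
  have eU: "e x \<in> U \<longleftrightarrow> x \<notin> U" if "x \<in> S" for x using U that by (simp add: alternating_def transversal_def)
  note vD = matchingD[OF v] and eD = matchingD[OF e]
  show w: "w permutes U"
  proof (rule bij_imp_permutes)
    show "bij_betw w U U"
      by (rule bij_betw_byWitness[where f' = "\<lambda>x. v (e x)"]) (use US in \<open>auto simp: w_def vD eD vU eU subset_iff\<close>)
  qed (auto simp: w_def)
  have finU: "finite U" using US S finite_subset by blast
  have perm: "permutation w" using w finU by (auto simp: permutation_permutes)
  define g where "g z = orbit w (if z \<in> U then z else v z)" for z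
  have gv: "g (v z) = g z" if "z \<in> S" for z using that by (simp add: g_def vU vD)
  have ge: "g (e z) = g z" if z: "z \<in> S" for z
  proof (cases "z \<in> U")
    case True
    then have "w (v (e z)) = z" using z by (simp add: w_def vU eU vD eD)
    then have "orbit w z = orbit w (v (e z))" using permutation_orbit_step[OF perm, of "v (e z)"] by simp
    then show ?thesis using True z by (simp add: g_def eU)
  next
    case False
    then have "w (v z) = e z" using z by (simp add: w_def vU vD)
    then have "orbit w (e z) = orbit w (v z)" using permutation_orbit_step[OF perm, of "v z"] by simp
    then show ?thesis using False z by (simp add: g_def eU)
  qed
  have rel: "orbit w x = orbit w y \<longleftrightarrow> (x, y) \<in> loop_rel S v e" if xy: "x \<in> U" "y \<in> U" for x y
  proof
    assume "(x, y) \<in> loop_rel S v e"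
    then have "g y = g x" by (rule loop_rel_invariant) (simp_all add: gv ge)
    then show "orbit w x = orbit w y" using xy by (simp add: g_def)
  next
    assume eq: "orbit w x = orbit w y"
    have st: "(z, w z) \<in> loop_rel S v e" if "z \<in> U" for z
    proof -
      have "(z, v z) \<in> loop_rel S v e" "(v z, e (v z)) \<in> loop_rel S v e"
        using that US by (auto intro!: loop_rel_step simp: vD)
      then show ?thesis using that unfolding w_def loop_rel_def by simp
    qed
    have "y \<in> orbit w x" unfolding eq using permutation_self_in_orbit[OF perm] .
    then show "(x, y) \<in> loop_rel S v e"
    proof induction
      case base
      then show ?case using st xy by simp
    next
      case (step z)
      have "z \<in> U" using permutes_orbit_subset[OF w xy(1)] step.hyps by blast
      then show ?case using step.IH st unfolding loop_rel_def by (meson rtrancl_trans)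
    qed
  qed
  have "loops S v e = (\<lambda>x. loop_rel S v e `` {x}) ` U"
  proof
    show "loops S v e \<subseteq> (\<lambda>x. loop_rel S v e `` {x}) ` U"
    proof
      fix L assume "L \<in> loops S v e"
      then obtain x where x: "x \<in> S" "L = loop_rel S v e `` {x}" by (auto simp: loops_def)
      show "L \<in> (\<lambda>x. loop_rel S v e `` {x}) ` U"
      proof (cases "x \<in> U")
        case False
        have "loop_rel S v e `` {x} = loop_rel S v e `` {v x}"
          unfolding loop_rel_image_eq[OF v e] using x by (intro loop_rel_step)
        then show ?thesis using False x vU by auto
      qed (use x in auto)
    qed
  qed (use US in \<open>auto simp: loops_def\<close>)
  then show "card (orbit w ` U) = card (loops S v e)"
    using finU by (simp only:) (intro card_image_eqI, simp_all add: rel loop_rel_image_eq[OF v e])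
qed

section \<open>Signs of pair switches, and two-colouring of loops\<close>

definition flip :: "('a \<Rightarrow> 'a) \<Rightarrow> 'a set \<Rightarrow> 'a \<Rightarrow> 'a" where
  "flip v X y = (if y \<in> X \<union> v ` X then v y else y)"

lemma sign_flip:
  assumes "finite X" "X \<inter> v ` X = {}" "\<And>x. x \<in> X \<Longrightarrow> v (v x) = x"
  shows "permutation (flip v X) \<and> sign (flip v X) = (-1) ^ card X"
  using assms
proof (induction X rule: finite_induct)
  case empty
  have "flip v {} = id" by (simp add: flip_def fun_eq_iff)
  then show ?case by simp
next
  case (insert x X)
  define f where "f = flip v X"
  have IH: "permutation f" "sign f = (-1) ^ card X"
    using insert.IH insert.prems unfolding f_def by auto
  have vx: "v x \<noteq> x" "v x \<notin> X" "x \<notin> v ` X" using insert.prems(1) by auto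
  have vx2: "v x \<notin> v ` X"
  proof
    assume "v x \<in> v ` X"
    then obtain y where y: "y \<in> X" "v x = v y" by (elim imageE) (rule that)
    have "x = v (v x)" by (rule insert.prems(2)[symmetric]) simp
    also have "\<dots> = v (v y)" unfolding y(2) ..
    also have "\<dots> = y" by (rule insert.prems(2)) (simp add: y(1))
    finally show False using y(1) insert.hyps(2) by simp
  qed
  have f_other: "f y \<noteq> x \<and> f y \<noteq> v x" if y: "y \<in> X \<union> v ` X" for y
  proof -
    have fy: "f y = v y" using y by (simp add: f_def flip_def)
    have vvy: "v (v y) = y" using y insert.prems(2) by auto
    have "x \<notin> X \<union> v ` X" "v x \<notin> X \<union> v ` X" using insert.hyps(2) vx vx2 by auto
    moreover have "v (v x) = x" using insert.prems(2) by simp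
    ultimately show ?thesis unfolding fy using vvy y by (metis (no_types, lifting))
  qed
  have f_fix: "f x = x" "f (v x) = v x" using insert.hyps(2) vx vx2 by (auto simp: f_def flip_def)
  have eq: "flip v (insert x X) = Transposition.transpose x (v x) \<circ> f"
  proof
    fix y
    consider "y = x" | "y = v x" | "y \<in> X \<union> v ` X" | "y \<noteq> x" "y \<noteq> v x" "y \<notin> X \<union> v ` X" by blast
    then show "flip v (insert x X) y = (Transposition.transpose x (v x) \<circ> f) y"
    proof cases
      case 1
      then show ?thesis using f_fix by (simp add: flip_def)
    next
      case 2
      have "flip v (insert x X) (v x) = v (v x)" by (simp add: flip_def)
      also have "\<dots> = x" by (rule insert.prems(2)) simp
      finally show ?thesis unfolding 2 o_apply f_fix transpose_apply_second .
    next
      case 3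
      then have "f y = v y" by (simp add: f_def flip_def)
      then show ?thesis using f_other[OF 3] 3 by (simp add: Transposition.transpose_def flip_def)
    next
      case 4
      then show ?thesis by (simp add: f_def flip_def Transposition.transpose_def)
    qed
  qed
  have "permutation (flip v (insert x X))"
    unfolding eq by (rule permutation_compose[OF permutation_swap_id IH(1)])
  moreover have "sign (flip v (insert x X)) = (-1) ^ card (insert x X)"
    unfolding eq sign_compose[OF permutation_swap_id IH(1)] IH(2) sign_swap_id card_insert_disjoint[OF insert.hyps]
    using vx(1) by simp
  ultimately show ?case by (rule conjI)
qed

text \<open>Loops have even length. With \<open>q\<close> acting as \<open>e\<close> after
  \<open>v\<close>, the loop of \<open>x\<close> consists of the two different
  \<open>q\<close>-orbits of \<open>x\<close> and \<open>v x\<close>; the alternating set takes on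
  each loop the \<open>q\<close>-orbit of a chosen point.\<close>

lemma alternating_nonempty:
  assumes v: "matching S v" and e: "matching S e" and S: "finite S"
  shows "alternating S v e \<noteq> {}"
proof -
  note vD = matchingD[OF v] and eD = matchingD[OF e]
  define q where "q = (\<lambda>x. if x \<in> S then e (v x) else x)"
  have q: "q permutes S" unfolding q_def by (rule step_permutes[OF v e S])
  have perm: "permutation q" using q S by (auto simp: permutation_permutes)
  have orb_q: "orbit q (q x) = orbit q x" for x by (rule permutation_orbit_step[OF perm])
  have orb_e: "orbit q (e x) = orbit q (v x)" if "x \<in> S" for x
  proof -
    have "q (v x) = e x" using that by (simp add: q_def vD)
    then show ?thesis using orb_q[of "v x"] by simp
  qed
  have q_in: "q x \<in> S" if "x \<in> S" for x using that by (simp add: q_def vD eD)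
  have orb_vq: "orbit q (v (q x)) = orbit q (v x)" if "x \<in> S" for x
  proof -
    have "q (v (q x)) = v x" using that by (simp add: q_def vD eD)
    then show ?thesis using orb_q[of "v (q x)"] by simp
  qed
  have orb_v: "orbit q (v x) = orbit q (v y)" if xy: "orbit q x = orbit q y" "x \<in> S" "y \<in> S" for x y
  proof -
    have "y \<in> orbit q x" unfolding xy(1) using permutation_self_in_orbit[OF perm] .
    then have "y \<in> S \<and> orbit q (v y) = orbit q (v x)"
      by induction (use xy(2) in \<open>auto simp: orb_vq q_in\<close>)
    then show ?thesis by simp
  qed
  have pow: "(q ^^ j) x \<in> S" if "x \<in> S" for j x
    using that by (induction j) (auto simp: q_in)
  have conj: "(q ^^ j) (v ((q ^^ j) x)) = v x" if x: "x \<in> S" for j x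
    using x
  proof (induction j arbitrary: x)
    case (Suc j)
    have "(q ^^ Suc j) (v ((q ^^ Suc j) x)) = q ((q ^^ j) (v ((q ^^ j) (q x))))"
      by (simp add: funpow_swap1)
    also have "\<dots> = q (v (q x))" using Suc.IH[of "q x"] q_in[OF Suc.prems] by simp
    also have "\<dots> = v x" using Suc.prems by (simp add: q_def vD eD)
    finally show ?case .
  qed simp
  have inj: "inj (q ^^ j)" for j using q by (simp add: inj_fn permutes_inj)
  \<comment> \<open>\<open>v\<close> conjugates \<open>q\<close> to its inverse, which is the
    content of \<open>conj\<close>. If \<open>v x\<close> were \<open>q^k x\<close>, the middle of
    the path would give a fixed point of \<open>v\<close> for even \<open>k\<close> and of
    \<open>e\<close> for odd \<open>k\<close>, impossible for matchings.\<close>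
  have distinct: "orbit q (v x) \<noteq> orbit q x" if x: "x \<in> S" for x
  proof
    assume "orbit q (v x) = orbit q x"
    then have "v x \<in> orbit q x" using permutation_self_in_orbit[OF perm, of "v x"] by simp
    then obtain k where k: "v x = (q ^^ k) x" unfolding orbit_altdef by blast
    define y where "y = (q ^^ (k div 2)) x"
    have y: "y \<in> S" unfolding y_def by (rule pow[OF x])
    have vy: "(q ^^ (k div 2)) (v y) = v x" unfolding y_def by (rule conj[OF x])
    show False
    proof (cases "even k")
      case True
      then have "k = k div 2 + k div 2" by presburger
      then have "v x = (q ^^ (k div 2)) y" unfolding k y_def by (metis funpow_add o_apply)
      then have "v y = y" using vy inj[of "k div 2"] by (simp add: inj_eq)
      then show False using vD(2)[OF y] by simp
    next
      case False
      define h where "h = k div 2"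
      have "k = h + Suc h" using False unfolding h_def by presburger
      then have "v x = (q ^^ h) (q y)" unfolding k y_def h_def[symmetric] by (simp add: funpow_add funpow_swap1)
      then have "v y = q y" using vy inj[of h] unfolding h_def[symmetric] by (simp add: inj_eq)
      then have "e (v y) = v y" using y by (simp add: q_def)
      then show False using eD(2)[of "v y"] vD(1)[OF y] by simp
    qed
  qed
  \<comment> \<open>The choice is made from the whole class, so it is literally the same point for
    all members of a loop.\<close>
  define rep where "rep x = (SOME y. y \<in> loop_rel S v e `` {x})" for x
  have rep_ve: "rep (v x) = rep x" "rep (e x) = rep x" if "x \<in> S" for x
  proof -
    have "loop_rel S v e `` {x} = loop_rel S v e `` {v x}" "loop_rel S v e `` {x} = loop_rel S v e `` {e x}"
      unfolding loop_rel_image_eq[OF v e] using that by (intro loop_rel_step; assumption)+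
    then show "rep (v x) = rep x" "rep (e x) = rep x" unfolding rep_def by simp_all
  qed
  have rep: "rep x \<in> S \<and> (orbit q (rep x) = orbit q x \<or> orbit q (rep x) = orbit q (v x))" if x: "x \<in> S" for x
  proof -
    have "rep x \<in> loop_rel S v e `` {x}"
      unfolding rep_def by (rule someI[of _ x]) (simp add: loop_rel_refl)
    then have "(x, rep x) \<in> loop_rel S v e" by simp
    then show ?thesis unfolding loop_rel_def
    proof (induction rule: rtrancl_induct)
      case base
      then show ?case using x by simp
    next
      case (step y z)
      then have y: "y \<in> S" "orbit q y = orbit q x \<or> orbit q y = orbit q (v x)" and z: "z = v y \<or> z = e y" by auto
      then have "orbit q (v y) = orbit q x \<or> orbit q (v y) = orbit q (v x)"
        using orb_v[of y x] orb_v[of y "v x"] x by (auto simp: vD)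
      moreover have "orbit q z = orbit q (v y)" using z orb_e[OF y(1)] by auto
      ultimately show ?case using z y(1) by (auto simp: vD eD)
    qed
  qed
  define U where "U = {x \<in> S. orbit q x = orbit q (rep x)}"
  have v_iff: "orbit q (v x) = orbit q (rep x) \<longleftrightarrow> orbit q x \<noteq> orbit q (rep x)" if "x \<in> S" for x
    using rep[OF that] distinct[OF that] by auto
  have "transversal S v U"
    unfolding transversal_def U_def using v_iff by (auto simp: vD rep_ve)
  moreover have "transversal S e U"
    unfolding transversal_def U_def using v_iff by (auto simp: eD rep_ve orb_e)
  ultimately show ?thesis by (auto simp: alternating_def)
qed

text \<open>Relative to a fixed \<open>U0\<close>, any alternating set agrees or disagrees with
  \<open>U0\<close> on entire loops. The sets therefore correspond to arbitrary collections of loops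
  on which they disagree.\<close>

lemma card_alternating:
  assumes v: "matching S v" and e: "matching S e" and S: "finite S"
  shows "card (alternating S v e) = 2 ^ card (loops S v e)"
proof -
  obtain U0 where U0: "U0 \<in> alternating S v e" using alternating_nonempty[OF assms] by blast
  define cls where "cls x = loop_rel S v e `` {x}" for x
  have cls_eq: "cls (v x) = cls x" "cls (e x) = cls x" if "x \<in> S" for x
    unfolding cls_def using loop_rel_step[OF that, of v e] loop_rel_step[OF that, of e v] loop_rel_image_eq[OF v e] by (metis that loop_rel_step(2) loop_rel_step(1))+
  define \<Phi> where "\<Phi> C = {x \<in> S. x \<in> U0 \<longleftrightarrow> cls x \<notin> C}" for C
  define \<Psi> where "\<Psi> U = {cls x | x. x \<in> S \<and> (x \<in> U) \<noteq> (x \<in> U0)}" for U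
  have "bij_betw \<Phi> (Pow (loops S v e)) (alternating S v e)"
  proof (rule bij_betw_byWitness[where f' = \<Psi>])
    show "\<forall>C\<in>Pow (loops S v e). \<Psi> (\<Phi> C) = C"
      unfolding \<Psi>_def \<Phi>_def loops_def cls_def[symmetric] by auto
    show "\<forall>U\<in>alternating S v e. \<Phi> (\<Psi> U) = U"
    proof
      fix U assume U: "U \<in> alternating S v e"
      have inv: "(y \<in> U) = (y \<in> U0) \<longleftrightarrow> (x \<in> U) = (x \<in> U0)" if "cls x = cls y" for x y
      proof -
        have "(x, y) \<in> loop_rel S v e" using that loop_rel_image_eq[OF v e] unfolding cls_def by blast
        then have "((y \<in> U) = (y \<in> U0)) = ((x \<in> U) = (x \<in> U0))"
          by (rule loop_rel_invariant[where f = "\<lambda>x. (x \<in> U) = (x \<in> U0)"])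
             (use U U0 in \<open>auto simp: alternating_def transversal_def\<close>)
        then show ?thesis .
      qed
      have "U \<subseteq> S" using U by (simp add: alternating_def transversal_def)
      moreover have "cls x \<in> \<Psi> U \<longleftrightarrow> (x \<in> U) \<noteq> (x \<in> U0)" if "x \<in> S" for x
        unfolding \<Psi>_def using inv that by blast
      ultimately show "\<Phi> (\<Psi> U) = U" unfolding \<Phi>_def by blast
    qed
    show "\<Phi> ` Pow (loops S v e) \<subseteq> alternating S v e"
    proof (rule image_subsetI)
      fix C
      show "\<Phi> C \<in> alternating S v e"
        using U0 unfolding \<Phi>_def alternating_def transversal_def
        by (simp add: cls_eq matchingD[OF v] matchingD[OF e])
    qed
    show "\<Psi> ` alternating S v e \<subseteq> Pow (loops S v e)"
      unfolding \<Psi>_def loops_def cls_def by auto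
  qed
  then have "card (alternating S v e) = card (Pow (loops S v e))" by (rule bij_betw_same_card[symmetric])
  also have "finite (loops S v e)" using S by (simp add: loops_def)
  then have "card (Pow (loops S v e)) = 2 ^ card (loops S v e)" by (rule card_Pow)
  finally show ?thesis .
qed

lemma card_transversal:
  assumes "matching S v" "transversal S v A" "finite S"
  shows "card S = 2 * card A"
proof -
  have A: "A \<subseteq> S" "\<And>x. x \<in> S \<Longrightarrow> v x \<in> A \<longleftrightarrow> x \<notin> A" using assms(2) by (auto simp: transversal_def)
  have "bij_betw v A (S - A)"
    by (rule bij_betw_byWitness[where f' = v]) (use A matchingD[OF assms(1)] in auto)
  then have "card A = card (S - A)" by (rule bij_betw_same_card)
  moreover have "card (S - A) = card S - card A" "card A \<le> card S"
    using A assms(3) by (auto intro: card_Diff_subset card_mono finite_subset)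
  ultimately show ?thesis by simp
qed

text \<open>Exchanges the ends of the pairs in which \<open>A\<close> and \<open>U\<close> pick the
  same end. It thereby carries the complement of \<open>U\<close> onto \<open>A\<close>, at the cost
  of one transposition per element of \<open>A \<inter> U\<close>.\<close>

definition switch :: "'a set \<Rightarrow> ('a \<Rightarrow> 'a) \<Rightarrow> 'a set \<Rightarrow> 'a set \<Rightarrow> 'a \<Rightarrow> 'a" where
  "switch S v A U x = (if x \<in> S \<and> (x \<in> A \<longleftrightarrow> x \<in> U) then v x else x)"

lemma sign_switch:
  assumes v: "matching S v" and A: "transversal S v A" and U: "transversal S v U" and S: "finite S"
  shows "permutation (switch S v A U)" "sign (switch S v A U) = (-1) ^ card (A \<inter> U)"
proof -
  have A': "A \<subseteq> S" "\<And>x. x \<in> S \<Longrightarrow> v x \<in> A \<longleftrightarrow> x \<notin> A" using A by (auto simp: transversal_def)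
  have U': "U \<subseteq> S" "\<And>x. x \<in> S \<Longrightarrow> v x \<in> U \<longleftrightarrow> x \<notin> U" using U by (auto simp: transversal_def)
  note vD = matchingD[OF v]
  have img: "x \<in> v ` (A \<inter> U) \<longleftrightarrow> x \<in> S \<and> x \<notin> A \<and> x \<notin> U" for x
  proof
    assume "x \<in> v ` (A \<inter> U)"
    then show "x \<in> S \<and> x \<notin> A \<and> x \<notin> U" using A' U' vD by auto
  next
    assume x: "x \<in> S \<and> x \<notin> A \<and> x \<notin> U"
    then have "v x \<in> A \<inter> U" "x = v (v x)" using A' U' vD by auto
    then show "x \<in> v ` (A \<inter> U)" by blast
  qed
  have eq: "switch S v A U = flip v (A \<inter> U)"
  proof
    fix x
    have "x \<in> A \<inter> U \<union> v ` (A \<inter> U) \<longleftrightarrow> x \<in> S \<and> (x \<in> A \<longleftrightarrow> x \<in> U)"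
      using img[of x] A'(1) U'(1) by blast
    then show "switch S v A U x = flip v (A \<inter> U) x" by (simp only: switch_def flip_def)
  qed
  have "finite (A \<inter> U)" using A'(1) S by (meson finite_Int finite_subset)
  moreover have "(A \<inter> U) \<inter> v ` (A \<inter> U) = {}" using img by auto
  moreover have "v (v x) = x" if "x \<in> A \<inter> U" for x using that A' vD by auto
  ultimately have "permutation (flip v (A \<inter> U)) \<and> sign (flip v (A \<inter> U)) = (-1) ^ card (A \<inter> U)"
    by (rule sign_flip)
  then show "permutation (switch S v A U)" "sign (switch S v A U) = (-1) ^ card (A \<inter> U)"
    unfolding eq by simp_all
qed


section \<open>The permutation comparing two matchings, and its sign\<close>

lemma permutes_extend:
  assumes "finite X" "inj_on f X" "f ` X \<subseteq> X"
  shows "(\<lambda>x. if x \<in> X then f x else x) permutes X"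
proof (rule bij_imp_permutes)
  have "f ` X = X" by (rule endo_inj_surj[OF assms(1,3,2)])
  then show "bij_betw (\<lambda>x. if x \<in> X then f x else x) X X"
    using assms(2) by (simp add: bij_betw_def inj_on_def)
qed auto

text \<open>\<open>composite\<close> carries the list of \<open>v\<close>-pairs to the list of \<open>e\<close>-pairs, matched up along \<open>r\<close>.
  Switching pairs moves both transversals to the complement of \<open>U\<close>, where it becomes a
  permutation of that complement, doubled, composed with \<open>e \<circ> v\<close> on \<open>U\<close>.\<close>

definition composite :: "'a set \<Rightarrow> ('a \<Rightarrow> 'a) \<Rightarrow> ('a \<Rightarrow> 'a) \<Rightarrow> 'a set \<Rightarrow> ('a \<Rightarrow> 'a) \<Rightarrow> 'a \<Rightarrow> 'a" where
  "composite S v e A r x = (if x \<in> A then r x else if x \<in> S then e (r (v x)) else x)"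

lemma permutes_composite:
  assumes v: "matching S v" and e: "matching S e" and S: "finite S"
    and A: "transversal S v A" and B: "transversal S e B" and r: "bij_betw r A B"
  shows "composite S v e A r permutes S"
proof (rule bij_imp_permutes)
  note vD = matchingD[OF v] and eD = matchingD[OF e]
  have A': "A \<subseteq> S" "\<And>x. x \<in> S \<Longrightarrow> v x \<in> A \<longleftrightarrow> x \<notin> A" using A by (auto simp: transversal_def)
  have B': "B \<subseteq> S" "\<And>x. x \<in> S \<Longrightarrow> e x \<in> B \<longleftrightarrow> x \<notin> B" using B by (auto simp: transversal_def)
  have rA: "r x \<in> B" if "x \<in> A" for x using that r by (auto simp: bij_betw_def)
  have r_inj: "r x = r y \<Longrightarrow> x = y" if "x \<in> A" "y \<in> A" for x y using that r by (auto simp: bij_betw_def inj_on_def)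
  let ?c = "composite S v e A r"
  have c1: "?c x = r x" "?c x \<in> B" if "x \<in> A" for x using that rA by (auto simp: composite_def)
  have c2: "?c x = e (r (v x))" "?c x \<in> S - B" "v x \<in> A" if "x \<in> S" "x \<notin> A" for x
  proof -
    show vA: "v x \<in> A" using that A' by auto
    show c: "?c x = e (r (v x))" using that by (simp add: composite_def)
    have "r (v x) \<in> B" "r (v x) \<in> S" using rA[OF vA] B' by auto
    then show "?c x \<in> S - B" unfolding c using B' eD by auto
  qed
  have "inj_on ?c S"
  proof (rule inj_onI)
    fix x y assume xy: "x \<in> S" "y \<in> S" "?c x = ?c y"
    show "x = y"
    proof (cases "x \<in> A")
      case True
      have "?c y \<in> B" using c1(2)[OF True] xy(3) by simp
      then have y: "y \<in> A" using c2(2)[OF xy(2)] by blast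
      have "r x = r y" using c1(1)[OF True] c1(1)[OF y] xy(3) by simp
      then show ?thesis by (rule r_inj[OF True y])
    next
      case False
      have "?c y \<notin> B" using c2(2)[OF xy(1) False] xy(3) by simp
      then have yA: "y \<notin> A" using c1(2)[of y] by blast
      have "e (r (v x)) = e (r (v y))" using c2(1)[OF xy(1) False] c2(1)[OF xy(2) yA] xy(3) by simp
      moreover have "r (v x) \<in> S" "r (v y) \<in> S" using rA c2(3) False yA xy B' by blast+
      ultimately have "r (v x) = r (v y)" using eD(3) by metis
      then have "v x = v y" by (rule r_inj[OF c2(3)[OF xy(1) False] c2(3)[OF xy(2) yA]])
      then show ?thesis using vD(3) xy by metis
    qed
  qed
  moreover have "?c ` S \<subseteq> S"
  proof (rule image_subsetI)
    fix x assume "x \<in> S"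
    then show "?c x \<in> S" using c1[of x] c2[of x] B' by (cases "x \<in> A") auto
  qed
  ultimately show "bij_betw ?c S S" unfolding bij_betw_def using endo_inj_surj[OF S] by blast
next
  fix x assume "x \<notin> S"
  then show "composite S v e A r x = x" using A by (auto simp: composite_def transversal_def)
qed

text \<open>The right side does not depend on \<open>U\<close>. Hence all alternating sets
  contribute with the same sign, and the global quantity \<open>(-1)^card (loops S v e)\<close> is
  expressed by the local counts \<open>card (A \<inter> U)\<close> and
  \<open>card (B \<inter> U)\<close>.\<close>

lemma sign_composite:
  assumes v: "matching S v" and e: "matching S e" and S: "finite S"
    and A: "transversal S v A" and B: "transversal S e B" and r: "bij_betw r A B"
    and U: "U \<in> alternating S v e"
  shows "(-1) ^ (card (A \<inter> U) + card (B \<inter> U)) * sign (composite S v e A r) = (-1) ^ (card A + card (loops S v e))"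
proof -
  note vD = matchingD[OF v] and eD = matchingD[OF e]
  have A': "A \<subseteq> S" "\<And>x. x \<in> S \<Longrightarrow> v x \<in> A \<longleftrightarrow> x \<notin> A" using A by (auto simp: transversal_def)
  have B': "B \<subseteq> S" "\<And>x. x \<in> S \<Longrightarrow> e x \<in> B \<longleftrightarrow> x \<notin> B" using B by (auto simp: transversal_def)
  have Uv: "transversal S v U" and Ue: "transversal S e U" using U by (auto simp: alternating_def)
  have US: "U \<subseteq> S" and vU: "\<And>x. x \<in> S \<Longrightarrow> v x \<in> U \<longleftrightarrow> x \<notin> U" and eU: "\<And>x. x \<in> S \<Longrightarrow> e x \<in> U \<longleftrightarrow> x \<notin> U"
    using Uv Ue by (auto simp: transversal_def)
  have rA: "r x \<in> B" if "x \<in> A" for x using that r by (auto simp: bij_betw_def)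
  define a where "a = switch S v A U"
  define b where "b = switch S e B U"
  define c where "c = composite S v e A r"
  have a: "permutation a" "sign a = (-1) ^ card (A \<inter> U)" unfolding a_def by (rule sign_switch[OF v A Uv S])+
  have b: "permutation b" "sign b = (-1) ^ card (B \<inter> U)" unfolding b_def by (rule sign_switch[OF e B Ue S])+
  have c: "permutation c" unfolding c_def
    using permutes_composite[OF v e S A B r] S by (auto simp: permutation_permutes)
  have aA: "a x \<in> A" if "x \<in> S - U" for x using that A' vD by (auto simp: a_def switch_def)
  have bB: "b x \<in> S - U" if "x \<in> B" for x using that B' eD eU by (auto simp: b_def switch_def)
  have va: "v (a x) = a (v x)" "a x \<in> S" "a x \<notin> A" if "x \<in> U" for x
    using that A' vD vU US by (auto simp: a_def switch_def)
  have eb: "b (e x) = e (b x)" if "x \<in> B" for x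
    using that B' eD eU by (auto simp: b_def switch_def)
  define \<rho> where "\<rho> = (\<lambda>x. if x \<in> S - U then b (r (a x)) else x)"
  have \<rho>: "\<rho> permutes (S - U)" unfolding \<rho>_def
  proof (rule permutes_extend)
    show "inj_on (\<lambda>x. b (r (a x))) (S - U)"
    proof (rule inj_onI)
      fix x y assume xy: "x \<in> S - U" "y \<in> S - U" "b (r (a x)) = b (r (a y))"
      have "r (a x) = r (a y)" using xy(3) b(1) by (metis permutation_bijective bij_is_inj injD)
      then have "a x = a y" using r aA xy by (auto simp: bij_betw_def inj_on_def)
      then show "x = y" using a(1) by (metis permutation_bijective bij_is_inj injD)
    qed
    show "(\<lambda>x. b (r (a x))) ` (S - U) \<subseteq> S - U" using aA rA bB by auto
  qed (use S in simp)
  have \<rho>_perm: "permutation \<rho>" using \<rho> S by (auto simp: permutation_permutes)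
  define w where "w = (\<lambda>x. if x \<in> U then e (v x) else x)"
  have w: "w permutes U" "card (orbit w ` U) = card (loops S v e)"
    unfolding w_def by (rule card_loops_eq_orbits[OF v e S U])+
  have finU: "finite U" using US S finite_subset by blast
  have w_perm: "permutation w" using w finU by (auto simp: permutation_permutes)
  define E where "E = (\<lambda>x. if x \<in> S then e x else x)"
  have E: "E permutes S" unfolding E_def
    by (rule permutes_extend[OF S]) (use eD in \<open>auto intro: inj_on_inverseI\<close>)
  have E_perm: "permutation E" using E S by (auto simp: permutation_permutes)
  have \<rho>_in: "\<rho> x \<in> S - U" if "x \<in> S - U" for x using permutes_in_image[OF \<rho>, of x] that by blast
  have \<rho>_out: "\<rho> x = x" if "x \<notin> S - U" for x using permutes_not_in[OF \<rho> that] .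
  \<comment> \<open>After switching, both lists of pairs start in the complement of
    \<open>U\<close>. There the map is \<open>\<rho>\<close>, and on \<open>U\<close> it is the copy
    of \<open>\<rho>\<close> transported by \<open>E\<close>, preceded by \<open>w\<close>; the two
    copies have equal signs, so only the sign of \<open>w\<close> remains.\<close>
  have "b \<circ> c \<circ> a = (E \<circ> \<rho> \<circ> E) \<circ> w \<circ> \<rho>"
  proof
    fix x
    consider "x \<in> U" | "x \<in> S - U" | "x \<notin> S" by blast
    then show "(b \<circ> c \<circ> a) x = ((E \<circ> \<rho> \<circ> E) \<circ> w \<circ> \<rho>) x"
    proof cases
      case 1
      have xS: "x \<in> S" using 1 US by auto
      have vx: "v x \<in> S - U" using 1 xS vU vD by auto
      have "c (a x) = e (r (a (v x)))" using va[OF 1] by (simp add: c_def composite_def)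
      then have L: "b (c (a x)) = e (\<rho> (v x))" using eb[OF rA[OF aA[OF vx]]] vx by (simp add: \<rho>_def)
      have "\<rho> x = x" using 1 by (intro \<rho>_out) auto
      moreover have "w x = e (v x)" using 1 by (simp add: w_def)
      moreover have "E (e (v x)) = v x" using vx eD by (simp add: E_def)
      moreover have "E (\<rho> (v x)) = e (\<rho> (v x))" using \<rho>_in[OF vx] by (simp add: E_def)
      ultimately show ?thesis using L by simp
    next
      case 2
      have "c (a x) = r (a x)" using aA[OF 2] by (simp add: c_def composite_def)
      then have L: "b (c (a x)) = \<rho> x" using 2 by (simp add: \<rho>_def)
      have \<rho>x: "\<rho> x \<in> S - U" by (rule \<rho>_in[OF 2])
      then have "w (\<rho> x) = \<rho> x" by (simp add: w_def)
      moreover have "E (\<rho> x) = e (\<rho> x)" using \<rho>x by (simp add: E_def)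
      moreover have "\<rho> (e (\<rho> x)) = e (\<rho> x)" using \<rho>x eU by (intro \<rho>_out) auto
      moreover have "E (e (\<rho> x)) = \<rho> x" using \<rho>x eD by (simp add: E_def)
      ultimately show ?thesis using L by simp
    next
      case 3
      then have "a x = x" "b x = x" "c x = x" "\<rho> x = x" "w x = x" "E x = x"
        using A' US by (auto simp: a_def b_def c_def switch_def composite_def \<rho>_def w_def E_def)
      then show ?thesis by simp
    qed
  qed
  then have "sign (b \<circ> c \<circ> a) = sign ((E \<circ> \<rho> \<circ> E) \<circ> w \<circ> \<rho>)" by simp
  then have "sign b * sign c * sign a = (sign E * sign E) * (sign \<rho> * sign \<rho>) * sign w"
    using a b c \<rho>_perm w_perm E_perm by (simp add: sign_compose permutation_compose mult_ac)
  then have "sign b * sign c * sign a = (-1) ^ (card U + card (loops S v e))"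
    using sign_eq_card_orbits[OF finU w(1)] w(2) by (simp add: sign_idempotent)
  moreover have "card U = card A"
    using card_transversal[OF v A S] card_transversal[OF v Uv S] by simp
  ultimately show ?thesis using a b by (simp add: c_def power_add mult_ac)
qed

text \<open>The matching \<open>e\<close> with a permutation inserted at the \<open>B\<close>-ends;
  seen from the other ends the inverse appears, as in \<open>ematch\<close>.\<close>

definition twist :: "'a set \<Rightarrow> ('a \<Rightarrow> 'a) \<Rightarrow> ('a \<Rightarrow> 'a) \<Rightarrow> 'a \<Rightarrow> 'a" where
  "twist B e h x = (if x \<in> B then e (h x) else inv h (e x))"

lemma twist_matching:
  assumes e: "matching S e" and B: "transversal S e B" and h: "h permutes B"
  shows "matching S (twist B e h)" "transversal S (twist B e h) B"
proof -
  note eD = matchingD[OF e]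
  have B': "B \<subseteq> S" "\<And>x. x \<in> S \<Longrightarrow> e x \<in> B \<longleftrightarrow> x \<notin> B" using B by (auto simp: transversal_def)
  have hB: "h x \<in> B" "inv h x \<in> B" if "x \<in> B" for x
    using that h permutes_inv[OF h] by (simp_all add: permutes_in_image)
  have hinv: "h (inv h x) = x" "inv h (h x) = x" for x using h by (simp_all add: permutes_inverses)
  have 1: "twist B e h x \<in> S - B" "twist B e h (twist B e h x) = x" if "x \<in> B" for x
  proof -
    have "h x \<in> B" "h x \<in> S" using hB that B' by auto
    then have "e (h x) \<in> S" "e (h x) \<notin> B" "e (e (h x)) = h x" using B' eD by auto
    then show "twist B e h x \<in> S - B" "twist B e h (twist B e h x) = x"
      using that hinv by (auto simp: twist_def)
  qed
  have 2: "twist B e h x \<in> B" "twist B e h (twist B e h x) = x" if "x \<in> S" "x \<notin> B" for x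
  proof -
    have "e x \<in> B" "e (e x) = x" using that B' eD by auto
    then show "twist B e h x \<in> B" "twist B e h (twist B e h x) = x"
      using that hinv hB by (auto simp: twist_def)
  qed
  show "matching S (twist B e h)" unfolding matching_def
  proof
    fix x assume "x \<in> S"
    then show "twist B e h x \<in> S \<and> twist B e h x \<noteq> x \<and> twist B e h (twist B e h x) = x"
      using 1[of x] 2[of x] B'(1) by (cases "x \<in> B") auto
  qed
  show "transversal S (twist B e h) B" unfolding transversal_def
  proof (intro conjI ballI B')
    fix x assume "x \<in> S"
    then show "twist B e h x \<in> B \<longleftrightarrow> x \<notin> B"
      using 1[of x] 2[of x] by (cases "x \<in> B") auto
  qed
qed

text \<open>Twisting by \<open>h\<close> multiplies the composite by a conjugate of
  \<open>h\<close>, so its sign absorbs \<open>sign h\<close>. By \<open>sign_composite\<close> the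
  \<open>2 ^ card (loops ...)\<close> alternating sets contribute equally. The unit
  \<open>\<zeta>\<close> is chosen before \<open>h\<close>, which permits summation over
  \<open>h\<close> afterwards.\<close>

theorem signed_loop_expansion:
  assumes v: "matching S v" and e: "matching S e" and S: "finite S"
    and A: "transversal S v A" and B: "transversal S e B"
  obtains \<zeta> :: int where "\<bar>\<zeta>\<bar> = 1"
    "\<And>h. h permutes B \<Longrightarrow> sign h * (-2) ^ card (loops S v (twist B e h))
      = \<zeta> * (\<Sum>U\<in>alternating S v (twist B e h). (-1) ^ (card (A \<inter> U) + card (B \<inter> U)))"
proof -
  note vD = matchingD[OF v] and eD = matchingD[OF e]
  have A': "A \<subseteq> S" "\<And>x. x \<in> S \<Longrightarrow> v x \<in> A \<longleftrightarrow> x \<notin> A" using A by (auto simp: transversal_def)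
  have B': "B \<subseteq> S" "\<And>x. x \<in> S \<Longrightarrow> e x \<in> B \<longleftrightarrow> x \<notin> B" using B by (auto simp: transversal_def)
  have "card A = card B" using card_transversal[OF v A S] card_transversal[OF e B S] by simp
  moreover have "finite A" "finite B" using A' B' S finite_subset by blast+
  ultimately obtain r where r: "bij_betw r A B" using finite_same_card_bij by blast
  define \<zeta> where "\<zeta> = (-1) ^ card A * sign (composite S v e A r)"
  define E where "E = (\<lambda>x. if x \<in> S then e x else x)"
  have E: "E permutes S" unfolding E_def
    by (rule permutes_extend[OF S]) (use eD in \<open>auto intro: inj_on_inverseI\<close>)
  have E_perm: "permutation E" using E S by (auto simp: permutation_permutes)
  have c_perm: "permutation (composite S v e A r)"
    using permutes_composite[OF v e S A B r] S by (auto simp: permutation_permutes)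
  show thesis
  proof
    show "\<bar>\<zeta>\<bar> = 1" by (simp add: \<zeta>_def abs_mult power_abs)
    fix h assume h: "h permutes B"
    let ?e = "twist B e h"
    note tw = twist_matching[OF e B h]
    have h_perm: "permutation h" using h \<open>finite B\<close> by (auto simp: permutation_permutes)
    have hB: "h x \<in> B" if "x \<in> B" for x using that h by (simp add: permutes_in_image)
    have h_out: "h x = x" if "x \<notin> B" for x using that h by (simp add: permutes_def)
    have "composite S v ?e A r = (E \<circ> h \<circ> E) \<circ> composite S v e A r"
    proof
      fix x
      consider "x \<in> A" | "x \<in> S" "x \<notin> A" | "x \<notin> S" by blast
      then show "composite S v ?e A r x = ((E \<circ> h \<circ> E) \<circ> composite S v e A r) x"
      proof cases
        case 1
        then have rB: "r x \<in> B" using r by (auto simp: bij_betw_def)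
        then have "r x \<in> S" "e (r x) \<in> S" "e (r x) \<notin> B" "e (e (r x)) = r x" using B' eD by auto
        then show ?thesis using 1 h_out[of "e (r x)"] by (simp add: composite_def E_def)
      next
        case 2
        then have "v x \<in> A" using A' by auto
        then have rB: "r (v x) \<in> B" using r by (auto simp: bij_betw_def)
        then have "r (v x) \<in> S" "e (r (v x)) \<in> S" "e (e (r (v x))) = r (v x)" "h (r (v x)) \<in> S"
          using B' eD hB by auto
        then show ?thesis using 2 rB by (simp add: composite_def E_def twist_def)
      next
        case 3
        then have "x \<notin> A" "x \<notin> B" using A' B' by auto
        then show ?thesis using 3 h_out by (simp add: composite_def E_def)
      qed
    qed
    then have sg: "sign (composite S v ?e A r) = sign h * sign (composite S v e A r)"
      using E_perm h_perm c_perm by (simp add: sign_compose permutation_compose mult_ac)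
    have each: "\<zeta> * (-1) ^ (card (A \<inter> U) + card (B \<inter> U)) = sign h * (-1) ^ card (loops S v ?e)"
      if U: "U \<in> alternating S v ?e" for U
    proof -
      have *: "(-1) ^ (card (A \<inter> U) + card (B \<inter> U)) * (sign h * sign (composite S v e A r)) = (-1) ^ (card A + card (loops S v ?e))"
        using sign_composite[OF v tw(1) S A tw(2) r U] unfolding sg .
      have "\<zeta> * (-1) ^ (card (A \<inter> U) + card (B \<inter> U))
         = (sign h * sign h) * ((-1) ^ card A * ((-1) ^ (card (A \<inter> U) + card (B \<inter> U)) * sign (composite S v e A r)))"
        unfolding \<zeta>_def by (simp add: mult_ac)
      also have "\<dots> = sign h * (-1) ^ card A * ((-1) ^ (card (A \<inter> U) + card (B \<inter> U)) * (sign h * sign (composite S v e A r)))"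
        by (simp only: mult_ac)
      also have "\<dots> = sign h * ((-1) ^ card A * (-1) ^ card A) * (-1) ^ card (loops S v ?e)"
        unfolding * by (simp add: power_add)
      also have "(-1::int) ^ card A * (-1) ^ card A = 1" by (simp add: power_add[symmetric])
      finally show ?thesis by simp
    qed
    have "\<zeta> * (\<Sum>U\<in>alternating S v ?e. (-1) ^ (card (A \<inter> U) + card (B \<inter> U)))
       = (\<Sum>U\<in>alternating S v ?e. sign h * (-1) ^ card (loops S v ?e))"
      unfolding sum_distrib_left by (intro sum.cong refl each)
    also have "\<dots> = 2 ^ card (loops S v ?e) * (sign h * (-1) ^ card (loops S v ?e))"
      by (simp add: card_alternating[OF v tw(1) S])
    also have "\<dots> = sign h * (-2) ^ card (loops S v ?e)"
      using power_mult_distrib[of "-1::int" 2 "card (loops S v ?e)"] by simp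
    finally show "sign h * (-2) ^ card (loops S v ?e)
      = \<zeta> * (\<Sum>U\<in>alternating S v ?e. (-1) ^ (card (A \<inter> U) + card (B \<inter> U)))" by simp
  qed
qed

section \<open>State sum of the Penrose evaluation\<close>

lemma card_permutations_preserving:
  assumes "finite T" "X \<subseteq> T"
  shows "card {p. p permutes T \<and> (\<forall>i\<in>T. p i \<in> X \<longleftrightarrow> i \<in> X)} = fact (card X) * fact (card T - card X)"
proof -
  have "bij_betw (\<lambda>(p, q). p \<circ> q) ({p. p permutes X} \<times> {q. q permutes (T - X)})
      {p. p permutes T \<and> (\<forall>i\<in>T. p i \<in> X \<longleftrightarrow> i \<in> X)}"
  proof (rule bij_betw_byWitness[where f' = "\<lambda>r. (\<lambda>x. if x \<in> X then r x else x, \<lambda>x. if x \<in> T - X then r x else x)"])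
    show "\<forall>z\<in>{p. p permutes X} \<times> {q. q permutes (T - X)}.
      (\<lambda>x. if x \<in> X then (case z of (p, q) \<Rightarrow> p \<circ> q) x else x, \<lambda>x. if x \<in> T - X then (case z of (p, q) \<Rightarrow> p \<circ> q) x else x) = z"
    proof
      fix z assume "z \<in> {p. p permutes X} \<times> {q. q permutes (T - X)}"
      then obtain p q where z: "z = (p, q)" and p: "p permutes X" and q: "q permutes (T - X)" by auto
      have "(\<lambda>x. if x \<in> X then p (q x) else x) = p"
        using permutes_not_in[OF q] permutes_not_in[OF p] by auto
      moreover have "(\<lambda>x. if x \<in> T - X then p (q x) else x) x = q x" for x
      proof (cases "x \<in> T - X")
        case True
        then have "q x \<in> T - X" using permutes_in_image[OF q] by blast
        then show ?thesis using True permutes_not_in[OF p, of "q x"] by simp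
      next
        case False
        then show ?thesis using permutes_not_in[OF q, of x] by auto
      qed
      ultimately have "(\<lambda>x. if x \<in> X then p (q x) else x) = p" "(\<lambda>x. if x \<in> T - X then p (q x) else x) = q"
        by (auto intro: ext)
      then show "(\<lambda>x. if x \<in> X then (case z of (p, q) \<Rightarrow> p \<circ> q) x else x, \<lambda>x. if x \<in> T - X then (case z of (p, q) \<Rightarrow> p \<circ> q) x else x) = z"
        unfolding z prod.case o_apply by (rule arg_cong2[where f=Pair])
    qed
    show "\<forall>r\<in>{p. p permutes T \<and> (\<forall>i\<in>T. p i \<in> X \<longleftrightarrow> i \<in> X)}.
      (case (\<lambda>x. if x \<in> X then r x else x, \<lambda>x. if x \<in> T - X then r x else x) of (p, q) \<Rightarrow> p \<circ> q) = r"
    proof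
      fix r assume r: "r \<in> {p. p permutes T \<and> (\<forall>i\<in>T. p i \<in> X \<longleftrightarrow> i \<in> X)}"
      then have "r permutes T" by simp
      then have "r x = x" if "x \<notin> T" for x using that by (rule permutes_not_in)
      then show "(case (\<lambda>x. if x \<in> X then r x else x, \<lambda>x. if x \<in> T - X then r x else x) of (p, q) \<Rightarrow> p \<circ> q) = r"
        using r assms(2) by (auto simp: fun_eq_iff)
    qed
    show "(\<lambda>(p, q). p \<circ> q) ` ({p. p permutes X} \<times> {q. q permutes (T - X)}) \<subseteq> {p. p permutes T \<and> (\<forall>i\<in>T. p i \<in> X \<longleftrightarrow> i \<in> X)}"
    proof (clarify, intro conjI ballI)
      fix p q assume p: "p permutes X" and q: "q permutes (T - X)"
      show "p \<circ> q permutes T"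
        by (rule permutes_compose) (use p q assms(2) in \<open>auto intro: permutes_subset\<close>)
      fix i assume "i \<in> T"
      show "(p \<circ> q) i \<in> X \<longleftrightarrow> i \<in> X"
        using permutes_in_image[OF p, of "q i"] permutes_in_image[OF q, of i] permutes_not_in[OF q, of i] \<open>i \<in> T\<close> by auto
    qed
    show "(\<lambda>r. (\<lambda>x. if x \<in> X then r x else x, \<lambda>x. if x \<in> T - X then r x else x)) `
      {p. p permutes T \<and> (\<forall>i\<in>T. p i \<in> X \<longleftrightarrow> i \<in> X)} \<subseteq> {p. p permutes X} \<times> {q. q permutes (T - X)}"
    proof (rule image_subsetI)
      fix r assume r: "r \<in> {p. p permutes T \<and> (\<forall>i\<in>T. p i \<in> X \<longleftrightarrow> i \<in> X)}"
      then have rT: "r permutes T" and rX: "\<And>i. i \<in> T \<Longrightarrow> r i \<in> X \<longleftrightarrow> i \<in> X" by auto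
      have inj: "inj_on r Z" for Z by (rule permutes_inj_on[OF rT])
      have "(\<lambda>x. if x \<in> X then r x else x) permutes X"
        using rX assms by (intro permutes_extend inj) (auto intro: finite_subset)
      moreover have "(\<lambda>x. if x \<in> T - X then r x else x) permutes (T - X)"
        using rX assms(1) permutes_in_image[OF rT] by (intro permutes_extend inj) auto
      ultimately show "(\<lambda>x. if x \<in> X then r x else x, \<lambda>x. if x \<in> T - X then r x else x) \<in> {p. p permutes X} \<times> {q. q permutes (T - X)}"
        by simp
    qed
  qed
  then have "card {p. p permutes T \<and> (\<forall>i\<in>T. p i \<in> X \<longleftrightarrow> i \<in> X)} = card ({p. p permutes X} \<times> {q. q permutes (T - X)})"
    by (rule bij_betw_same_card[symmetric])
  also have "\<dots> = fact (card X) * fact (card (T - X))"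
    unfolding card_cartesian_product using finite_subset[OF assms(2,1)] assms(1) by (simp add: card_permutations[OF refl])
  also have "card (T - X) = card T - card X" using assms by (meson card_Diff_subset finite_subset)
  finally show ?thesis .
qed

text \<open>The permutations that carry \<open>X\<close> onto \<open>Y\<close> form a coset of the
  stabiliser of \<open>X\<close>, if there are any.\<close>

lemma card_permutations_onto:
  assumes "finite T" "X \<subseteq> T" "Y \<subseteq> T"
  shows "card {p. p permutes T \<and> (\<forall>i\<in>T. p i \<in> Y \<longleftrightarrow> i \<in> X)}
    = (if card X = card Y then fact (card X) * fact (card T - card X) else 0)"
proof (cases "card X = card Y")
  case True
  have fin: "finite X" "finite Y" using assms finite_subset by blast+
  have "card (T - X) = card (T - Y)" using True fin assms by (simp add: card_Diff_subset)
  then obtain f g where f: "bij_betw f X Y" and g: "bij_betw g (T - X) (T - Y)"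
    using True fin assms(1) finite_same_card_bij[of X Y] finite_same_card_bij[of "T - X" "T - Y"] by auto
  define s where "s x = (if x \<in> T then if x \<in> X then f x else g x else x)" for x
  have fX: "f x \<in> Y" if "x \<in> X" for x using f that by (auto simp: bij_betw_def)
  have gX: "g x \<in> T - Y" if "x \<in> T - X" for x using g that by (auto simp: bij_betw_def)
  have s: "s permutes T" unfolding s_def
  proof (rule permutes_extend[OF assms(1)])
    show "inj_on (\<lambda>x. if x \<in> X then f x else g x) T"
    proof (rule inj_onI)
      fix x y assume "x \<in> T" "y \<in> T" "(if x \<in> X then f x else g x) = (if y \<in> X then f y else g y)"
      then show "x = y" using f g fX[of x] fX[of y] gX[of x] gX[of y]
        by (auto simp: bij_betw_def inj_on_def split: if_splits)
    qed
    show "(\<lambda>x. if x \<in> X then f x else g x) ` T \<subseteq> T" using fX gX assms by auto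
  qed
  have sX: "s x \<in> Y \<longleftrightarrow> x \<in> X" if "x \<in> T" for x using that fX[of x] gX[of x] by (auto simp: s_def)
  have "bij_betw (\<lambda>p. s \<circ> p) {p. p permutes T \<and> (\<forall>i\<in>T. p i \<in> X \<longleftrightarrow> i \<in> X)}
      {p. p permutes T \<and> (\<forall>i\<in>T. p i \<in> Y \<longleftrightarrow> i \<in> X)}"
  proof (rule bij_betw_byWitness[where f' = "\<lambda>p. inv s \<circ> p"])
    show "(\<lambda>p. s \<circ> p) ` {p. p permutes T \<and> (\<forall>i\<in>T. p i \<in> X \<longleftrightarrow> i \<in> X)} \<subseteq> {p. p permutes T \<and> (\<forall>i\<in>T. p i \<in> Y \<longleftrightarrow> i \<in> X)}"
      using s sX by (auto simp: permutes_compose permutes_in_image)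
    have "inv s i \<in> X \<longleftrightarrow> i \<in> Y" if "i \<in> T" for i
      using sX[of "inv s i"] permutes_in_image[OF permutes_inv[OF s], of i] that permutes_inverses(1)[OF s] by simp
    then show "(\<lambda>p. inv s \<circ> p) ` {p. p permutes T \<and> (\<forall>i\<in>T. p i \<in> Y \<longleftrightarrow> i \<in> X)} \<subseteq> {p. p permutes T \<and> (\<forall>i\<in>T. p i \<in> X \<longleftrightarrow> i \<in> X)}"
      using permutes_inv[OF s] by (auto simp: permutes_compose permutes_in_image)
  qed (auto simp: fun_eq_iff permutes_inverses[OF s])
  then have "card {p. p permutes T \<and> (\<forall>i\<in>T. p i \<in> Y \<longleftrightarrow> i \<in> X)} = card {p. p permutes T \<and> (\<forall>i\<in>T. p i \<in> X \<longleftrightarrow> i \<in> X)}"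
    by (rule bij_betw_same_card[symmetric])
  then show ?thesis using True card_permutations_preserving[OF assms(1,2)] by simp
next
  case False
  have "card X = card Y" if p: "p permutes T" "\<forall>i\<in>T. p i \<in> Y \<longleftrightarrow> i \<in> X" for p
  proof -
    have "p ` X = Y"
    proof
      show "p ` X \<subseteq> Y" using p assms by auto
      show "Y \<subseteq> p ` X"
      proof
        fix y assume y: "y \<in> Y"
        have T: "inv p y \<in> T" using permutes_in_image[OF permutes_inv[OF p(1)], of y] y assms by blast
        have py: "p (inv p y) = y" using permutes_inverses(1)[OF p(1)] .
        have "inv p y \<in> X" using bspec[OF p(2) T] y unfolding py by blast
        then show "y \<in> p ` X" by (rule image_eqI[where f = p, OF py[symmetric]])
      qed
    qed
    moreover have "card (p ` X) = card X" by (rule card_image, rule permutes_inj_on[OF p(1)])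
    ultimately show ?thesis by simp
  qed
  then have "{p. p permutes T \<and> (\<forall>i\<in>T. p i \<in> Y \<longleftrightarrow> i \<in> X)} = {}" using False by auto
  then show ?thesis using False by (simp only: card.empty if_False)
qed

text \<open>Gathers the permutations of all edges into one permutation of strand points, whose sign
  is the product of the individual signs; it serves as the single \<open>h\<close> of
  \<open>signed_loop_expansion\<close>.\<close>

definition fibrewise :: "('d \<Rightarrow> nat \<Rightarrow> nat) \<Rightarrow> 'd \<times> nat \<Rightarrow> 'd \<times> nat" where
  "fibrewise P x = (fst x, P (fst x) (snd x))"

lemma sign_fibre:
  assumes "p permutes {..<m::nat}"
  shows "permutation (fibrewise ((\<lambda>_. id)(d := p))) \<and> sign (fibrewise ((\<lambda>_. id)(d := p))) = sign p"
  using assms finite_lessThan[of m]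
proof (induction p rule: permutes_induct)
  case id
  have e: "fibrewise ((\<lambda>_. id)(d := id)) = id" by (auto simp: fibrewise_def fun_eq_iff)
  show ?case unfolding e by simp
next
  case (swap a b p)
  have eq: "fibrewise ((\<lambda>_. id)(d := Transposition.transpose a b \<circ> p)) = Transposition.transpose (d, a) (d, b) \<circ> fibrewise ((\<lambda>_. id)(d := p))"
    by (auto simp: fibrewise_def fun_eq_iff Transposition.transpose_def)
  have IH: "permutation (fibrewise ((\<lambda>_. id)(d := p)))" "sign (fibrewise ((\<lambda>_. id)(d := p))) = sign p"
    using swap(5) by blast+
  have "permutation p" using swap(4) by (auto simp: permutation_permutes)
  then have s1: "sign (Transposition.transpose a b \<circ> p) = (if a = b then 1 else -1) * sign p"
    by (simp only: sign_compose[OF permutation_swap_id] sign_swap_id)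
  have s2: "sign (Transposition.transpose (d, a) (d, b) \<circ> fibrewise ((\<lambda>_. id)(d := p))) = (if a = b then 1 else -1) * sign p"
    by (simp only: sign_compose[OF permutation_swap_id IH(1)] sign_swap_id IH(2)) simp
  show ?case unfolding eq
    by (rule conjI[OF permutation_compose[OF permutation_swap_id IH(1)]]) (simp only: s1 s2)
qed

lemma sign_fibrewise:
  assumes "finite K" "\<And>d. d \<in> K \<Longrightarrow> P d permutes {..<m::nat}" "\<And>d. d \<notin> K \<Longrightarrow> P d = id"
  shows "permutation (fibrewise P) \<and> sign (fibrewise P) = (\<Prod>d\<in>K. sign (P d))"
  using assms
proof (induction K arbitrary: P rule: finite_induct)
  case empty
  then have e: "fibrewise P = id" by (auto simp: fibrewise_def fun_eq_iff)
  show ?case unfolding e by simp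
next
  case (insert d K)
  have IH: "permutation (fibrewise (P(d := id)))" "sign (fibrewise (P(d := id))) = (\<Prod>d'\<in>K. sign ((P(d := id)) d'))"
  proof -
    have "(P(d := id)) d' permutes {..<m}" if "d' \<in> K" for d'
      using insert.prems(1)[of d'] that insert.hyps by auto
    moreover have "(P(d := id)) d' = id" if "d' \<notin> K" for d'
      using insert.prems(2)[of d'] that by (cases "d' = d") auto
    ultimately have "permutation (fibrewise (P(d := id))) \<and> sign (fibrewise (P(d := id))) = (\<Prod>d'\<in>K. sign ((P(d := id)) d'))"
      by (rule insert.IH)
    then show "permutation (fibrewise (P(d := id)))" "sign (fibrewise (P(d := id))) = (\<Prod>d'\<in>K. sign ((P(d := id)) d'))"
      by blast+
  qed
  have sf: "permutation (fibrewise ((\<lambda>_. id)(d := P d)))" "sign (fibrewise ((\<lambda>_. id)(d := P d))) = sign (P d)"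
    using sign_fibre[of "P d" m d] insert.prems(1)[of d] by blast+
  have eq: "fibrewise P = fibrewise ((\<lambda>_. id)(d := P d)) \<circ> fibrewise (P(d := id))"
    by (auto simp: fibrewise_def fun_eq_iff)
  have pr: "(\<Prod>d'\<in>K. sign ((P(d := id)) d')) = (\<Prod>d'\<in>K. sign (P d'))"
    using insert.hyps by (intro prod.cong) auto
  show ?case unfolding eq
    by (rule conjI[OF permutation_compose[OF sf(1) IH(1)]])
       (simp only: sign_compose[OF sf(1) IH(1)] IH(2) sf(2) pr prod.insert[OF insert.hyps])
qed

text \<open>Groups the families of subsets by their cardinalities. The binomial coefficients of the
  3j-symbols originate here, from the choice of the arcs in each corner.\<close>

lemma sum_card_functions:
  assumes "finite D" "finite T"
  shows "(\<Sum>Y\<in>(\<Pi>\<^sub>E d\<in>D. Pow T). f (\<lambda>d\<in>D. card (Y d))) = (\<Sum>k\<in>(\<Pi>\<^sub>E d\<in>D. {..card T}). of_nat (\<Prod>d\<in>D. card T choose k d) * (f k :: 'b::comm_ring_1))"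
proof -
  let ?c = "\<lambda>Y. \<lambda>d\<in>D. card (Y d)"
  have img: "?c ` (\<Pi>\<^sub>E d\<in>D. Pow T) \<subseteq> (\<Pi>\<^sub>E d\<in>D. {..card T})"
  proof (rule image_subsetI)
    fix Y assume Y: "Y \<in> (\<Pi>\<^sub>E d\<in>D. Pow T)"
    have "card (Y d) \<le> card T" if "d \<in> D" for d
      using PiE_mem[OF Y that] by (intro card_mono assms(2)) auto
    then show "?c Y \<in> (\<Pi>\<^sub>E d\<in>D. {..card T})" by auto
  qed
  have "(\<Sum>Y\<in>(\<Pi>\<^sub>E d\<in>D. Pow T). f (?c Y)) = (\<Sum>k\<in>(\<Pi>\<^sub>E d\<in>D. {..card T}). \<Sum>Y\<in>{Y \<in> (\<Pi>\<^sub>E d\<in>D. Pow T). ?c Y = k}. f (?c Y))"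
    using assms img by (intro sum.group[symmetric]) (auto intro!: finite_PiE)
  also have "\<dots> = (\<Sum>k\<in>(\<Pi>\<^sub>E d\<in>D. {..card T}). of_nat (\<Prod>d\<in>D. card T choose k d) * f k)"
  proof (intro sum.cong refl)
    fix k assume k: "k \<in> (\<Pi>\<^sub>E d\<in>D. {..card T})"
    have "{Y \<in> (\<Pi>\<^sub>E d\<in>D. Pow T). ?c Y = k} = (\<Pi>\<^sub>E d\<in>D. {Z. Z \<subseteq> T \<and> card Z = k d})"
    proof (intro set_eqI iffI)
      fix Y assume "Y \<in> {Y \<in> (\<Pi>\<^sub>E d\<in>D. Pow T). ?c Y = k}"
      then have "Y \<in> (\<Pi>\<^sub>E d\<in>D. Pow T)" "\<And>d. d \<in> D \<Longrightarrow> card (Y d) = k d" by (auto dest: fun_cong)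
      then show "Y \<in> (\<Pi>\<^sub>E d\<in>D. {Z. Z \<subseteq> T \<and> card Z = k d})" by (auto simp: PiE_iff)
    next
      fix Y assume Y: "Y \<in> (\<Pi>\<^sub>E d\<in>D. {Z. Z \<subseteq> T \<and> card Z = k d})"
      then have "?c Y = k" using k by (auto simp: PiE_iff fun_eq_iff extensional_def)
      then show "Y \<in> {Y \<in> (\<Pi>\<^sub>E d\<in>D. Pow T). ?c Y = k}" using Y by (auto simp: PiE_iff)
    qed
    then have "card {Y \<in> (\<Pi>\<^sub>E d\<in>D. Pow T). ?c Y = k} = (\<Prod>d\<in>D. card T choose k d)"
      using assms by (simp add: card_PiE n_subsets)
    then show "(\<Sum>Y\<in>{Y \<in> (\<Pi>\<^sub>E d\<in>D. Pow T). ?c Y = k}. f (?c Y)) = of_nat (\<Prod>d\<in>D. card T choose k d) * f k"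
      by simp
  qed
  finally show ?thesis .
qed

section \<open>Networks in which every edge carries \<open>2*n\<close> strands\<close>

lemma loops_cong:
  assumes "\<And>x. x \<in> S \<Longrightarrow> e x = e' x"
  shows "loops S v e = loops S v e'"
proof -
  have "{(x, e x) | x. x \<in> S} = {(x, e' x) | x. x \<in> S}" using assms by auto
  then show ?thesis unfolding loops_def loop_rel_def by (simp only:)
qed

text \<open>The decoration is written \<open>n * 2\<close> because this is the form that
  \<open>n * g d\<close> takes in \<open>spectral_radius_sn\<close> for the constant decoration
  2.\<close>

locale uniform_network =
  fixes D :: "'d::linorder set" and alpha rot :: "'d \<Rightarrow> 'd" and n :: nat
  assumes finite_D: "finite D"
    and alphaD: "d \<in> D \<Longrightarrow> alpha d \<in> D" "d \<in> D \<Longrightarrow> alpha d \<noteq> d" "d \<in> D \<Longrightarrow> alpha (alpha d) = d"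
    and rotD: "d \<in> D \<Longrightarrow> rot d \<in> D" "d \<in> D \<Longrightarrow> rot (rot (rot d)) = d"
begin

abbreviation (input) "g \<equiv> \<lambda>d::'d. n * 2"
abbreviation "reps \<equiv> edge_reps D alpha"
abbreviation "S \<equiv> strand_pts D g"
abbreviation "v \<equiv> vmatch rot g"
abbreviation "e \<equiv> ematch alpha g (\<lambda>_. id)"

lemma mem_S: "x \<in> S \<longleftrightarrow> fst x \<in> D \<and> snd x < n * 2"
  by (cases x) (simp add: strand_pts_def)

lemma finite_S: "finite S"
proof -
  have "S = D \<times> {..<n * 2}" by (auto simp: strand_pts_def)
  then show ?thesis using finite_D by simp
qed

lemma reps_sub: "reps \<subseteq> D" and finite_reps: "finite reps"
  using finite_D by (auto simp: edge_reps_def)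

lemma alpha_reps: "d \<in> D \<Longrightarrow> alpha d \<in> reps \<longleftrightarrow> d \<notin> reps"
  using alphaD[of d] by (auto simp: edge_reps_def)

lemma v_eq: "v (d, i) = (if n \<le> i then (rot d, n * 2 - 1 - i) else (rot (rot d), n * 2 - 1 - i))"
  by (simp add: vmatch_def corner_def)

lemma matching_v: "matching S v"
  unfolding matching_def
proof
  fix x assume "x \<in> S"
  then obtain d i where x: "x = (d, i)" "d \<in> D" "i < n * 2" by (cases x) (simp add: mem_S)
  \<comment> \<open>By parity, mirroring the position moves every point, whatever \<open>rot\<close>
    does to the dart.\<close>
  have ne: "n * 2 - 1 - i \<noteq> i" using x(3) by presburger
  show "v x \<in> S \<and> v x \<noteq> x \<and> v (v x) = x"
  proof (cases "n \<le> i")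
    case True
    then have vx: "v x = (rot d, n * 2 - 1 - i)" by (simp add: x v_eq)
    have "\<not> n \<le> n * 2 - 1 - i" using True x(3) by simp
    then have "v (v x) = (rot (rot (rot d)), n * 2 - 1 - (n * 2 - 1 - i))" unfolding vx by (simp add: v_eq)
    then show ?thesis using vx ne x rotD by (simp add: mem_S)
  next
    case False
    then have vx: "v x = (rot (rot d), n * 2 - 1 - i)" by (simp add: x v_eq)
    have "n \<le> n * 2 - 1 - i" using False x(3) by simp
    then have "v (v x) = (rot (rot (rot d)), n * 2 - 1 - (n * 2 - 1 - i))" unfolding vx by (simp add: v_eq)
    then show ?thesis using vx ne x rotD by (simp add: mem_S)
  qed
qed

lemma e_eq: "e (d, i) = (alpha d, n * 2 - 1 - i)"
  by (simp add: ematch_def)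

lemma matching_e: "matching S e"
  unfolding matching_def
proof
  fix x assume "x \<in> S"
  then obtain d i where x: "x = (d, i)" "d \<in> D" "i < n * 2" by (cases x) (simp add: mem_S)
  then show "e x \<in> S \<and> e x \<noteq> x \<and> e (e x) = x" using alphaD by (simp add: mem_S e_eq)
qed

text \<open>\<open>A\<close> marks one end of every corner arc, the one on the dart \<open>d\<close>
  of the corner between \<open>d\<close> and \<open>rot d\<close>. \<open>B\<close>, defined next,
  marks the end of every strand at which the permutations are inserted.\<close>

definition "A = {x \<in> S. n \<le> snd x}"
definition "B = {x \<in> S. fst x \<in> reps}"

lemma transversal_A: "transversal S v A"
  unfolding transversal_def
proof (intro conjI ballI)
  fix x assume xS: "x \<in> S"
  then obtain d i where x: "x = (d, i)" "i < n * 2" by (cases x) (simp add: mem_S)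
  have "v x \<in> S" by (rule matchingD(1)[OF matching_v xS])
  then show "v x \<in> A \<longleftrightarrow> x \<notin> A" using xS x by (auto simp: A_def v_eq)
qed (auto simp: A_def)

lemma transversal_B: "transversal S e B"
  unfolding transversal_def
proof (intro conjI ballI)
  fix x assume xS: "x \<in> S"
  then obtain d i where x: "x = (d, i)" "d \<in> D" by (cases x) (simp add: mem_S)
  have "e x \<in> S" by (rule matchingD(1)[OF matching_e xS])
  then show "e x \<in> B \<longleftrightarrow> x \<notin> B" using xS x alpha_reps[OF x(2)] by (auto simp: B_def e_eq)
qed (auto simp: B_def)

lemma permsD:
  assumes "P \<in> perm_assignments D alpha g"
  shows "\<And>d. d \<in> reps \<Longrightarrow> P d permutes {..<n * 2}" "\<And>d. d \<notin> reps \<Longrightarrow> P d = id"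
  using assms by (auto simp: perm_assignments_def)

lemma permutes_all:
  assumes "P \<in> perm_assignments D alpha g"
  shows "P d permutes {..<n * 2}"
  using permsD[OF assms, of d] by (cases "d \<in> reps") (auto simp: permutes_id)

lemma fibrewise_inverse:
  assumes P: "P \<in> perm_assignments D alpha g"
  shows "inv (fibrewise P) = fibrewise (\<lambda>d. inv (P d))"
  by (rule inv_unique_comp) (auto simp: fibrewise_def fun_eq_iff permutes_inverses[OF permutes_all[OF P]])

lemma fibrewise_permutes:
  assumes P: "P \<in> perm_assignments D alpha g"
  shows "fibrewise P permutes B"
proof (rule bij_imp_permutes)
  have in1: "fibrewise P x \<in> B" if "x \<in> B" for x
    using that permutes_in_image[OF permutes_all[OF P], of "fst x" "snd x"] by (simp add: B_def mem_S fibrewise_def)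
  have in2: "fibrewise (\<lambda>d. inv (P d)) x \<in> B" if "x \<in> B" for x
    using that permutes_in_image[OF permutes_inv[OF permutes_all[OF P]], of "fst x" "snd x"] by (simp add: B_def mem_S fibrewise_def)
  show "bij_betw (fibrewise P) B B"
    by (rule bij_betw_byWitness[where f' = "fibrewise (\<lambda>d. inv (P d))"])
       (use in1 in2 in \<open>auto simp: fibrewise_def permutes_inverses[OF permutes_all[OF P]]\<close>)
next
  fix x assume x: "x \<notin> B"
  show "fibrewise P x = x"
  proof (cases "fst x \<in> reps")
    case True
    then have "snd x \<notin> {..<n * 2}" using x reps_sub by (auto simp: B_def mem_S)
    then show ?thesis using permutes_not_in[OF permutes_all[OF P]] by (simp add: fibrewise_def)
  next
    case False
    then show ?thesis using permsD(2)[OF P] by (simp add: fibrewise_def)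
  qed
qed

lemma ematch_twist:
  assumes P: "P \<in> perm_assignments D alpha g" and x: "x \<in> S"
  shows "ematch alpha g P x = twist B e (fibrewise P) x"
proof -
  obtain d i where d: "x = (d, i)" "d \<in> D" using x by (cases x) (simp add: mem_S)
  show ?thesis
  proof (cases "d \<in> reps")
    case True
    then have "d \<le> alpha d" by (simp add: edge_reps_def)
    then show ?thesis using True x d by (simp add: twist_def B_def ematch_def fibrewise_def)
  next
    case False
    then have "\<not> d \<le> alpha d" using d by (simp add: edge_reps_def)
    then show ?thesis using False d unfolding twist_def fibrewise_inverse[OF P]
      by (simp add: B_def ematch_def fibrewise_def)
  qed
qed

definition strands :: "('d \<times> nat) set \<Rightarrow> 'd \<Rightarrow> nat set" where
  "strands U d = {i. i < n * 2 \<and> (d, i) \<in> U}"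

definition edge_factor :: "nat \<Rightarrow> nat \<Rightarrow> nat" where
  "edge_factor m m' = (if m + m' = n * 2 then fact m * fact (n * 2 - m) else 0)"

text \<open>The condition decouples over the edges: \<open>P d\<close> must carry the ones on the
  dart \<open>d\<close> exactly to the positions that face zeros on \<open>alpha d\<close>.\<close>

lemma transversal_twist:
  assumes P: "P \<in> perm_assignments D alpha g" and U: "U \<subseteq> S"
  shows "transversal S (twist B e (fibrewise P)) U \<longleftrightarrow>
    (\<forall>d\<in>reps. \<forall>i\<in>{..<n * 2}. P d i \<in> {j. j < n * 2 \<and> (alpha d, n * 2 - 1 - j) \<notin> U} \<longleftrightarrow> i \<in> strands U d)"
proof -
  let ?t = "twist B e (fibrewise P)"
  note tw = twist_matching[OF matching_e transversal_B fibrewise_permutes[OF P]]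
  have "transversal S ?t U \<longleftrightarrow> (\<forall>x\<in>B. ?t x \<in> U \<longleftrightarrow> x \<notin> U)"
  proof
    assume "transversal S ?t U"
    then show "\<forall>x\<in>B. ?t x \<in> U \<longleftrightarrow> x \<notin> U" by (auto simp: transversal_def B_def)
  next
    assume *: "\<forall>x\<in>B. ?t x \<in> U \<longleftrightarrow> x \<notin> U"
    show "transversal S ?t U" unfolding transversal_def
    proof (intro conjI ballI U)
      fix x assume x: "x \<in> S"
      show "?t x \<in> U \<longleftrightarrow> x \<notin> U"
      proof (cases "x \<in> B")
        case False
        then have "?t x \<in> B" using tw(2) x by (simp add: transversal_def)
        then show ?thesis using bspec[OF *] matchingD(3)[OF tw(1) x] by metis
      qed (use * in blast)
    qed
  qed
  also have "\<dots> \<longleftrightarrow> (\<forall>d\<in>reps. \<forall>i\<in>{..<n * 2}. (alpha d, n * 2 - 1 - P d i) \<in> U \<longleftrightarrow> (d, i) \<notin> U)"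
  proof -
    have "B = reps \<times> {..<n * 2}" using reps_sub by (auto simp: B_def mem_S)
    moreover have "?t (d, i) = (alpha d, n * 2 - 1 - P d i)" if "(d, i) \<in> B" for d i
      using that by (simp add: twist_def fibrewise_def ematch_def)
    ultimately show ?thesis by auto
  qed
  also have "\<dots> \<longleftrightarrow> (\<forall>d\<in>reps. \<forall>i\<in>{..<n * 2}. P d i \<in> {j. j < n * 2 \<and> (alpha d, n * 2 - 1 - j) \<notin> U} \<longleftrightarrow> i \<in> strands U d)"
  proof (intro ball_cong refl)
    fix d i assume "d \<in> reps" "i \<in> {..<n * 2}"
    then have "P d i < n * 2" using permutes_in_image[OF permutes_all[OF P], of d i] by simp
    then show "((alpha d, n * 2 - 1 - P d i) \<in> U \<longleftrightarrow> (d, i) \<notin> U) = (P d i \<in> {j. j < n * 2 \<and> (alpha d, n * 2 - 1 - j) \<notin> U} \<longleftrightarrow> i \<in> strands U d)"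
      using \<open>i \<in> {..<n * 2}\<close> by (auto simp: strands_def)
  qed
  finally show ?thesis .
qed

lemma card_strands_le: "card (strands U d) \<le> n * 2"
proof -
  have "strands U d \<subseteq> {..<n * 2}" by (auto simp: strands_def)
  then show ?thesis using card_mono[of "{..<n * 2}"] by fastforce
qed

text \<open>On each edge independently, the permutation has a prescribed image of a prescribed set,
  which is possible only if there are as many ones at one end as zeros at the other.\<close>

lemma card_perms_alternating:
  assumes U: "U \<subseteq> S"
  shows "card {P \<in> perm_assignments D alpha g. transversal S (twist B e (fibrewise P)) U}
    = (\<Prod>d\<in>reps. edge_factor (card (strands U d)) (card (strands U (alpha d))))"
proof -
  let ?T = "{..<n * 2}"
  define Y where "Y d = {j. j < n * 2 \<and> (alpha d, n * 2 - 1 - j) \<notin> U}" for d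
  define C where "C d = {p. p permutes ?T \<and> (\<forall>i\<in>?T. p i \<in> Y d \<longleftrightarrow> i \<in> strands U d)}" for d
  have cardY: "card (Y d) = n * 2 - card (strands U (alpha d))" for d
  proof -
    have "bij_betw (\<lambda>j. n * 2 - 1 - j) (Y d) (?T - strands U (alpha d))"
      by (rule bij_betw_byWitness[where f' = "\<lambda>j. n * 2 - 1 - j"]) (auto simp: Y_def strands_def)
    then have "card (Y d) = card (?T - strands U (alpha d))" by (rule bij_betw_same_card)
    also have "\<dots> = card ?T - card (strands U (alpha d))"
      by (rule card_Diff_subset) (auto simp: strands_def intro: finite_subset[of _ ?T])
    finally show ?thesis by simp
  qed
  have cardC: "card (C d) = edge_factor (card (strands U d)) (card (strands U (alpha d)))" for d
  proof -
    have "card (C d) = (if card (strands U d) = card (Y d) then fact (card (strands U d)) * fact (card ?T - card (strands U d)) else 0)"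
      unfolding C_def by (rule card_permutations_onto) (auto simp: strands_def Y_def)
    then show ?thesis using card_strands_le[of U d] card_strands_le[of U "alpha d"]
      by (auto simp: cardY edge_factor_def)
  qed
  have "bij_betw (\<lambda>P. restrict P reps) {P \<in> perm_assignments D alpha g. transversal S (twist B e (fibrewise P)) U} (\<Pi>\<^sub>E d\<in>reps. C d)"
  proof (rule bij_betw_byWitness[where f' = "\<lambda>f d. if d \<in> reps then f d else id"])
    have ch: "P \<in> perm_assignments D alpha g \<and> transversal S (twist B e (fibrewise P)) U \<longleftrightarrow>
      (\<forall>d\<in>reps. P d \<in> C d) \<and> (\<forall>d. d \<notin> reps \<longrightarrow> P d = id)" for P
    proof (cases "P \<in> perm_assignments D alpha g")
      case True
      then show ?thesis using transversal_twist[OF True U] permsD[OF True] unfolding C_def Y_def by blast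
    next
      case False
      then show ?thesis unfolding C_def perm_assignments_def by blast
    qed
    show "\<forall>P\<in>{P \<in> perm_assignments D alpha g. transversal S (twist B e (fibrewise P)) U}. (\<lambda>d. if d \<in> reps then restrict P reps d else id) = P"
      using ch by (auto simp: fun_eq_iff)
    show "\<forall>f\<in>\<Pi>\<^sub>E d\<in>reps. C d. restrict (\<lambda>d. if d \<in> reps then f d else id) reps = f"
      by (auto simp: fun_eq_iff PiE_iff extensional_def)
    show "(\<lambda>P. restrict P reps) ` {P \<in> perm_assignments D alpha g. transversal S (twist B e (fibrewise P)) U} \<subseteq> (\<Pi>\<^sub>E d\<in>reps. C d)"
      using ch by auto
    show "(\<lambda>f d. if d \<in> reps then f d else id) ` (\<Pi>\<^sub>E d\<in>reps. C d) \<subseteq> {P \<in> perm_assignments D alpha g. transversal S (twist B e (fibrewise P)) U}"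
      using ch by (auto simp: PiE_iff)
  qed
  then have "card {P \<in> perm_assignments D alpha g. transversal S (twist B e (fibrewise P)) U} = card (\<Pi>\<^sub>E d\<in>reps. C d)"
    by (rule bij_betw_same_card)
  also have "\<dots> = (\<Prod>d\<in>reps. card (C d))" by (rule card_PiE[OF finite_reps])
  finally show ?thesis by (simp only: cardC)
qed

lemma finite_perms: "finite (perm_assignments D alpha g)"
proof -
  have "perm_assignments D alpha g \<subseteq> (\<lambda>f d. if d \<in> reps then f d else id) ` (\<Pi>\<^sub>E d\<in>reps. {p. p permutes {..<n * 2}})"
  proof
    fix P assume P: "P \<in> perm_assignments D alpha g"
    then have "P = (\<lambda>d. if d \<in> reps then restrict P reps d else id)" by (auto simp: perm_assignments_def fun_eq_iff)
    moreover have "restrict P reps \<in> (\<Pi>\<^sub>E d\<in>reps. {p. p permutes {..<n * 2}})" using permsD[OF P] by auto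
    ultimately show "P \<in> (\<lambda>f d. if d \<in> reps then f d else id) ` (\<Pi>\<^sub>E d\<in>reps. {p. p permutes {..<n * 2}})"
      by (rule image_eqI)
  qed
  moreover have "finite (\<Pi>\<^sub>E d\<in>reps. {p. p permutes {..<n * 2}})"
    by (intro finite_PiE finite_reps finite_permutations) simp
  ultimately show ?thesis using finite_surj by blast
qed

text \<open>The sums over permutations and labellings are interchanged. Signs depend on the
  labelling \<open>U\<close> alone, so the inner sum merely counts the permutations compatible with
  \<open>U\<close>.\<close>

lemma penrose_transversal_sum:
  obtains \<zeta> :: int where "\<bar>\<zeta>\<bar> = 1"
    "penrose_eval D alpha rot g = \<zeta> * (\<Sum>U | transversal S v U.
       (-1) ^ (card (A \<inter> U) + card (B \<inter> U)) * int (\<Prod>d\<in>reps. edge_factor (card (strands U d)) (card (strands U (alpha d)))))"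
proof -
  obtain \<zeta> :: int where z: "\<bar>\<zeta>\<bar> = 1"
    "\<And>h. h permutes B \<Longrightarrow> sign h * (-2) ^ card (loops S v (twist B e h))
      = \<zeta> * (\<Sum>U\<in>alternating S v (twist B e h). (-1) ^ (card (A \<inter> U) + card (B \<inter> U)))"
    using signed_loop_expansion[OF matching_v matching_e finite_S transversal_A transversal_B] by blast
  let ?Ps = "perm_assignments D alpha g" and ?Us = "{U. transversal S v U}"
  have finU: "finite ?Us" by (rule finite_subset[of _ "Pow S"]) (auto simp: transversal_def finite_S)
  have "penrose_eval D alpha rot g = (\<Sum>P\<in>?Ps. (\<Prod>d\<in>reps. sign (P d)) * (-2) ^ num_curves D alpha rot g P)"
    by (simp add: penrose_eval_def)
  also have "\<dots> = (\<Sum>P\<in>?Ps. \<zeta> * (\<Sum>U\<in>alternating S v (twist B e (fibrewise P)). (-1) ^ (card (A \<inter> U) + card (B \<inter> U))))"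
  proof (intro sum.cong refl)
    fix P assume P: "P \<in> ?Ps"
    have "num_curves D alpha rot g P = card (loops S v (ematch alpha g P))"
      by (simp add: num_curves_def loops_def loop_rel_def Let_def)
    also have "\<dots> = card (loops S v (twist B e (fibrewise P)))"
      by (rule arg_cong[where f = card], rule loops_cong) (rule ematch_twist[OF P])
    finally have "num_curves D alpha rot g P = card (loops S v (twist B e (fibrewise P)))" .
    moreover have "sign (fibrewise P) = (\<Prod>d\<in>reps. sign (P d))"
      using sign_fibrewise[OF finite_reps, of P "n * 2"] permsD[OF P] by blast
    ultimately show "(\<Prod>d\<in>reps. sign (P d)) * (-2) ^ num_curves D alpha rot g P
        = \<zeta> * (\<Sum>U\<in>alternating S v (twist B e (fibrewise P)). (-1) ^ (card (A \<inter> U) + card (B \<inter> U)))"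
      using z(2)[OF fibrewise_permutes[OF P]] by (simp only:)
  qed
  also have "\<dots> = \<zeta> * (\<Sum>P\<in>?Ps. \<Sum>U\<in>?Us. if transversal S (twist B e (fibrewise P)) U then (-1) ^ (card (A \<inter> U) + card (B \<inter> U)) else 0)"
    unfolding sum_distrib_left[symmetric] alternating_def
    using finU by (intro arg_cong[where f = "\<lambda>x. \<zeta> * x"] sum.cong refl sum.mono_neutral_cong_left) auto
  also have "\<dots> = \<zeta> * (\<Sum>U\<in>?Us. \<Sum>P\<in>?Ps. if transversal S (twist B e (fibrewise P)) U then (-1) ^ (card (A \<inter> U) + card (B \<inter> U)) else 0)"
    by (subst sum.swap) (rule refl)
  also have "\<dots> = \<zeta> * (\<Sum>U\<in>?Us. (-1) ^ (card (A \<inter> U) + card (B \<inter> U)) * int (\<Prod>d\<in>reps. edge_factor (card (strands U d)) (card (strands U (alpha d)))))"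
  proof (intro arg_cong[where f = "\<lambda>x. \<zeta> * x"] sum.cong refl)
    fix U assume "U \<in> ?Us"
    then have U: "U \<subseteq> S" by (simp add: transversal_def)
    have "(\<Sum>P\<in>?Ps. if transversal S (twist B e (fibrewise P)) U then (-1) ^ (card (A \<inter> U) + card (B \<inter> U)) else 0 :: int)
      = (\<Sum>P\<in>{P \<in> ?Ps. transversal S (twist B e (fibrewise P)) U}. (-1) ^ (card (A \<inter> U) + card (B \<inter> U)))"
      by (rule sum.inter_filter[OF finite_perms, symmetric])
    then show "(\<Sum>P\<in>?Ps. if transversal S (twist B e (fibrewise P)) U then (-1) ^ (card (A \<inter> U) + card (B \<inter> U)) else 0)
      = (-1) ^ (card (A \<inter> U) + card (B \<inter> U)) * int (\<Prod>d\<in>reps. edge_factor (card (strands U d)) (card (strands U (alpha d))))"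
      using card_perms_alternating[OF U] by (simp add: mult.commute)
  qed
  finally show thesis by (rule that[OF z(1)])
qed

end

section \<open>From labelled strand points to counts of ones per corner\<close>

context uniform_network begin

text \<open>Arc \<open>j\<close> in the corner of \<open>d\<close> joins \<open>(d, n + j)\<close>
  to \<open>(rot d, n - 1 - j)\<close>, and \<open>j \<in> Y d\<close> means that its one sits at
  the former end. Positions below \<open>n\<close> on \<open>d\<close> belong to the preceding
  corner, that of \<open>rot (rot d)\<close>.\<close>

definition arcs_to_ones :: "('d \<Rightarrow> nat set) \<Rightarrow> ('d \<times> nat) set" where
  "arcs_to_ones Y = {x \<in> S. if n \<le> snd x then snd x - n \<in> Y (fst x) else n - 1 - snd x \<notin> Y (rot (rot (fst x)))}"

lemma arcs_to_ones_iff: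
  assumes "d \<in> D"
  shows "j < n \<Longrightarrow> (d, n + j) \<in> arcs_to_ones Y \<longleftrightarrow> j \<in> Y d"
    "j < n \<Longrightarrow> (d, j) \<in> arcs_to_ones Y \<longleftrightarrow> n - 1 - j \<notin> Y (rot (rot d))"
  using assms by (auto simp: arcs_to_ones_def mem_S)

lemma bij_betw_arcs_to_ones: "bij_betw arcs_to_ones (\<Pi>\<^sub>E d\<in>D. Pow {..<n}) {U. transversal S v U}"
proof (rule bij_betw_byWitness[where f' = "\<lambda>U. \<lambda>d\<in>D. {j. j < n \<and> (d, n + j) \<in> U}"])
  show "\<forall>Y\<in>\<Pi>\<^sub>E d\<in>D. Pow {..<n}. (\<lambda>d\<in>D. {j. j < n \<and> (d, n + j) \<in> arcs_to_ones Y}) = Y"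
  proof (intro ballI ext)
    fix Y d assume Y: "Y \<in> (\<Pi>\<^sub>E d\<in>D. Pow {..<n})"
    show "(\<lambda>d\<in>D. {j. j < n \<and> (d, n + j) \<in> arcs_to_ones Y}) d = Y d"
    proof (cases "d \<in> D")
      case True
      then have "Y d \<subseteq> {..<n}" using PiE_mem[OF Y True] by simp
      then show ?thesis using True arcs_to_ones_iff(1)[OF True] by auto
    next
      case False
      then show ?thesis using PiE_arb[OF Y False] by simp
    qed
  qed
  show "\<forall>U\<in>{U. transversal S v U}. arcs_to_ones (\<lambda>d\<in>D. {j. j < n \<and> (d, n + j) \<in> U}) = U"
  proof (intro ballI)
    fix U assume "U \<in> {U. transversal S v U}"
    then have US: "U \<subseteq> S" and vU: "\<And>x. x \<in> S \<Longrightarrow> v x \<in> U \<longleftrightarrow> x \<notin> U" by (auto simp: transversal_def)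
    show "arcs_to_ones (\<lambda>d\<in>D. {j. j < n \<and> (d, n + j) \<in> U}) = U"
    proof (intro set_eqI)
      fix x :: "'d \<times> nat"
      obtain d i where x: "x = (d, i)" by (cases x)
      show "x \<in> arcs_to_ones (\<lambda>d\<in>D. {j. j < n \<and> (d, n + j) \<in> U}) \<longleftrightarrow> x \<in> U"
      proof (cases "x \<in> S")
        case True
        then have d: "d \<in> D" "i < n * 2" "rot (rot d) \<in> D" using x rotD by (auto simp: mem_S)
        show ?thesis
        proof (cases "n \<le> i")
          case True
          then show ?thesis using d x by (auto simp: arcs_to_ones_def mem_S)
        next
          case False
          then have "v x = (rot (rot d), n + (n - 1 - i))" unfolding x by (simp add: v_eq)
          then have "(rot (rot d), n + (n - 1 - i)) \<in> U \<longleftrightarrow> x \<notin> U" using vU[OF True] by simp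
          then show ?thesis using False d x by (auto simp: arcs_to_ones_def mem_S)
        qed
      next
        case False
        then show ?thesis using US by (auto simp: arcs_to_ones_def)
      qed
    qed
  qed
  show "arcs_to_ones ` (\<Pi>\<^sub>E d\<in>D. Pow {..<n}) \<subseteq> {U. transversal S v U}"
  proof (rule image_subsetI, rule CollectI)
    fix Y
    have "v x \<in> arcs_to_ones Y \<longleftrightarrow> x \<notin> arcs_to_ones Y" if xS: "x \<in> S" for x
    proof -
      obtain d i where x: "x = (d, i)" by (cases x)
      then have d: "d \<in> D" "i < n * 2" using xS by (auto simp: mem_S)
      show ?thesis
      proof (cases "n \<le> i")
        case True
        define j where "j = i - n"
        have j: "i = n + j" "j < n" using True d by (auto simp: j_def)
        have vx: "v x = (rot d, n - 1 - j)" unfolding x using j by (simp add: v_eq)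
        have "v x \<in> arcs_to_ones Y \<longleftrightarrow> n - 1 - (n - 1 - j) \<notin> Y (rot (rot (rot d)))"
          unfolding vx using j by (intro arcs_to_ones_iff(2) rotD d) simp
        then show ?thesis using j d arcs_to_ones_iff(1)[OF d(1) j(2)] rotD unfolding x by simp
      next
        case False
        then have i: "i < n" by simp
        have vx: "v x = (rot (rot d), n + (n - 1 - i))" unfolding x using i by (simp add: v_eq)
        have "v x \<in> arcs_to_ones Y \<longleftrightarrow> n - 1 - i \<in> Y (rot (rot d))"
          unfolding vx using i by (intro arcs_to_ones_iff(1) rotD d) simp
        then show ?thesis using arcs_to_ones_iff(2)[OF d(1) i] unfolding x by simp
      qed
    qed
    then show "transversal S v (arcs_to_ones Y)" by (auto simp: transversal_def arcs_to_ones_def)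
  qed
qed auto

lemma card_A_arcs:
  assumes Y: "Y \<in> (\<Pi>\<^sub>E d\<in>D. Pow {..<n})"
  shows "card (A \<inter> arcs_to_ones Y) = (\<Sum>d\<in>D. card (Y d))"
proof -
  have sub: "Y d \<subseteq> {..<n}" if "d \<in> D" for d using PiE_mem[OF Y that] by simp
  have "bij_betw (\<lambda>(d, j). (d, n + j)) (Sigma D Y) (A \<inter> arcs_to_ones Y)"
  proof (rule bij_betw_byWitness[where f' = "\<lambda>(d, i). (d, i - n)"])
    show "(\<lambda>(d, j). (d, n + j)) ` Sigma D Y \<subseteq> A \<inter> arcs_to_ones Y"
    proof (clarify, rename_tac d j)
      fix d j assume dj: "d \<in> D" "j \<in> Y d"
      then have "j < n" using sub by auto
      then show "(d, n + j) \<in> A \<inter> arcs_to_ones Y" using dj arcs_to_ones_iff(1)[OF dj(1)] by (auto simp: A_def mem_S)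
    qed
    show "(\<lambda>(d, i). (d, i - n)) ` (A \<inter> arcs_to_ones Y) \<subseteq> Sigma D Y"
      by (auto simp: A_def mem_S arcs_to_ones_def)
  qed (auto simp: A_def)
  then have "card (A \<inter> arcs_to_ones Y) = card (Sigma D Y)" by (rule bij_betw_same_card[symmetric])
  also have "\<dots> = (\<Sum>d\<in>D. card (Y d))"
    using finite_D sub by (intro card_SigmaI) (auto intro: finite_subset)
  finally show ?thesis .
qed

lemma card_B_ones: "U \<subseteq> S \<Longrightarrow> card (B \<inter> U) = (\<Sum>d\<in>reps. card (strands U d))"
proof -
  assume "U \<subseteq> S"
  then have "B \<inter> U = Sigma reps (strands U)" using reps_sub by (auto simp: B_def strands_def mem_S)
  moreover have "finite (strands U d)" for d by (rule finite_subset[of _ "{..<n * 2}"]) (auto simp: strands_def)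
  ultimately show ?thesis using finite_reps by (simp add: card_SigmaI)
qed

text \<open>The number of ones on the dart: \<open>k d\<close> of them come from the corner after
  \<open>d\<close>, and the corner before \<open>d\<close> supplies one for each arc not counted by
  \<open>k (rot (rot d))\<close>.\<close>

definition flow :: "('d \<Rightarrow> nat) \<Rightarrow> 'd \<Rightarrow> nat" where
  "flow k d = k d + (n - k (rot (rot d)))"

lemma card_strands_arcs:
  assumes Y: "Y \<in> (\<Pi>\<^sub>E d\<in>D. Pow {..<n})" and d: "d \<in> D"
  shows "card (strands (arcs_to_ones Y) d) = flow (\<lambda>d\<in>D. card (Y d)) d"
proof -
  have sub: "Y d \<subseteq> {..<n}" if "d \<in> D" for d using PiE_mem[OF Y that] by simp
  define Z where "Z = Y (rot (rot d))"
  have r: "rot (rot d) \<in> D" using rotD d by simp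
  have Z: "Z \<subseteq> {..<n}" using sub[OF r] by (simp add: Z_def)
  have low: "(\<lambda>j. n - 1 - j) ` ({..<n} - Z) = {i. i < n \<and> (d, i) \<in> arcs_to_ones Y}"
  proof
    show "(\<lambda>j. n - 1 - j) ` ({..<n} - Z) \<subseteq> {i. i < n \<and> (d, i) \<in> arcs_to_ones Y}"
      using arcs_to_ones_iff(2)[OF d] by (auto simp: Z_def)
    show "{i. i < n \<and> (d, i) \<in> arcs_to_ones Y} \<subseteq> (\<lambda>j. n - 1 - j) ` ({..<n} - Z)"
    proof
      fix i assume "i \<in> {i. i < n \<and> (d, i) \<in> arcs_to_ones Y}"
      then have "i = n - 1 - (n - 1 - i)" "n - 1 - i \<in> {..<n} - Z" using arcs_to_ones_iff(2)[OF d] by (auto simp: Z_def)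
      then show "i \<in> (\<lambda>j. n - 1 - j) ` ({..<n} - Z)" by (rule image_eqI)
    qed
  qed
  have "strands (arcs_to_ones Y) d = (\<lambda>j. n + j) ` Y d \<union> {i. i < n \<and> (d, i) \<in> arcs_to_ones Y}"
  proof (intro set_eqI)
    fix i
    show "i \<in> strands (arcs_to_ones Y) d \<longleftrightarrow> i \<in> (\<lambda>j. n + j) ` Y d \<union> {i. i < n \<and> (d, i) \<in> arcs_to_ones Y}"
    proof (cases "n \<le> i")
      case True
      then obtain j where j: "i = n + j" using le_Suc_ex by blast
      show ?thesis using j arcs_to_ones_iff(1)[OF d, of j Y] sub[OF d] by (auto simp: strands_def)
    qed (auto simp: strands_def)
  qed
  then have "card (strands (arcs_to_ones Y) d) = card ((\<lambda>j. n + j) ` Y d) + card ((\<lambda>j. n - 1 - j) ` ({..<n} - Z))"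
    unfolding low using sub[OF d] by (simp only:) (intro card_Un_disjoint, auto intro: finite_subset)
  also have "card ((\<lambda>j. n + j) ` Y d) = card (Y d)" by (rule card_image) simp
  also have "card ((\<lambda>j. n - 1 - j) ` ({..<n} - Z)) = card ({..<n} - Z)" by (rule card_image) (auto simp: inj_on_def)
  also have "\<dots> = n - card Z" using Z by (subst card_Diff_subset) (auto intro: finite_subset)
  finally show ?thesis using d r by (simp add: flow_def Z_def)
qed

lemma penrose_flow_sum:
  obtains \<zeta> :: int where "\<bar>\<zeta>\<bar> = 1"
    "penrose_eval D alpha rot g = \<zeta> * (\<Sum>k\<in>(\<Pi>\<^sub>E d\<in>D. {..n}). int (\<Prod>d\<in>D. n choose k d) *
       ((-1) ^ (sum k D + sum (flow k) reps) * int (\<Prod>d\<in>reps. edge_factor (flow k d) (flow k (alpha d)))))"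
proof -
  define F where "F k = (-1) ^ (sum k D + sum (flow k) reps) * int (\<Prod>d\<in>reps. edge_factor (flow k d) (flow k (alpha d)))" for k
  obtain \<zeta> :: int where z: "\<bar>\<zeta>\<bar> = 1"
    "penrose_eval D alpha rot g = \<zeta> * (\<Sum>U | transversal S v U.
       (-1) ^ (card (A \<inter> U) + card (B \<inter> U)) * int (\<Prod>d\<in>reps. edge_factor (card (strands U d)) (card (strands U (alpha d)))))"
    by (rule penrose_transversal_sum)
  have "(\<Sum>U | transversal S v U.
       (-1) ^ (card (A \<inter> U) + card (B \<inter> U)) * int (\<Prod>d\<in>reps. edge_factor (card (strands U d)) (card (strands U (alpha d)))))
    = (\<Sum>Y\<in>(\<Pi>\<^sub>E d\<in>D. Pow {..<n}). (-1) ^ (card (A \<inter> arcs_to_ones Y) + card (B \<inter> arcs_to_ones Y)) *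
        int (\<Prod>d\<in>reps. edge_factor (card (strands (arcs_to_ones Y) d)) (card (strands (arcs_to_ones Y) (alpha d)))))"
    by (rule sum.reindex_bij_betw[OF bij_betw_arcs_to_ones, symmetric])
  also have "\<dots> = (\<Sum>Y\<in>(\<Pi>\<^sub>E d\<in>D. Pow {..<n}). F (\<lambda>d\<in>D. card (Y d)))"
  proof (intro sum.cong refl)
    fix Y assume Y: "Y \<in> (\<Pi>\<^sub>E d\<in>D. Pow {..<n})"
    have US: "arcs_to_ones Y \<subseteq> S" by (auto simp: arcs_to_ones_def)
    have "card (A \<inter> arcs_to_ones Y) = sum (\<lambda>d\<in>D. card (Y d)) D" unfolding card_A_arcs[OF Y] by (intro sum.cong) auto
    moreover have "card (B \<inter> arcs_to_ones Y) = sum (flow (\<lambda>d\<in>D. card (Y d))) reps"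
      unfolding card_B_ones[OF US] using reps_sub by (intro sum.cong refl card_strands_arcs[OF Y]) auto
    moreover have "(\<Prod>d\<in>reps. edge_factor (card (strands (arcs_to_ones Y) d)) (card (strands (arcs_to_ones Y) (alpha d))))
      = (\<Prod>d\<in>reps. edge_factor (flow (\<lambda>d\<in>D. card (Y d)) d) (flow (\<lambda>d\<in>D. card (Y d)) (alpha d)))"
      using reps_sub alphaD by (intro prod.cong refl) (auto simp: card_strands_arcs[OF Y])
    ultimately show "(-1) ^ (card (A \<inter> arcs_to_ones Y) + card (B \<inter> arcs_to_ones Y)) *
        int (\<Prod>d\<in>reps. edge_factor (card (strands (arcs_to_ones Y) d)) (card (strands (arcs_to_ones Y) (alpha d)))) = F (\<lambda>d\<in>D. card (Y d))"
      by (simp only: F_def)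
  qed
  also have "\<dots> = (\<Sum>k\<in>(\<Pi>\<^sub>E d\<in>D. {..n}). int (\<Prod>d\<in>D. n choose k d) * F k)"
    using sum_card_functions[OF finite_D, of "{..<n}" F] by simp
  finally have "penrose_eval D alpha rot g = \<zeta> * (\<Sum>k\<in>(\<Pi>\<^sub>E d\<in>D. {..n}). int (\<Prod>d\<in>D. n choose k d) * F k)"
    unfolding z(2) by (rule arg_cong[where f = "\<lambda>x. \<zeta> * x"])
  then show thesis by (intro that[OF z(1)]) (simp only: F_def)
qed

definition edge_weight :: "('d \<Rightarrow> nat) \<Rightarrow> 'd \<Rightarrow> real" where
  "edge_weight k d = (if int (flow k d) + int (flow k (alpha d)) = 2 * int n then sweight n (int (flow k d)) else 0)"

text \<open>The sign counted by \<open>A\<close> distributes over the corners and completes the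
  binomials to \<open>sbinom\<close>; the sign counted by \<open>B\<close> distributes over the
  edges and completes the factorials to \<open>sweight\<close>.\<close>

theorem penrose_state_sum:
  obtains \<zeta> :: real where "\<bar>\<zeta>\<bar> = 1"
    "real_of_int (penrose_eval D alpha rot g) = \<zeta> * (\<Sum>k\<in>(\<Pi>\<^sub>E d\<in>D. {..n}).
       (\<Prod>d\<in>D. sbinom n (k d)) * (\<Prod>d\<in>reps. edge_weight k d))"
proof -
  obtain \<zeta> :: int where z: "\<bar>\<zeta>\<bar> = 1"
    "penrose_eval D alpha rot g = \<zeta> * (\<Sum>k\<in>(\<Pi>\<^sub>E d\<in>D. {..n}). int (\<Prod>d\<in>D. n choose k d) *
       ((-1) ^ (sum k D + sum (flow k) reps) * int (\<Prod>d\<in>reps. edge_factor (flow k d) (flow k (alpha d)))))"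
    by (rule penrose_flow_sum)
  have ew: "edge_weight k d = (-1) ^ flow k d * real (edge_factor (flow k d) (flow k (alpha d)))" for k d
  proof (cases "flow k d + flow k (alpha d) = n * 2")
    case True
    then have "int (flow k d) + int (flow k (alpha d)) = 2 * int n" "nat (2 * int n - int (flow k d)) = n * 2 - flow k d" by auto
    then show ?thesis using True by (simp add: edge_weight_def edge_factor_def sweight_def weight_def)
  next
    case False
    then have "int (flow k d) + int (flow k (alpha d)) \<noteq> 2 * int n" by linarith
    then show ?thesis using False by (simp add: edge_weight_def edge_factor_def)
  qed
  have "real_of_int (penrose_eval D alpha rot g) = real_of_int \<zeta> * (\<Sum>k\<in>(\<Pi>\<^sub>E d\<in>D. {..n}).
       (\<Prod>d\<in>D. sbinom n (k d)) * (\<Prod>d\<in>reps. edge_weight k d))"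
    unfolding z(2) of_int_mult of_int_sum ew sbinom_def prod.distrib power_add power_sum
    by (simp add: mult_ac)
  moreover have "\<bar>real_of_int \<zeta>\<bar> = 1" using z(1) by (simp flip: of_int_abs)
  ultimately show thesis using that by blast
qed

end

section \<open>The drum network\<close>

lemma sum_PiE_insert:
  assumes "x \<notin> A"
  shows "(\<Sum>k\<in>PiE (insert x A) B. g k) = (\<Sum>b\<in>B x. \<Sum>k\<in>PiE A B. g (k(x := b)))"
proof -
  have "(\<Sum>k\<in>PiE (insert x A) B. g k) = (\<Sum>z\<in>B x \<times> PiE A B. g ((snd z)(x := fst z)))"
    by (rule sum.reindex_bij_betw[symmetric, where h = "\<lambda>z. (snd z)(x := fst z)", unfolded case_prod_unfold])
       (auto simp: bij_betw_def PiE_insert_eq case_prod_unfold inj_combinator[OF assms, unfolded case_prod_unfold])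
  then show ?thesis by (simp add: sum.cartesian_product case_prod_unfold)
qed

text \<open>The six new darts are listed in the order of the rotation at the outer vertex, 0, 2, 1,
  and at the inner vertex, 5, 3, 4, so that the arguments of the vertex factors come out in cyclic
  order.\<close>

lemma lessThan_6_Suc: "{..<6 * Suc s} = insert (6 * s) (insert (6 * s+2) (insert (6 * s+1) (insert (6 * s+5) (insert (6 * s+3) (insert (6 * s+4) {..<6 * s})))))"
  by auto

lemma prod_lessThan_6:
  fixes s :: nat and f :: "nat \<Rightarrow> real"
  shows "(\<Prod>d<6 * s. f d) = (\<Prod>i<s. f (6*i) * f (6*i+2) * f (6*i+1) * (f (6*i+5) * f (6*i+3) * f (6*i+4)))"
proof (induction s)
  case (Suc s)
  show ?case unfolding lessThan_6_Suc using Suc by (simp add: mult_ac)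
qed simp

text \<open>For fixed edge labels the factor with index \<open>i\<close> depends only on the corners
  at the two ends of the rung \<open>i\<close>, so the sum over all corner counts is a product over
  the rungs.\<close>

lemma sum_PiE_lessThan_6:
  fixes \<Phi> :: "nat \<Rightarrow> nat \<Rightarrow> nat \<Rightarrow> nat \<Rightarrow> nat \<Rightarrow> nat \<Rightarrow> nat \<Rightarrow> real"
  shows "(\<Sum>k\<in>(\<Pi>\<^sub>E d\<in>{..<6 * s}. T). \<Prod>i<s. \<Phi> i (k (6*i)) (k (6*i+2)) (k (6*i+1)) (k (6*i+5)) (k (6*i+3)) (k (6*i+4)))
    = (\<Prod>i<s. \<Sum>a\<in>T. \<Sum>b\<in>T. \<Sum>c\<in>T. \<Sum>d\<in>T. \<Sum>e\<in>T. \<Sum>f\<in>T. \<Phi> i a b c d e f)"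
proof (induction s)
  case (Suc s)
  define W where "W k = (\<Prod>i<s. \<Phi> i (k (6*i)) (k (6*i+2)) (k (6*i+1)) (k (6*i+5)) (k (6*i+3)) (k (6*i+4)))" for k
  have upd: "W (k(x := y)) = W k" if "x \<ge> 6 * s" for k x y
    unfolding W_def using that by (intro prod.cong refl) auto
  have "(\<Sum>k\<in>(\<Pi>\<^sub>E d\<in>{..<6 * Suc s}. T). \<Prod>i<Suc s. \<Phi> i (k (6*i)) (k (6*i+2)) (k (6*i+1)) (k (6*i+5)) (k (6*i+3)) (k (6*i+4)))
    = (\<Sum>k\<in>(\<Pi>\<^sub>E d\<in>{..<6 * Suc s}. T). W k * \<Phi> s (k (6 * s)) (k (6 * s+2)) (k (6 * s+1)) (k (6 * s+5)) (k (6 * s+3)) (k (6 * s+4)))"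
    by (simp only: prod.lessThan_Suc W_def)
  also have "\<dots> = (\<Sum>a\<in>T. \<Sum>b\<in>T. \<Sum>c\<in>T. \<Sum>d\<in>T. \<Sum>e\<in>T. \<Sum>f\<in>T. \<Sum>k\<in>(\<Pi>\<^sub>E d\<in>{..<6 * s}. T). W k * \<Phi> s a b c d e f)"
    unfolding lessThan_6_Suc by (simp add: sum_PiE_insert upd)
  also have "\<dots> = (\<Sum>k\<in>(\<Pi>\<^sub>E d\<in>{..<6 * s}. T). W k) * (\<Sum>a\<in>T. \<Sum>b\<in>T. \<Sum>c\<in>T. \<Sum>d\<in>T. \<Sum>e\<in>T. \<Sum>f\<in>T. \<Phi> s a b c d e f)"
    by (simp only: sum_distrib_right[symmetric] sum_distrib_left[symmetric])
  finally show ?case unfolding W_def Suc by (simp only: prod.lessThan_Suc)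
qed simp

lemma threej_flow:
  "(\<Sum>a\<le>n. \<Sum>b\<le>n. \<Sum>c\<le>n. sbinom n a * sbinom n b * sbinom n c *
     of_bool (int (a + (n - c)) = u \<and> int (b + (n - a)) = v \<and> int (c + (n - b)) = w)) = threej n u v w"
  unfolding threej_def
proof (intro sum.cong refl, goal_cases)
  case (1 a b c)
  then have "(int (a + (n - c)) = u \<and> int (b + (n - a)) = v \<and> int (c + (n - b)) = w) \<longleftrightarrow>
    (int n + int a = u + int c \<and> int n + int b = v + int a \<and> int n + int c = w + int b)"
    by (auto simp: of_nat_diff)
  then show ?case by (simp only: of_bool_def) simp
qed

lemma sum_six_split:
  fixes F G :: "nat \<Rightarrow> nat \<Rightarrow> nat \<Rightarrow> real"
  shows "(\<Sum>a\<in>T. \<Sum>b\<in>T. \<Sum>c\<in>T. \<Sum>d\<in>T. \<Sum>e\<in>T. \<Sum>f\<in>T. F a b c * G d e f)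
    = (\<Sum>a\<in>T. \<Sum>b\<in>T. \<Sum>c\<in>T. F a b c) * (\<Sum>d\<in>T. \<Sum>e\<in>T. \<Sum>f\<in>T. G d e f)"
  by (simp only: sum_distrib_right[symmetric] sum_distrib_left[symmetric])

section \<open>Cyclic indices and the combinatorial map of the drum\<close>

definition cyc_next :: "nat \<Rightarrow> nat \<Rightarrow> nat" where
  "cyc_next s i = (i + 1) mod s"

definition cyc_prev :: "nat \<Rightarrow> nat \<Rightarrow> nat" where
  "cyc_prev s i = (i + s - 1) mod s"

lemma cyc:
  assumes "i < s"
  shows "cyc_next s i < s" "cyc_prev s i < s" "cyc_next s (cyc_prev s i) = i" "cyc_prev s (cyc_next s i) = i"
proof -
  have s: "s > 0" using assms by simp
  show "cyc_next s i < s" "cyc_prev s i < s" using s by (auto simp: cyc_next_def cyc_prev_def)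
  show "cyc_next s (cyc_prev s i) = i"
  proof (cases "i = 0")
    case True then show ?thesis using s by (simp add: cyc_next_def cyc_prev_def)
  next
    case False
    then have e: "i + s - 1 = (i - 1) + s" by simp
    have "cyc_prev s i = i - 1" unfolding cyc_prev_def e using assms by simp
    then show ?thesis using False assms by (simp add: cyc_next_def)
  qed
  show "cyc_prev s (cyc_next s i) = i"
  proof (cases "i + 1 = s")
    case True
    then have "cyc_next s i = 0" by (simp add: cyc_next_def)
    then show ?thesis using assms by (simp add: cyc_prev_def flip: True)
  next
    case False
    then have "cyc_next s i = i + 1" using assms by (simp add: cyc_next_def)
    then show ?thesis using assms by (simp add: cyc_prev_def)
  qed
qed

lemma prod_cyc_prev: "(\<Prod>i<s. f i (cyc_prev s i)) = (\<Prod>i<s. f (cyc_next s i) i)"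
  by (rule prod.reindex_bij_witness[of _ "cyc_next s" "cyc_prev s"]) (auto simp: cyc)

lemma prod_cyc_next: "(\<Prod>i<s. f (cyc_next s i)) = (\<Prod>i<s. f i)"
  by (rule prod.reindex_bij_witness[of _ "cyc_prev s" "cyc_next s"]) (auto simp: cyc)

lemma sum_cyc_next: "(\<Sum>i<s. f (cyc_next s i)) = (\<Sum>i<s. f i)"
  by (rule sum.reindex_bij_witness[of _ "cyc_prev s" "cyc_next s"]) (auto simp: cyc)

lemma dart_cases:
  assumes "d < 6 * (s::nat)"
  obtains i where "i < s" "d = 6*i \<or> d = 6*i+1 \<or> d = 6*i+2 \<or> d = 6*i+3 \<or> d = 6*i+4 \<or> d = 6*i+5"
proof
  show "d div 6 < s" using assms by (simp add: less_mult_imp_div_less mult.commute)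
  show "d = 6*(d div 6) \<or> d = 6*(d div 6)+1 \<or> d = 6*(d div 6)+2 \<or> d = 6*(d div 6)+3 \<or> d = 6*(d div 6)+4 \<or> d = 6*(d div 6)+5"
    by presburger
qed

lemma dart_div_mod:
  "(6*i) div 6 = i" "(6*i) mod 6 = (0::nat)" "(6*i+1) div 6 = i" "(6*i+1) mod 6 = 1"
  "(6*i+2) div 6 = i" "(6*i+2) mod 6 = 2" "(6*i+3) div 6 = i" "(6*i+3) mod 6 = 3"
  "(6*i+4) div 6 = i" "(6*i+4) mod 6 = 4" "(6*i+5) div 6 = i" "(6*i+5) mod (6::nat) = 5"
  by presburger+

lemma drum_alpha_eq:
  "drum_alpha s (6*i) = 6 * cyc_next s i + 1" "drum_alpha s (6*i+1) = 6 * cyc_prev s i"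
  "drum_alpha s (6*i+2) = 6*i+5" "drum_alpha s (6*i+3) = 6 * cyc_next s i + 4"
  "drum_alpha s (6*i+4) = 6 * cyc_prev s i + 3" "drum_alpha s (6*i+5) = 6*i+2"
  unfolding drum_alpha_def dart_div_mod Let_def cyc_next_def cyc_prev_def by simp_all

lemma drum_rot_eq:
  "drum_rot (6*i) = 6*i+2" "drum_rot (6*i+2) = 6*i+1" "drum_rot (6*i+1) = 6*i"
  "drum_rot (6*i+5) = 6*i+3" "drum_rot (6*i+3) = 6*i+4" "drum_rot (6*i+4) = 6*i+5"
  unfolding drum_rot_def dart_div_mod Let_def by simp_all


lemma uniform_network_drum:
  assumes "s \<ge> 2"
  shows "uniform_network (drum_darts s) (drum_alpha s) drum_rot"
proof -
  let ?D = "drum_darts s"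
  have D: "d \<in> ?D \<longleftrightarrow> d < 6 * s" for d by (simp add: drum_darts_def)
  have ne: "cyc_next s i \<noteq> i" "cyc_prev s i \<noteq> i" if "i < s" for i
  proof -
    show n: "cyc_next s i \<noteq> i"
      using that assms by (cases "i + 1 = s") (auto simp: cyc_next_def)
    show "cyc_prev s i \<noteq> i" using n cyc(3)[OF that] by metis
  qed
  have a: "drum_alpha s d \<in> ?D \<and> drum_alpha s d \<noteq> d \<and> drum_alpha s (drum_alpha s d) = d" if d: "d \<in> ?D" for d
  proof -
    obtain i where i: "i < s" "d = 6*i \<or> d = 6*i+1 \<or> d = 6*i+2 \<or> d = 6*i+3 \<or> d = 6*i+4 \<or> d = 6*i+5"
      using dart_cases[of d s] d D by blast
    note c = cyc[OF i(1)]
    have b: "6 * j + m < 6 * s" if "j < s" "m < 6" for j m :: nat using that by linarith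
    from i(2) show ?thesis
    proof (elim disjE)
      assume e: "d = 6*i" show ?thesis unfolding e drum_alpha_eq D using c b[of "cyc_next s i" 1] by (simp; presburger)
    next
      assume e: "d = 6*i+1" show ?thesis unfolding e drum_alpha_eq D using c b[of "cyc_prev s i" 0] by (simp; presburger)
    next
      assume e: "d = 6*i+2" show ?thesis unfolding e drum_alpha_eq D using b[of i 5] i(1) by simp
    next
      assume e: "d = 6*i+3" show ?thesis unfolding e drum_alpha_eq D using c b[of "cyc_next s i" 4] by (simp; presburger)
    next
      assume e: "d = 6*i+4" show ?thesis unfolding e drum_alpha_eq D using c b[of "cyc_prev s i" 3] by (simp; presburger)
    next
      assume e: "d = 6*i+5" show ?thesis unfolding e drum_alpha_eq D using b[of i 2] i(1) by simp
    qed
  qed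
  have r3: "drum_rot (drum_rot (drum_rot d)) = d \<and> drum_rot d \<noteq> d" for d
  proof -
    obtain i where i: "d = 6*i \<or> d = 6*i+1 \<or> d = 6*i+2 \<or> d = 6*i+3 \<or> d = 6*i+4 \<or> d = 6*i+5"
      using dart_cases[of d "Suc d"] by auto
    then show ?thesis by (elim disjE) (simp_all only: drum_rot_eq, simp_all)
  qed
  have rD: "drum_rot d \<in> ?D" if d: "d \<in> ?D" for d
  proof -
    obtain i where i: "i < s" "d = 6*i \<or> d = 6*i+1 \<or> d = 6*i+2 \<or> d = 6*i+3 \<or> d = 6*i+4 \<or> d = 6*i+5"
      using dart_cases[of d s] d D by blast
    from i(2) show ?thesis unfolding D using i(1) by (elim disjE; hypsubst; simp only: drum_rot_eq; linarith)
  qed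
  show ?thesis
    by unfold_locales (use a r3 rD in \<open>auto simp: drum_darts_def\<close>)
qed

section \<open>Wheel amplitudes as sums over cyclic labellings\<close>

lemma spoke_prod_list_sum:
  "(\<Sum>ps\<in>lists_of n (length cs). h (hd (ps @ [y])) * (\<Prod>i<length cs. spoke n (cs ! i) (ps ! i) ((ps @ [y]) ! Suc i)))
    = (\<Sum>x\<in>spins n. h x * spoke_prod n cs x y)" if "y \<in> spins n"
\<comment> \<open>The arbitrary factor \<open>h\<close> on the first label absorbs the spoke split
  off in the induction step, while \<open>y\<close> closes the path; \<open>hd (ps @ [y])\<close> is
  the first label also when no intermediate label is left.\<close>
proof (induction cs arbitrary: h)
  case Nil
  have "(\<Sum>x\<in>spins n. h x * mone x y) = (\<Sum>x\<in>spins n. if x = y then h x else 0)"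
    by (intro sum.cong refl) (simp add: mone_def)
  then show ?case using that by (simp add: sum_lists_of_0 sum.delta)
next
  case (Cons c cs)
  have hd_nth: "(ps @ [y]) ! 0 = hd (ps @ [y])" for ps by (simp add: hd_conv_nth)
  have "(\<Sum>ps\<in>lists_of n (length (c # cs)). h (hd (ps @ [y])) * (\<Prod>i<length (c # cs). spoke n ((c # cs) ! i) (ps ! i) ((ps @ [y]) ! Suc i)))
     = (\<Sum>p\<in>spins n. h p * (\<Sum>ps\<in>lists_of n (length cs). spoke n c p (hd (ps @ [y])) * (\<Prod>i<length cs. spoke n (cs ! i) (ps ! i) ((ps @ [y]) ! Suc i))))"
    by (simp add: sum_lists_of_Suc prod.lessThan_Suc_shift hd_nth sum_distrib_left del: prod.lessThan_Suc)
  also have "\<dots> = (\<Sum>p\<in>spins n. h p * (\<Sum>x\<in>spins n. spoke n c p x * spoke_prod n cs x y))"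
    by (simp only: Cons)
  finally show ?case by (simp add: mmul_def)
qed

lemma mtrace_spoke_prod:
  "mtrace n (spoke_prod n (c # cs)) = (\<Sum>ps\<in>lists_of n (length (c # cs)). \<Prod>i<length (c # cs). spoke n ((c # cs) ! i) (ps ! i) (ps ! cyc_next (length (c # cs)) i))"
proof -
  let ?m = "length cs"
  have "mtrace n (spoke_prod n (c # cs)) = (\<Sum>y\<in>spins n. \<Sum>x\<in>spins n. spoke n c y x * spoke_prod n cs x y)"
    by (simp add: mtrace_def mmul_def)
  also have "\<dots> = (\<Sum>y\<in>spins n. \<Sum>ps\<in>lists_of n ?m. spoke n c y (hd (ps @ [y])) * (\<Prod>i<?m. spoke n (cs ! i) (ps ! i) ((ps @ [y]) ! Suc i)))"
    by (intro sum.cong refl spoke_prod_list_sum[symmetric])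
  also have "\<dots> = (\<Sum>ps\<in>lists_of n (length (c # cs)). \<Prod>i<length (c # cs). spoke n ((c # cs) ! i) (ps ! i) (ps ! cyc_next (length (c # cs)) i))"
    unfolding length_Cons sum_lists_of_Suc
  proof (intro sum.cong refl)
    fix y ps assume ps: "ps \<in> lists_of n ?m"
    have len: "length ps = ?m" using ps by (simp add: lists_of_def)
    have nxt: "(y # ps) ! cyc_next (Suc ?m) i = (ps @ [y]) ! i" if "i < Suc ?m" for i
      using that len by (cases "i = ?m") (auto simp: cyc_next_def nth_append)
    have "(\<Prod>i<Suc ?m. spoke n ((c # cs) ! i) ((y # ps) ! i) ((y # ps) ! cyc_next (Suc ?m) i))
       = (\<Prod>i<Suc ?m. spoke n ((c # cs) ! i) ((y # ps) ! i) ((ps @ [y]) ! i))"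
      by (intro prod.cong refl) (simp add: nxt)
    also have "\<dots> = spoke n c y (hd (ps @ [y])) * (\<Prod>i<?m. spoke n (cs ! i) (ps ! i) ((ps @ [y]) ! Suc i))"
      unfolding prod.lessThan_Suc_shift by (simp add: hd_conv_nth)
    finally show "spoke n c y (hd (ps @ [y])) * (\<Prod>i<?m. spoke n (cs ! i) (ps ! i) ((ps @ [y]) ! Suc i))
      = (\<Prod>i<Suc ?m. spoke n ((c # cs) ! i) ((y # ps) ! i) ((y # ps) ! cyc_next (Suc ?m) i))" by simp
  qed
  finally show ?thesis .
qed

lemma sum_lists_PiE: "(\<Sum>cs\<in>lists_of n s. f cs) = (\<Sum>c\<in>(\<Pi>\<^sub>E i\<in>{..<s}. spins n). f (map c [0..<s]))"
proof (rule sum.reindex_bij_witness[of _ "\<lambda>c. map c [0..<s]" "\<lambda>cs. \<lambda>i\<in>{..<s}. cs ! i"])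
  fix cs assume "cs \<in> lists_of n s"
  then have l: "length cs = s" "set cs \<subseteq> spins n" by (auto simp: lists_of_def)
  show e: "map (\<lambda>i\<in>{..<s}. cs ! i) [0..<s] = cs" using l by (intro nth_equalityI) auto
  then show "f (map (\<lambda>i\<in>{..<s}. cs ! i) [0..<s]) = f cs" by simp
  show "(\<lambda>i\<in>{..<s}. cs ! i) \<in> (\<Pi>\<^sub>E i\<in>{..<s}. spins n)" using l by (auto simp: subset_iff)
next
  fix c :: "nat \<Rightarrow> int" assume c: "c \<in> (\<Pi>\<^sub>E i\<in>{..<s}. spins n)"
  show "(\<lambda>i\<in>{..<s}. map c [0..<s] ! i) = c"
    using c by (auto simp: fun_eq_iff PiE_iff extensional_def)
  show "map c [0..<s] \<in> lists_of n s" using c by (auto simp: lists_of_def PiE_iff)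
qed

definition wheel_sum :: "nat \<Rightarrow> nat \<Rightarrow> (nat \<Rightarrow> int) \<Rightarrow> real" where
  "wheel_sum n s c = (\<Sum>x\<in>(\<Pi>\<^sub>E i\<in>{..<s}. spins n). \<Prod>i<s. sweight n (x i) * threej n (x i) (c i) (2 * int n - x (cyc_next s i)))"

text \<open>Around the cycle each label ends one spoke and starts the next, so its two square roots
  recombine to the full weight. The square roots of the rung weights factor out and recombine on
  squaring the trace.\<close>

lemma wheel_eq:
  assumes "s > 0"
  shows "wheel n s = (\<Sum>c\<in>(\<Pi>\<^sub>E i\<in>{..<s}. spins n). (\<Prod>i<s. weight n (c i)) * (wheel_sum n s c)^2)"
  unfolding wheel_def sum_lists_PiE
proof (intro sum.cong refl)
  fix c :: "nat \<Rightarrow> int"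
  let ?X = "\<Pi>\<^sub>E i\<in>{..<s}. spins n"
  let ?cs = "map c [0..<s]"
  obtain c0 cs where cs: "?cs = c0 # cs" using assms by (cases ?cs) auto
  have len: "length (c0 # cs) = s" unfolding cs[symmetric] by simp
  have sq: "sqrt (weight n a) * sqrt (weight n a) = weight n a" for a
    using weight_pos[of n a] by simp
  have "mtrace n (spoke_prod n ?cs) = (\<Sum>ps\<in>lists_of n s. \<Prod>i<s. spoke n (?cs ! i) (ps ! i) (ps ! cyc_next s i))"
    unfolding cs mtrace_spoke_prod len ..
  also have "\<dots> = (\<Sum>x\<in>?X. \<Prod>i<s. spoke n (c i) (x i) (x (cyc_next s i)))"
    unfolding sum_lists_PiE by (intro sum.cong prod.cong refl) (simp add: cyc)
  also have "\<dots> = (\<Sum>x\<in>?X. (\<Prod>i<s. sqrt (weight n (c i))) * (\<Prod>i<s. sweight n (x i) * threej n (x i) (c i) (2 * int n - x (cyc_next s i))))"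
  proof (rule sum.cong[OF refl])
    fix x
    have "(\<Prod>i<s. spoke n (c i) (x i) (x (cyc_next s i)))
      = (\<Prod>i<s. sqrt (weight n (c i))) * ((\<Prod>i<s. sqrt (weight n (x i))) * (\<Prod>i<s. sqrt (weight n (x (cyc_next s i))))) *
        ((\<Prod>i<s. (-1) ^ nat (x i)) * (\<Prod>i<s. threej n (x i) (c i) (2 * int n - x (cyc_next s i))))"
      unfolding spoke_def prod.distrib by (simp only: mult_ac)
    also have "(\<Prod>i<s. sqrt (weight n (x i))) * (\<Prod>i<s. sqrt (weight n (x (cyc_next s i)))) = (\<Prod>i<s. weight n (x i))"
      unfolding prod_cyc_next[of "\<lambda>i. sqrt (weight n (x i))"] prod.distrib[symmetric] sq ..
    finally show "(\<Prod>i<s. spoke n (c i) (x i) (x (cyc_next s i)))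
      = (\<Prod>i<s. sqrt (weight n (c i))) * (\<Prod>i<s. sweight n (x i) * threej n (x i) (c i) (2 * int n - x (cyc_next s i)))"
      unfolding sweight_def prod.distrib by (simp only: mult_ac)
  qed
  finally have "mtrace n (spoke_prod n ?cs) = (\<Prod>i<s. sqrt (weight n (c i))) * wheel_sum n s c"
    unfolding wheel_sum_def sum_distrib_left .
  moreover have "(\<Prod>i<s. sqrt (weight n (c i)))^2 = (\<Prod>i<s. weight n (c i))"
    unfolding power2_eq_square prod.distrib[symmetric] sq ..
  ultimately show "(mtrace n (spoke_prod n ?cs))^2 = (\<Prod>i<s. weight n (c i)) * (wheel_sum n s c)^2"
    by (simp only: power_mult_distrib)
qed

text \<open>Conservation at the vertices fixes the sum of the rung labels, so the product of their signs
  is the same for all nonzero contributions.\<close>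

lemma wheel_sum_sign:
  assumes c: "c \<in> (\<Pi>\<^sub>E i\<in>{..<s}. spins n)"
  shows "(\<Prod>i<s. sweight n (c i)) * (wheel_sum n s c)^2 = (-1)^(n * s) * ((\<Prod>i<s. weight n (c i)) * (wheel_sum n s c)^2)"
proof (cases "wheel_sum n s c = 0")
  case False
  then obtain x where x: "x \<in> (\<Pi>\<^sub>E i\<in>{..<s}. spins n)" "(\<Prod>i<s. sweight n (x i) * threej n (x i) (c i) (2 * int n - x (cyc_next s i))) \<noteq> 0"
    unfolding wheel_sum_def by (meson sum.not_neutral_contains_not_neutral)
  have "x i + c i + (2 * int n - x (cyc_next s i)) = 3 * int n" if "i < s" for i
  proof -
    have "threej n (x i) (c i) (2 * int n - x (cyc_next s i)) \<noteq> 0"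
      using x(2) that by (auto simp: prod_zero_iff)
    then show ?thesis using threej_eq_0 by blast
  qed
  then have "(\<Sum>i<s. x i + c i + (2 * int n - x (cyc_next s i))) = (\<Sum>i<s. 3 * int n)" by (intro sum.cong) auto
  \<comment> \<open>The cycle labels cancel when the conservation laws are added up around the
    wheel.\<close>
  then have sum: "(\<Sum>i<s. c i) = int s * int n"
    using sum_cyc_next[of x s] by (simp add: sum.distrib sum_subtractf algebra_simps)
  have "int (\<Sum>i<s. nat (c i)) = (\<Sum>i<s. c i)"
    unfolding of_nat_sum using c by (intro sum.cong refl) (auto simp: PiE_iff spins_def)
  then have "int (\<Sum>i<s. nat (c i)) = int (n * s)" unfolding sum by (simp only: of_nat_mult mult.commute)
  then have "(\<Sum>i<s. nat (c i)) = n * s" by (simp only: of_nat_eq_iff)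
  then have "(\<Prod>i<s. (-1::real) ^ nat (c i)) = (-1)^(n * s)" by (simp add: power_sum[symmetric])
  then show ?thesis unfolding sweight_def prod.distrib by simp
qed simp

text \<open>\<open>edge_reps\<close> takes the smaller dart of an edge, which lies on the other side
  for the edges closing the two cycles. Since \<open>f\<close> is constant on edges, the
  representatives 1, 2, 4 modulo 6 may be used uniformly.\<close>

lemma prod_edge_reps:
  fixes f :: "nat \<Rightarrow> real"
  assumes s: "s \<ge> 2" and sym: "\<And>d. d \<in> drum_darts s \<Longrightarrow> f (drum_alpha s d) = f d"
  shows "(\<Prod>d\<in>edge_reps (drum_darts s) (drum_alpha s). f d) = (\<Prod>i<s. f (6*i+1)) * (\<Prod>i<s. f (6*i+2)) * (\<Prod>i<s. f (6*i+4))"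
proof -
  interpret uniform_network "drum_darts s" "drum_alpha s" drum_rot 0 by (rule uniform_network_drum[OF s])
  let ?D = "drum_darts s" and ?\<alpha> = "drum_alpha s"
  define E where "E = (\<lambda>i. 6*i+1) ` {..<s} \<union> (\<lambda>i. 6*i+2) ` {..<s} \<union> (\<lambda>i. 6*i+4) ` {..<s}"
  have ED: "E \<subseteq> ?D" by (auto simp: E_def drum_darts_def)
  have memE: "6*i \<notin> E" "6*i+3 \<notin> E" "6*i+5 \<notin> E" for i unfolding E_def by (auto; presburger)+
  have memE': "6*i+1 \<in> E" "6*i+2 \<in> E" "6*i+4 \<in> E" if "i < s" for i using that unfolding E_def by auto
  have E_iff: "?\<alpha> d \<in> E \<longleftrightarrow> d \<notin> E" if d: "d \<in> ?D" for d
  proof -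
    obtain i where i: "i < s" "d = 6*i \<or> d = 6*i+1 \<or> d = 6*i+2 \<or> d = 6*i+3 \<or> d = 6*i+4 \<or> d = 6*i+5"
      using dart_cases[of d s] d by (auto simp: drum_darts_def)
    from i(2) show ?thesis
      by (elim disjE; hypsubst; simp only: drum_alpha_eq memE memE' cyc i(1) simp_thms)
  qed
  have reps_iff: "?\<alpha> d \<in> reps \<longleftrightarrow> d \<notin> reps" if "d \<in> ?D" for d by (rule alpha_reps[OF that])
  have "(\<Prod>d\<in>reps. f d) = (\<Prod>d\<in>E. f d)"
  proof (rule prod.reindex_bij_witness[of _ "\<lambda>d. if d \<in> reps then d else ?\<alpha> d" "\<lambda>d. if d \<in> E then d else ?\<alpha> d"])
    fix d assume d: "d \<in> reps"
    then have dD: "d \<in> ?D" using reps_sub by blast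
    show "(if (if d \<in> E then d else ?\<alpha> d) \<in> reps then (if d \<in> E then d else ?\<alpha> d) else ?\<alpha> (if d \<in> E then d else ?\<alpha> d)) = d"
      using d dD reps_iff[OF dD] alphaD(3)[OF dD] by auto
    show "(if d \<in> E then d else ?\<alpha> d) \<in> E" using E_iff[OF dD] by auto
    show "f (if d \<in> E then d else ?\<alpha> d) = f d" using sym[OF dD] by auto
  next
    fix d assume d: "d \<in> E"
    then have dD: "d \<in> ?D" using ED by blast
    show "(if (if d \<in> reps then d else ?\<alpha> d) \<in> E then (if d \<in> reps then d else ?\<alpha> d) else ?\<alpha> (if d \<in> reps then d else ?\<alpha> d)) = d"
      using d dD E_iff[OF dD] alphaD(3)[OF dD] by auto
    show "(if d \<in> reps then d else ?\<alpha> d) \<in> reps" using reps_iff[OF dD] by auto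
  qed
  also have "\<dots> = (\<Prod>d\<in>(\<lambda>i. 6*i+1) ` {..<s}. f d) * (\<Prod>d\<in>(\<lambda>i. 6*i+2) ` {..<s}. f d) * (\<Prod>d\<in>(\<lambda>i. 6*i+4) ` {..<s}. f d)"
  proof -
    have "((\<lambda>i. 6*i+1) ` {..<s} \<union> (\<lambda>i. 6*i+2) ` {..<s}) \<inter> (\<lambda>i. 6*i+4) ` {..<s} = {}"
      "(\<lambda>i. 6*i+1) ` {..<s} \<inter> (\<lambda>i. 6*i+2) ` {..<s} = {}"
      by (auto; presburger)+
    then show ?thesis unfolding E_def by (simp add: prod.union_disjoint)
  qed
  also have "\<dots> = (\<Prod>i<s. f (6*i+1)) * (\<Prod>i<s. f (6*i+2)) * (\<Prod>i<s. f (6*i+4))"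
    by (simp add: prod.reindex inj_on_def)
  finally show ?thesis .
qed

section \<open>Contraction of the drum into a sum of squares\<close>

lemma sum_triple_product:
  fixes f g h :: "_ \<Rightarrow> real"
  shows "sum f X * sum g Y * sum h Z = (\<Sum>x\<in>X. \<Sum>y\<in>Y. \<Sum>z\<in>Z. f x * g y * h z)"
  by (simp only: sum_distrib_right[symmetric] sum_distrib_left[symmetric])

lemma penrose_drum:
  assumes s: "s \<ge> 2"
  shows "\<bar>real_of_int (penrose_eval (drum_darts s) (drum_alpha s) drum_rot (\<lambda>d. n * 2))\<bar> = wheel n s"
proof -
  interpret uniform_network "drum_darts s" "drum_alpha s" drum_rot n by (rule uniform_network_drum[OF s])
  let ?N = "2 * int n"
  let ?K = "\<Pi>\<^sub>E d\<in>drum_darts s. {..n}" and ?X = "\<Pi>\<^sub>E i\<in>{..<s}. spins n"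
  have K_eq: "?K = (\<Pi>\<^sub>E d\<in>{..<6 * s}. {..n})" by (simp add: drum_darts_def)
  define \<phi> where "\<phi> k d = int (flow k d)" for k :: "nat \<Rightarrow> nat" and d
  obtain \<zeta> :: real where z: "\<bar>\<zeta>\<bar> = 1"
    "real_of_int (penrose_eval (drum_darts s) (drum_alpha s) drum_rot (\<lambda>d. n * 2)) = \<zeta> * (\<Sum>k\<in>?K.
       (\<Prod>d\<in>drum_darts s. sbinom n (k d)) * (\<Prod>d\<in>reps. edge_weight k d))"
    by (rule penrose_state_sum)
  have flow_spins: "\<phi> k d \<in> spins n" if "k \<in> ?K" "d \<in> drum_darts s" for k d
    using PiE_mem[OF that] by (auto simp: spins_def flow_def \<phi>_def)
  have ew: "edge_weight k d = (\<Sum>x\<in>spins n. sweight n x * of_bool (\<phi> k d = x \<and> \<phi> k (drum_alpha s d) = ?N - x))"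
    if "k \<in> ?K" "d \<in> drum_darts s" for k d
  proof -
    have "(\<Sum>x\<in>spins n. sweight n x * of_bool (\<phi> k d = x \<and> \<phi> k (drum_alpha s d) = ?N - x))
      = (\<Sum>x\<in>spins n. if x = \<phi> k d then edge_weight k d else 0)"
      by (intro sum.cong refl) (auto simp: edge_weight_def \<phi>_def)
    then show ?thesis using flow_spins[OF that] by (simp add: sum.delta)
  qed
  have ew_sym: "edge_weight k (drum_alpha s d) = edge_weight k d" if "k \<in> ?K" "d \<in> drum_darts s" for k d
  proof (cases "\<phi> k d + \<phi> k (drum_alpha s d) = ?N")
    case True
    then have "\<phi> k (drum_alpha s d) = ?N - \<phi> k d" by simp
    then show ?thesis using True sweight_complement[OF flow_spins[OF that]] alphaD(3)[OF that(2)]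
      by (simp add: edge_weight_def \<phi>_def add.commute)
  next
    case False
    then show ?thesis using alphaD(3)[OF that(2)] by (simp add: edge_weight_def \<phi>_def add.commute)
  qed
  \<comment> \<open>\<open>x\<close>, \<open>c\<close> and \<open>y\<close> label the outer cycle,
    the rungs and the inner cycle. For fixed labels this is the contribution of the two vertices at
    the rung \<open>i\<close>, each edge constraint being imposed at the vertex where the dart
    lies.\<close>
  define \<Phi> where "\<Phi> x c y i a b e a' b' e' = sbinom n a * sbinom n b * sbinom n e *
       of_bool (int (a + (n - e)) = ?N - x (cyc_next s i) \<and> int (b + (n - a)) = c i \<and> int (e + (n - b)) = x i) *
      (sbinom n a' * sbinom n b' * sbinom n e' *
       of_bool (int (a' + (n - e')) = ?N - c i \<and> int (b' + (n - a')) = y (cyc_next s i) \<and> int (e' + (n - b')) = ?N - y i))"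
    for x c y :: "nat \<Rightarrow> int" and i a b e a' b' e' :: nat
  let ?A = "\<lambda>k x. \<Prod>i<s. sweight n (x i) * of_bool (\<phi> k (6*i+1) = x i \<and> \<phi> k (6 * cyc_prev s i) = ?N - x i)"
  let ?B = "\<lambda>k c. \<Prod>i<s. sweight n (c i) * of_bool (\<phi> k (6*i+2) = c i \<and> \<phi> k (6*i+5) = ?N - c i)"
  let ?C = "\<lambda>k y. \<Prod>i<s. sweight n (y i) * of_bool (\<phi> k (6*i+4) = ?N - y i \<and> \<phi> k (6 * cyc_prev s i + 3) = y i)"
  let ?G = "\<lambda>k x c y. (\<Prod>i<s. sweight n (x i)) * (\<Prod>i<s. sweight n (c i)) * (\<Prod>i<s. sweight n (y i)) *
    (\<Prod>i<s. \<Phi> x c y i (k (6*i)) (k (6*i+2)) (k (6*i+1)) (k (6*i+5)) (k (6*i+3)) (k (6*i+4)))"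
  let ?H = "\<lambda>c x y. (\<Prod>i<s. sweight n (c i)) * (
    (\<Prod>i<s. sweight n (x i) * threej n (x i) (c i) (?N - x (cyc_next s i))) * (\<Prod>i<s. sweight n (y i) * threej n (y i) (c i) (?N - y (cyc_next s i))))"
  have dart_in: "6*i < 6 * s" "6*i+1 < 6 * s" "6*i+2 < 6 * s" "6*i+3 < 6 * s" "6*i+4 < 6 * s" "6*i+5 < 6 * s" if "i < s" for i :: nat
    using that by linarith+
  have dart_in': "6*i \<in> drum_darts s" "6*i+1 \<in> drum_darts s" "6*i+2 \<in> drum_darts s" "6*i+3 \<in> drum_darts s" "6*i+4 \<in> drum_darts s"
    if "i < s" for i
    using dart_in[OF that] by (simp_all only: drum_darts_def lessThan_iff)
  have term_eq: "(\<Prod>d\<in>drum_darts s. sbinom n (k d)) * (\<Prod>d\<in>reps. edge_weight k d)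
     = (\<Sum>x\<in>?X. \<Sum>c\<in>?X. \<Sum>y\<in>?X. ?G k x c y)"
    if k: "k \<in> ?K" for k
  proof -
    have e1': "edge_weight k (6*i+1) = (\<Sum>x\<in>spins n. sweight n x * of_bool (\<phi> k (6*i+1) = x \<and> \<phi> k (6 * cyc_prev s i) = ?N - x))"
      if i: "i < s" for i
      by (rule ew[OF k dart_in'(2)[OF i], unfolded drum_alpha_eq])
    have e2': "edge_weight k (6*i+2) = (\<Sum>x\<in>spins n. sweight n x * of_bool (\<phi> k (6*i+2) = x \<and> \<phi> k (6*i+5) = ?N - x))"
      if i: "i < s" for i
      by (rule ew[OF k dart_in'(3)[OF i], unfolded drum_alpha_eq])
    \<comment> \<open>On the inner cycle the label is read at the end opposite to the one used on
      the outer cycle. This complements the labels at the inner vertices, so that both cycles lead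
      to the same \<open>wheel_sum\<close>.\<close>
    have e4': "edge_weight k (6*i+4) = (\<Sum>y\<in>spins n. sweight n y * of_bool (\<phi> k (6*i+4) = ?N - y \<and> \<phi> k (6 * cyc_prev s i + 3) = y))"
      if i: "i < s" for i
    proof -
      have "edge_weight k (6*i+4) = edge_weight k (6 * cyc_prev s i + 3)"
        using ew_sym[OF k dart_in'(5)[OF i]] unfolding drum_alpha_eq by (rule sym)
      also have "\<dots> = (\<Sum>y\<in>spins n. sweight n y * of_bool (\<phi> k (6 * cyc_prev s i + 3) = y \<and> \<phi> k (6*i+4) = ?N - y))"
        by (rule ew[OF k dart_in'(4)[OF cyc(2)[OF i]], unfolded drum_alpha_eq cyc(3)[OF i]])
      finally show ?thesis by (simp only: conj_commute)
    qed
    have e1: "(\<Prod>i<s. edge_weight k (6*i+1)) = (\<Sum>x\<in>?X. ?A k x)"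
      by (subst prod_sum_PiE[symmetric], simp, simp, rule prod.cong[OF refl], rule e1', simp)
    have e2: "(\<Prod>i<s. edge_weight k (6*i+2)) = (\<Sum>c\<in>?X. ?B k c)"
      by (subst prod_sum_PiE[symmetric], simp, simp, rule prod.cong[OF refl], rule e2', simp)
    have e4: "(\<Prod>i<s. edge_weight k (6*i+4)) = (\<Sum>y\<in>?X. ?C k y)"
      by (subst prod_sum_PiE[symmetric], simp, simp, rule prod.cong[OF refl], rule e4', simp)
    have fl: "\<phi> k (6*i) = int (k (6*i) + (n - k (6*i+1)))" "\<phi> k (6*i+1) = int (k (6*i+1) + (n - k (6*i+2)))"
      "\<phi> k (6*i+2) = int (k (6*i+2) + (n - k (6*i)))" "\<phi> k (6*i+3) = int (k (6*i+3) + (n - k (6*i+5)))"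
      "\<phi> k (6*i+4) = int (k (6*i+4) + (n - k (6*i+3)))" "\<phi> k (6*i+5) = int (k (6*i+5) + (n - k (6*i+4)))" for i
      unfolding \<phi>_def flow_def drum_rot_eq by simp_all
    have "(\<Prod>d\<in>reps. edge_weight k d) = (\<Prod>i<s. edge_weight k (6*i+1)) * (\<Prod>i<s. edge_weight k (6*i+2)) * (\<Prod>i<s. edge_weight k (6*i+4))"
      by (rule prod_edge_reps[OF s, of "edge_weight k"]) (rule ew_sym[OF k])
    also have "\<dots> = (\<Sum>x\<in>?X. \<Sum>c\<in>?X. \<Sum>y\<in>?X.
        ?A k x *
        ?B k c *
        ?C k y)"
      unfolding e1 e2 e4 by (rule sum_triple_product)
    finally have "(\<Prod>d\<in>drum_darts s. sbinom n (k d)) * (\<Prod>d\<in>reps. edge_weight k d) = (\<Sum>x\<in>?X. \<Sum>c\<in>?X. \<Sum>y\<in>?X. (\<Prod>d\<in>drum_darts s. sbinom n (k d)) *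
       (?A k x *
        ?B k c *
        ?C k y))"
      by (simp only: sum_distrib_left)
    also have "\<dots> = (\<Sum>x\<in>?X. \<Sum>c\<in>?X. \<Sum>y\<in>?X. ?G k x c y)"
    proof (intro sum.cong refl, goal_cases)
      case (1 x c y)
      \<comment> \<open>Shifts the constraint at the far end of each cycle edge to the index of the
        vertex there, so that index \<open>i\<close> involves only the corners at the rung
        \<open>i\<close>.\<close>
      have h1: "(\<Prod>i<s. of_bool (\<phi> k (6 * cyc_prev s i) = ?N - x i) :: real) = (\<Prod>i<s. of_bool (\<phi> k (6*i) = ?N - x (cyc_next s i)))"
        by (rule prod_cyc_prev[of "\<lambda>i j. of_bool (\<phi> k (6 * j) = ?N - x i)"])
      have h2: "(\<Prod>i<s. of_bool (\<phi> k (6 * cyc_prev s i + 3) = y i) :: real) = (\<Prod>i<s. of_bool (\<phi> k (6*i+3) = y (cyc_next s i)))"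
        by (rule prod_cyc_prev[of "\<lambda>i j. of_bool (\<phi> k (6 * j + 3) = y i)"])
      show ?case
        unfolding \<Phi>_def fl[symmetric] drum_darts_def prod_lessThan_6 of_bool_conj prod.distrib h1 h2
        by (simp only: mult_ac)
    qed
    finally show ?thesis .
  qed
  have vertex: "(\<Sum>a\<le>n. \<Sum>b\<le>n. \<Sum>e\<le>n. \<Sum>a'\<le>n. \<Sum>b'\<le>n. \<Sum>e'\<le>n. \<Phi> x c y i a b e a' b' e')
    = threej n (x i) (c i) (?N - x (cyc_next s i)) * threej n (y i) (c i) (?N - y (cyc_next s i))" for x c y i
  proof -
    have m: "(-1::real)^n * (-1)^n = 1" by (simp flip: power_add)
    \<comment> \<open>The outer vertex meets its legs in reversed order, and the inner one, up to a
      cyclic shift, has complemented labels. Each contributes a sign \<open>(-1)^n\<close>, and the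
      two signs cancel.\<close>
    have r1: "threej n (?N - x (cyc_next s i)) (c i) (x i) = (-1)^n * threej n (x i) (c i) (?N - x (cyc_next s i))"
      by (rule threej_reverse)
    have r2: "threej n (?N - c i) (y (cyc_next s i)) (?N - y i) = (-1)^n * threej n (y i) (c i) (?N - y (cyc_next s i))"
      using threej_complement[of n "c i" "?N - y (cyc_next s i)" "y i"] threej_cyclic[of n "y i" "c i" "?N - y (cyc_next s i)"] by simp
    have "(\<Sum>a\<le>n. \<Sum>b\<le>n. \<Sum>e\<le>n. \<Sum>a'\<le>n. \<Sum>b'\<le>n. \<Sum>e'\<le>n. \<Phi> x c y i a b e a' b' e')
      = threej n (?N - x (cyc_next s i)) (c i) (x i) * threej n (?N - c i) (y (cyc_next s i)) (?N - y i)"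
      unfolding \<Phi>_def sum_six_split threej_flow ..
    also have "\<dots> = ((-1)^n * (-1)^n) * (threej n (x i) (c i) (?N - x (cyc_next s i)) * threej n (y i) (c i) (?N - y (cyc_next s i)))"
      unfolding r1 r2 by (simp only: mult_ac)
    finally show ?thesis unfolding m by simp
  qed
  have "(\<Sum>k\<in>?K. (\<Prod>d\<in>drum_darts s. sbinom n (k d)) * (\<Prod>d\<in>reps. edge_weight k d))
     = (\<Sum>k\<in>?K. \<Sum>x\<in>?X. \<Sum>c\<in>?X. \<Sum>y\<in>?X. ?G k x c y)"
    by (intro sum.cong refl term_eq)
  also have "\<dots> = (\<Sum>x\<in>?X. \<Sum>k\<in>?K. \<Sum>c\<in>?X. \<Sum>y\<in>?X. ?G k x c y)"
    by (rule sum.swap)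
  also have "\<dots> = (\<Sum>x\<in>?X. \<Sum>c\<in>?X. \<Sum>k\<in>?K. \<Sum>y\<in>?X. ?G k x c y)"
    by (rule sum.cong[OF refl], rule sum.swap)
  also have "\<dots> = (\<Sum>x\<in>?X. \<Sum>c\<in>?X. \<Sum>y\<in>?X. \<Sum>k\<in>?K. ?G k x c y)"
    by (rule sum.cong[OF refl], rule sum.cong[OF refl], rule sum.swap)
  also have "\<dots> = (\<Sum>x\<in>?X. \<Sum>c\<in>?X. \<Sum>y\<in>?X. ?H c x y)"
  proof (intro sum.cong refl, goal_cases)
    case (1 x c y)
    show ?case unfolding sum_distrib_left[symmetric] K_eq sum_PiE_lessThan_6 vertex prod.distrib
      by (simp only: mult_ac)
  qed
  also have "\<dots> = (\<Sum>c\<in>?X. \<Sum>x\<in>?X. \<Sum>y\<in>?X. ?H c x y)"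
    by (rule sum.swap)
  also have "\<dots> = (\<Sum>c\<in>?X. (\<Prod>i<s. sweight n (c i)) * (wheel_sum n s c)^2)"
    unfolding wheel_sum_def power2_eq_square
    by (simp only: sum_distrib_right[symmetric] sum_distrib_left[symmetric])
  also have "\<dots> = (\<Sum>c\<in>?X. (-1)^(n * s) * ((\<Prod>i<s. weight n (c i)) * (wheel_sum n s c)^2))"
    by (intro sum.cong refl wheel_sum_sign)
  also have "\<dots> = (-1)^(n * s) * wheel n s"
    using s by (subst wheel_eq) (simp_all add: sum_distrib_left)
  finally have "real_of_int (penrose_eval (drum_darts s) (drum_alpha s) drum_rot (\<lambda>d. n * 2)) = \<zeta> * ((-1)^(n * s) * wheel n s)"
    unfolding z(2) by simp
  moreover have "wheel n s \<ge> 0" unfolding wheel_def by (intro sum_nonneg) simp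
  ultimately show ?thesis using z(1) by (simp add: abs_mult power_abs)
qed

theorem theorem3:
  fixes s :: nat
  assumes "s \<ge> 2"
  shows "spectral_radius_sn (drum_darts s) (drum_alpha s) drum_rot (\<lambda>_. 2) = ereal (3 ^ (3 * s))"
proof -
  define a where "a n = standard_eval (drum_darts s) (drum_alpha s) drum_rot (\<lambda>d. n * 2)" for n
  have "\<bar>a n\<bar> = wheel n s / (fact n)^(6 * s)" for n
  proof -
    \<comment> \<open>There is one corner per dart, hence \<open>6*s\<close> corners with
      \<open>n\<close> arcs each.\<close>
    have "(\<Prod>d\<in>drum_darts s. fact (corner drum_rot (\<lambda>d. n * 2) d) :: real) = (fact n)^(6 * s)"
      by (simp add: corner_def drum_darts_def)
    then show ?thesis unfolding a_def standard_eval_def using penrose_drum[OF assms, of n] by (simp add: abs_divide)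
  qed
  then have "conv_radius a = ereal (1 / 27^s)" by (rule conv_radius_wheel[OF assms])
  then have "inverse (conv_radius a) = ereal (3 ^ (3 * s))"
    by (simp add: power_mult)
  then show ?thesis by (simp add: spectral_radius_sn_def a_def[abs_def])
qed

end
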